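(* Let $k\geq 8$, $l\geq 2$ be integers and write $l=qk+r$ with $q,r$ integers and $-2\leq r\leq k-3$. Then $\mu(k,l)=k!\,(l!)^k$. Moreover, if $l=2$ then $\chi(k,l)=2k$, and otherwise $$\chi(k,l)=\begin{cases} ((q+1)!)^k\,(q!)^{k^2-2k}\,((q-1)!)^k&\text{ if } r=0,\\ ((q+1)!)^{rk}\,(q!)^{k^2-rk}&\text{ if } 3\leq r\leq k-3,\\ ((q+r)!)^{k+\lceil k/2\rceil }\,(q!)^{k^2-k-2\lceil k/2\rceil}\,((q-r)!)^{\lceil k/2\rceil}&\text{ if } r=\pm1,\\ ((q+\varepsilon)!)^{2k+1}\,(q!)^{k^2-2k-2}\,(q-\varepsilon)!&\text{ if } r=2\varepsilon\text{ with }\varepsilon=\pm1. \end{cases}$$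
   Context: A multigraph is a triple $\Gamma=(V,E,I)$ with vertex set $V$, edge set $E$, and an incidence relation $I$ such that each $e\in E$ is incident with exactly two distinct vertices (multiple edges between the same pair of vertices are allowed). For integers $k,l$, a $(k,l)$-bipartite graph is an $l$-regular bipartite multigraph with bipartite blocks of size $k$, one of which is coloured black and the other white (all edges join a black vertex to a white vertex). An automorphism of a vertex-coloured multigraph $\Gamma$ is a pair $(\varphi_V,\varphi_E)$ where $\varphi_V$ is a colour-preserving bijection $V\to V$ and $\varphi_E$ is a bijection $E\to E$ such that $(v,e)\in I$ if and only if $(\varphi_V(v),\varphi_E(e))\in I$; $\mathrm{Aut}(\Gamma)$ is the group of all automorphisms. Let $\mathcal{A}(k,l)=\{|\mathrm{Aut}(\Gamma)| : \Gamma \text{ a } (k,l)\text{-bipartite graph}\}$, $\chi(k,l)=\min\mathcal{A}(k,l)$ and $\mu(k,l)=\max\mathcal{A}(k,l)$. *)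

theory Defs
  imports Complex_Main "HOL-Combinatorics.Permutations"
begin

record ('v, 'e) multigraph =
  verts :: "'v set"
  edges :: "'e set"
  inc :: "('v \<times> 'e) set"

record ('v, 'e, 'c) coloured_multigraph = "('v, 'e) multigraph" +
  colour :: "'v \<Rightarrow> 'c"

definition is_multigraph :: "('v, 'e, 'x) multigraph_scheme \<Rightarrow> bool" where
  "is_multigraph \<Gamma> \<longleftrightarrow>
     inc \<Gamma> \<subseteq> verts \<Gamma> \<times> edges \<Gamma> \<and>
     (\<forall>e\<in>edges \<Gamma>. card {v \<in> verts \<Gamma>. (v, e) \<in> inc \<Gamma>} = 2)"

(* Automorphisms are pairs of bijections of verts and edges.  "permutes" makes each component
   the identity outside its carrier, so that every automorphism is represented by exactly one
   pair of total functions and card (Aut \<Gamma>) is the order of the group. *)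
definition Aut :: "('v, 'e, 'c, 'x) coloured_multigraph_scheme \<Rightarrow> (('v \<Rightarrow> 'v) \<times> ('e \<Rightarrow> 'e)) set" where
  "Aut \<Gamma> = {(\<phi>V, \<phi>E).
     \<phi>V permutes verts \<Gamma> \<and> \<phi>E permutes edges \<Gamma> \<and>
     (\<forall>v\<in>verts \<Gamma>. colour \<Gamma> (\<phi>V v) = colour \<Gamma> v) \<and>
     (\<forall>v\<in>verts \<Gamma>. \<forall>e\<in>edges \<Gamma>. (v, e) \<in> inc \<Gamma> \<longleftrightarrow> (\<phi>V v, \<phi>E e) \<in> inc \<Gamma>)}"

datatype bw = Black | White

definition kl_bipartite :: "nat \<Rightarrow> nat \<Rightarrow> ('v, 'e, bw) coloured_multigraph \<Rightarrow> bool" where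
  "kl_bipartite k l \<Gamma> \<longleftrightarrow>
     is_multigraph \<Gamma> \<and> finite (verts \<Gamma>) \<and> finite (edges \<Gamma>) \<and>
     card {v \<in> verts \<Gamma>. colour \<Gamma> v = Black} = k \<and>
     card {v \<in> verts \<Gamma>. colour \<Gamma> v = White} = k \<and>
     (\<forall>e\<in>edges \<Gamma>. \<exists>b w. (b, e) \<in> inc \<Gamma> \<and> (w, e) \<in> inc \<Gamma> \<and>
        colour \<Gamma> b = Black \<and> colour \<Gamma> w = White) \<and>
     (\<forall>v\<in>verts \<Gamma>. card {e \<in> edges \<Gamma>. (v, e) \<in> inc \<Gamma>} = l)"

(* Vertices and edges are drawn from nat; by card_Aut_in_aut_orders below this loses no
   (k,l)-bipartite graph up to isomorphism. *)
definition aut_orders :: "nat \<Rightarrow> nat \<Rightarrow> nat set" where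
  "aut_orders k l =
     {card (Aut \<Gamma>) | \<Gamma> :: (nat, nat, bw) coloured_multigraph. kl_bipartite k l \<Gamma>}"

(* Min and Max are meaningful here: aut_orders k l is finite (finite_aut_orders). *)
definition chi :: "nat \<Rightarrow> nat \<Rightarrow> nat" where
  "chi k l = Min (aut_orders k l)"

definition mu :: "nat \<Rightarrow> nat \<Rightarrow> nat" where
  "mu k l = Max (aut_orders k l)"

lemma card_verts_kl_bipartite:
  assumes "kl_bipartite k l \<Gamma>"
  shows "card (verts \<Gamma>) = 2 * k"
proof -
  have fin: "finite (verts \<Gamma>)"
    using assms by (simp add: kl_bipartite_def)
  have "verts \<Gamma> = {v \<in> verts \<Gamma>. colour \<Gamma> v = Black} \<union> {v \<in> verts \<Gamma>. colour \<Gamma> v = White}"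
    using bw.exhaust by auto
  then have "card (verts \<Gamma>) = card {v \<in> verts \<Gamma>. colour \<Gamma> v = Black}
      + card {v \<in> verts \<Gamma>. colour \<Gamma> v = White}"
    using fin by (subst card_Un_disjoint [symmetric]) auto
  then show ?thesis
    using assms by (simp add: kl_bipartite_def)
qed

lemma card_edges_kl_bipartite:
  assumes "kl_bipartite k l \<Gamma>"
  shows "card (edges \<Gamma>) = k * l"
proof -
  have fin: "finite (verts \<Gamma>)" "finite (edges \<Gamma>)"
    and two: "\<And>e. e \<in> edges \<Gamma> \<Longrightarrow> card {v \<in> verts \<Gamma>. (v, e) \<in> inc \<Gamma>} = 2"
    and reg: "\<And>v. v \<in> verts \<Gamma> \<Longrightarrow> card {e \<in> edges \<Gamma>. (v, e) \<in> inc \<Gamma>} = l"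
    using assms by (auto simp: kl_bipartite_def is_multigraph_def)
  have "2 * card (edges \<Gamma>) = (\<Sum>e\<in>edges \<Gamma>. card {v \<in> verts \<Gamma>. (v, e) \<in> inc \<Gamma>})"
    using two by simp
  also have "\<dots> = (\<Sum>v\<in>verts \<Gamma>. card {e \<in> edges \<Gamma>. (v, e) \<in> inc \<Gamma>})"
    by (rule sum_multicount_gen) (use fin in auto)
  also have "\<dots> = l * (2 * k)"
    using reg card_verts_kl_bipartite [OF assms] by simp
  finally show ?thesis by simp
qed

lemma finite_aut_orders: "finite (aut_orders k l)"
proof (rule finite_subset)
  show "aut_orders k l \<subseteq> {..fact (2 * k) * fact (k * l)}"
  proof
    fix n assume "n \<in> aut_orders k l"
    then obtain \<Gamma> :: "(nat, nat, bw) coloured_multigraph"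
      where n: "n = card (Aut \<Gamma>)" and kl: "kl_bipartite k l \<Gamma>"
      by (auto simp: aut_orders_def)
    have fin: "finite (verts \<Gamma>)" "finite (edges \<Gamma>)"
      using kl by (auto simp: kl_bipartite_def)
    let ?P = "{p. p permutes verts \<Gamma>} \<times> {p. p permutes edges \<Gamma>}"
    have "n \<le> card ?P"
      unfolding n using fin by (intro card_mono) (auto simp: Aut_def finite_permutations)
    also have "card ?P = fact (2 * k) * fact (k * l)"
      using card_permutations [OF card_verts_kl_bipartite [OF kl] fin(1)]
        card_permutations [OF card_edges_kl_bipartite [OF kl] fin(2)]
      by (simp add: card_cartesian_product)
    finally show "n \<in> {..fact (2 * k) * fact (k * l)}" by simp
  qed
qed simp

lemma card_Aut_in_aut_orders:
  fixes \<Gamma> :: "('v, 'e, bw) coloured_multigraph"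
  assumes kl: "kl_bipartite k l \<Gamma>"
  shows "card (Aut \<Gamma>) \<in> aut_orders k l"
proof -
  define V where "V = verts \<Gamma>"
  define E where "E = edges \<Gamma>"
  have fin: "finite V" "finite E" and incs: "inc \<Gamma> \<subseteq> V \<times> E"
    using kl by (auto simp: kl_bipartite_def is_multigraph_def V_def E_def)
  obtain f :: "'v \<Rightarrow> nat" where f: "inj_on f V"
    using finite_imp_inj_to_nat_seg [OF fin(1)] by blast
  obtain g :: "'e \<Rightarrow> nat" where g: "inj_on g E"
    using finite_imp_inj_to_nat_seg [OF fin(2)] by blast
  define \<Delta> :: "(nat, nat, bw) coloured_multigraph" where
    "\<Delta> = \<lparr>verts = f ` V, edges = g ` E, inc = map_prod f g ` inc \<Gamma>,
          colour = colour \<Gamma> \<circ> inv_into V f\<rparr>"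
  have [simp]: "verts \<Delta> = f ` V" "edges \<Delta> = g ` E"
    by (simp_all add: \<Delta>_def)
  have inc: "(f v, g e) \<in> inc \<Delta> \<longleftrightarrow> (v, e) \<in> inc \<Gamma>" if "v \<in> V" "e \<in> E" for v e
  proof
    assume "(f v, g e) \<in> inc \<Delta>"
    then obtain v' e' where "(v', e') \<in> inc \<Gamma>" "f v = f v'" "g e = g e'"
      by (auto simp: \<Delta>_def)
    moreover from this have "v' = v" "e' = e"
      using that incs f g by (auto dest: inj_onD)
    ultimately show "(v, e) \<in> inc \<Gamma>" by simp
  qed (force simp: \<Delta>_def)
  have col: "colour \<Delta> (f v) = colour \<Gamma> v" if "v \<in> V" for v
    using that f by (simp add: \<Delta>_def)
  have cardV: "card {x \<in> f ` V. P x} = card {v \<in> V. P (f v)}" for P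
  proof -
    have "{x \<in> f ` V. P x} = f ` {v \<in> V. P (f v)}" by auto
    then show ?thesis using f by (simp add: card_image inj_on_def)
  qed
  have cardE: "card {x \<in> g ` E. P x} = card {e \<in> E. P (g e)}" for P
  proof -
    have "{x \<in> g ` E. P x} = g ` {e \<in> E. P (g e)}" by auto
    then show ?thesis using g by (simp add: card_image inj_on_def)
  qed
  have "kl_bipartite k l \<Delta>"
    unfolding kl_bipartite_def is_multigraph_def
  proof (intro conjI)
    show "inc \<Delta> \<subseteq> verts \<Delta> \<times> edges \<Delta>"
      using incs by (auto simp: \<Delta>_def)
    show "\<forall>e\<in>edges \<Delta>. card {v \<in> verts \<Delta>. (v, e) \<in> inc \<Delta>} = 2"
      using kl by (auto simp: cardV inc kl_bipartite_def is_multigraph_def cong: conj_cong simp flip: V_def E_def)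
    show "finite (verts \<Delta>)" "finite (edges \<Delta>)"
      using fin by auto
    show "card {v \<in> verts \<Delta>. colour \<Delta> v = Black} = k" "card {v \<in> verts \<Delta>. colour \<Delta> v = White} = k"
      using kl by (auto simp: cardV col kl_bipartite_def cong: conj_cong simp flip: V_def)
    show "\<forall>v\<in>verts \<Delta>. card {e \<in> edges \<Delta>. (v, e) \<in> inc \<Delta>} = l"
      using kl by (auto simp: cardE inc kl_bipartite_def cong: conj_cong simp flip: V_def E_def)
    show "\<forall>e\<in>edges \<Delta>. \<exists>b w. (b, e) \<in> inc \<Delta> \<and> (w, e) \<in> inc \<Delta> \<and>
        colour \<Delta> b = Black \<and> colour \<Delta> w = White"
    proof
      fix e' assume "e' \<in> edges \<Delta>"
      then obtain e where e: "e \<in> E" "e' = g e" by auto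
      then obtain b w where "(b, e) \<in> inc \<Gamma>" "(w, e) \<in> inc \<Gamma>"
        "colour \<Gamma> b = Black" "colour \<Gamma> w = White"
        using kl by (auto simp: kl_bipartite_def E_def)
      moreover from this have "b \<in> V" "w \<in> V" using incs by auto
      ultimately have "(f b, e') \<in> inc \<Delta> \<and> (f w, e') \<in> inc \<Delta> \<and>
          colour \<Delta> (f b) = Black \<and> colour \<Delta> (f w) = White"
        using e inc col by simp
      then show "\<exists>b w. (b, e') \<in> inc \<Delta> \<and> (w, e') \<in> inc \<Delta> \<and>
          colour \<Delta> b = Black \<and> colour \<Delta> w = White" by blast
    qed
  qed
  moreover have "card (Aut \<Delta>) = card (Aut \<Gamma>)"
  proof -
    define F where "F = (\<lambda>\<pi> x. if x \<in> f ` V then f (\<pi> (inv_into V f x)) else x)"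
    define G where "G = (\<lambda>\<pi> x. if x \<in> g ` E then g (\<pi> (inv_into E g x)) else x)"
    have bF: "bij_betw F {\<pi>. \<pi> permutes V} {\<pi>. \<pi> permutes f ` V}"
      unfolding F_def by (rule bij_betw_permutations) (use f in \<open>simp add: bij_betw_def\<close>)
    have bG: "bij_betw G {\<pi>. \<pi> permutes E} {\<pi>. \<pi> permutes g ` E}"
      unfolding G_def by (rule bij_betw_permutations) (use g in \<open>simp add: bij_betw_def\<close>)
    have F: "F p (f v) = f (p v)" if "v \<in> V" for p v
      using that f by (simp add: F_def)
    have G: "G p (g e) = g (p e)" if "e \<in> E" for p e
      using that g by (simp add: G_def)
    let ?P = "{\<pi>. \<pi> permutes V} \<times> {\<pi>. \<pi> permutes E}"
    let ?Q = "{\<pi>. \<pi> permutes f ` V} \<times> {\<pi>. \<pi> permutes g ` E}"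
    have b: "bij_betw (map_prod F G) ?P ?Q"
      using bF bG by (rule bij_betw_map_prod)
    have iff: "map_prod F G x \<in> Aut \<Delta> \<longleftrightarrow> x \<in> Aut \<Gamma>" if xP: "x \<in> ?P" for x
    proof -
      obtain p q where x: "x = (p, q)" and pq: "p permutes V" "q permutes E"
        using xP by auto
      have FG: "F p permutes f ` V" "G q permutes g ` E"
        using bij_betwE [OF bF] bij_betwE [OF bG] pq by blast+
      have pV: "p v \<in> V" if "v \<in> V" for v using that pq by (simp add: permutes_in_image)
      have qE: "q e \<in> E" if "e \<in> E" for e using that pq by (simp add: permutes_in_image)
      have "(\<forall>v\<in>f ` V. colour \<Delta> (F p v) = colour \<Delta> v) \<longleftrightarrow>
          (\<forall>v\<in>V. colour \<Gamma> (p v) = colour \<Gamma> v)"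
        by (simp add: F col pV)
      moreover have "(\<forall>v\<in>f ` V. \<forall>e\<in>g ` E. (v, e) \<in> inc \<Delta> \<longleftrightarrow> (F p v, G q e) \<in> inc \<Delta>) \<longleftrightarrow>
          (\<forall>v\<in>V. \<forall>e\<in>E. (v, e) \<in> inc \<Gamma> \<longleftrightarrow> (p v, q e) \<in> inc \<Gamma>)"
        by (simp add: F G inc pV qE)
      ultimately show ?thesis
        using pq FG unfolding x Aut_def V_def [symmetric] E_def [symmetric]
        by simp
    qed
    have sub: "Aut \<Gamma> \<subseteq> ?P"
      by (auto simp: Aut_def V_def E_def)
    have "map_prod F G ` Aut \<Gamma> = Aut \<Delta>"
    proof
      show "map_prod F G ` Aut \<Gamma> \<subseteq> Aut \<Delta>"
        using iff [OF subsetD [OF sub]] by (intro image_subsetI) simp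
      show "Aut \<Delta> \<subseteq> map_prod F G ` Aut \<Gamma>"
      proof
        fix y assume y: "y \<in> Aut \<Delta>"
        then have "y \<in> ?Q" by (auto simp: Aut_def)
        then have "y \<in> map_prod F G ` ?P"
          using bij_betw_imp_surj_on [OF b] by simp
        then obtain x where x: "x \<in> ?P" "y = map_prod F G x"
          by (rule imageE)
        then have "x \<in> Aut \<Gamma>" using iff y by simp
        then show "y \<in> map_prod F G ` Aut \<Gamma>" unfolding x(2) by (rule imageI)
      qed
    qed
    moreover have "inj_on (map_prod F G) (Aut \<Gamma>)"
      using inj_on_subset [OF bij_betw_imp_inj_on [OF b] sub] .
    ultimately show ?thesis using card_image by fastforce
  qed
  ultimately show ?thesis
    unfolding aut_orders_def by force
qed

end

theory Submission
  imports Defs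
begin

text \<open>
  Number the black and the white vertices of a \<open>(k, l)\<close>-bipartite graph and let \<open>M i j\<close> be the number
  of edges between the \<open>i\<close>-th black and the \<open>j\<close>-th white vertex.  This is a \<open>k \<times> k\<close> matrix of natural
  numbers all of whose rows and columns sum to \<open>l\<close>, and every such matrix occurs.  A pair of row and
  column permutations preserves the graph exactly if it preserves \<open>M\<close>, and then each bundle of
  \<open>M i j\<close> parallel edges can be mapped in \<open>fact (M i j)\<close> ways.  Hence the order of the automorphism
  group is the number of symmetries of \<open>M\<close> times the product of all \<open>fact (M i j)\<close>
  (\<open>card_edge_aut\<close>, \<open>aut_ordersE\<close>, \<open>aut_ordersI\<close>).

  The maximum: an automorphism is determined by its action on edges, and that action permutes the
  \<open>k\<close> stars of \<open>l\<close> edges at the black vertices.  There are \<open>fact k * fact l ^ k\<close> edge permutations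
  with this property, and all of them are automorphisms if the stars are bundles (\<open>mu_eq\<close>).

  The minimum for \<open>l = 2\<close>: each of the \<open>2 * k\<close> edges has one other edge at its black end and one at
  its white end.  Permutations that commute with these two involutions are automorphisms, and they
  can act on every connected component independently and transitively on its edges.  So the order is
  at least the product, hence at least the sum, of the component sizes (\<open>card_centraliser\<close>); a single
  cycle attains \<open>2 * k\<close>.

  The minimum for \<open>l > 2\<close>: write \<open>l = q * k + r\<close> with \<open>r = \<epsilon> * c\<close>, \<open>c \<ge> 0\<close>, and \<open>M = q + \<epsilon> * D\<close>, so
  that \<open>D\<close> is an integer matrix with line sums \<open>c\<close>.  If \<open>x\<close> is the sum of the absolute values of the
  negative entries of \<open>D\<close>, then the positive entries sum to \<open>k * c + x\<close>.  For \<open>q \<ge> 1\<close>, each unit of \<open>x\<close>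
  raises a lower bound for the product of factorials by the factor \<open>(q + 1) / q\<close>, which is at most 2
  (\<open>prod_fact_weight\<close>).  The claimed value belongs to a matrix \<open>D\<close> with entries \<open>-1, 0, 1\<close>, no
  symmetry but the identity, and \<open>x = h\<close>, where \<open>h\<close> is \<open>k\<close>, half of \<open>k\<close> rounded up, 1, or 0
  according to whether \<open>c\<close> is 0, 1, 2, or larger.  Two facts make this optimal.

  A matrix \<open>D\<close> with \<open>x < h\<close> has at least \<open>2 ^ (h - x)\<close> symmetries
  (\<open>card_mat_aut_ge_cancellations\<close>), which outweighs what it saves in the factorials
  (\<open>weight_tradeoff\<close>).  The reason is that a line without a negative entry is very restricted: it is
  zero if \<open>c = 0\<close> and a unit vector if \<open>c = 1\<close>, so many lines coincide, or many entries are alone in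
  their row and column.  For both values of \<open>c\<close> one borderline case escapes this count, and there \<open>D\<close>
  consists, up to leaves, of cycles with alternating signs, which can be rotated.  If \<open>c = 2\<close> and
  \<open>x = 0\<close>, then \<open>D\<close> is the matrix of a two-regular graph.

  Matrices without symmetry and with \<open>x = h\<close> exist (\<open>ex_rigid\<close>).  If \<open>c = 0\<close> or \<open>c = 1\<close>, they are built
  from two directed cycles of different lengths through one common vertex; if \<open>c = 2\<close>, from three
  paths of different lengths with common ends; and if \<open>c \<ge> 3\<close>, from the matrix whose rows are the
  cyclic intervals of length \<open>c\<close>, after a change in three rows, or from the complement of such a
  matrix.
\<close>

section \<open>Counting permutations that respect a labelling\<close>

lemma permutes_if_inj_on:
  assumes "finite S" "inj_on f S" "f ` S \<subseteq> S" "\<And>x. x \<notin> S \<Longrightarrow> f x = x"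
  shows "f permutes S"
  using assms by (intro bij_imp_permutes) (simp_all add: bij_betw_def endo_inj_surj)

text \<open>
  The permutations of \<open>E\<close> that induce the map \<open>\<pi>\<close> on the labels: \<open>g\<close> will be the black end of an
  edge, or both ends at once.
\<close>

definition lifts :: "'e set \<Rightarrow> ('e \<Rightarrow> 'x) \<Rightarrow> ('x \<Rightarrow> 'x) \<Rightarrow> ('e \<Rightarrow> 'e) set" where
  "lifts E g \<pi> = {q. q permutes E \<and> (\<forall>e\<in>E. g (q e) = \<pi> (g e))}"

text \<open>
  Such a permutation is an independent choice of one permutation of each fibre of \<open>g\<close>; the induction
  splits off one fibre at a time.
\<close>

lemma card_lifts_id:
  fixes E :: "'e set"
  assumes "finite X" "finite E" "g ` E \<subseteq> X"
  shows "card (lifts E g id) = (\<Prod>x\<in>X. fact (card {e\<in>E. g e = x}))"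
  using assms
proof (induction X arbitrary: E rule: finite_induct)
  case empty
  then show ?case by (simp add: lifts_def)
next
  case (insert x X)
  define A where "A = {e\<in>E. g e = x}"
  define B where "B = {e\<in>E. g e \<noteq> x}"
  have fin: "finite A" "finite B" and AB: "E = A \<union> B" "A \<inter> B = {}"
    and nAB: "\<And>e. e \<in> A \<Longrightarrow> e \<notin> B" "\<And>e. e \<in> B \<Longrightarrow> e \<notin> A"
    using insert.prems by (auto simp: A_def B_def)
  \<comment> \<open>restriction to a union of fibres, extended by the identity\<close>
  define res :: "'e set \<Rightarrow> ('e \<Rightarrow> 'e) \<Rightarrow> 'e \<Rightarrow> 'e" where "res C q = (\<lambda>e. if e \<in> C then q e else e)" for C q
  have res: "res C q permutes C" if q: "q permutes E" "\<forall>e\<in>E. g (q e) = g e"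
      and C: "C \<subseteq> E" "\<And>e e'. e \<in> E \<Longrightarrow> e' \<in> C \<Longrightarrow> g e = g e' \<Longrightarrow> e \<in> C" for C q
  proof (rule bij_imp_permutes)
    have "inj_on (res C q) C"
      using permutes_inj[OF q(1)] by (auto simp: res_def inj_on_def)
    moreover have "res C q ` C \<subseteq> C"
    proof
      fix y assume "y \<in> res C q ` C"
      then obtain e where e: "e \<in> C" "y = q e" by (auto simp: res_def)
      have "q e \<in> E" using e C(1) q(1) by (simp add: permutes_in_image subset_iff)
      then show "y \<in> C" using C(2)[of "q e" e] e C(1) q(2) by auto
    qed
    moreover have "finite C" using C(1) insert.prems(1) finite_subset by blast
    ultimately show "bij_betw (res C q) C C"
      by (simp add: bij_betw_def endo_inj_surj)
  qed (simp add: res_def)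
  have "bij_betw (\<lambda>(p, q). p \<circ> q) ({p. p permutes A} \<times> lifts B g id) (lifts E g id)"
  proof (rule bij_betw_byWitness[where f' = "\<lambda>q. (res A q, res B q)"])
    show "\<forall>a\<in>{p. p permutes A} \<times> lifts B g id.
        (\<lambda>q. (res A q, res B q)) ((\<lambda>(p, q). p \<circ> q) a) = a"
    proof (intro ballI)
      fix x assume "x \<in> {p. p permutes A} \<times> lifts B g id"
      then obtain p q where x: "x = (p, q)" and p: "p permutes A" and q: "q \<in> lifts B g id"
        by auto
      have q': "q permutes B" using q by (simp add: lifts_def)
      have "res A (p \<circ> q) = p"
        using nAB p q' by (auto simp: res_def fun_eq_iff permutes_not_in)
      moreover have "res B (p \<circ> q) = q"
      proof
        fix e show "res B (p \<circ> q) e = q e"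
        proof (cases "e \<in> B")
          case True
          then have "q e \<in> B" using q' by (simp add: permutes_in_image)
          then have "q e \<notin> A" using AB(2) by auto
          then show ?thesis using True p by (simp add: res_def permutes_not_in)
        qed (use q' in \<open>simp add: res_def permutes_not_in\<close>)
      qed
      ultimately show "(\<lambda>q. (res A q, res B q)) ((\<lambda>(p, q). p \<circ> q) x) = x" by (simp add: x)
    qed
    show "\<forall>q\<in>lifts E g id. (\<lambda>(p, q). p \<circ> q) (res A q, res B q) = q"
    proof
      fix q assume q: "q \<in> lifts E g id"
      have q1: "q permutes E" "\<forall>e\<in>E. g (q e) = g e" using q by (auto simp: lifts_def)
      show "(\<lambda>(p, q). p \<circ> q) (res A q, res B q) = q"
      proof
        fix e
        have "e \<in> B \<Longrightarrow> q e \<in> B"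
          using q1 by (auto simp: B_def permutes_in_image)
        then show "(\<lambda>(p, q). p \<circ> q) (res A q, res B q) e = q e"
          using AB q1(1) by (auto simp: res_def permutes_not_in)
      qed
    qed
    show "(\<lambda>(p, q). p \<circ> q) ` ({p. p permutes A} \<times> lifts B g id) \<subseteq> lifts E g id"
    proof clarify
      fix p q assume p: "p permutes A" and q: "q \<in> lifts B g id"
      have q': "q permutes B" "\<forall>e\<in>B. g (q e) = g e" using q by (auto simp: lifts_def)
      have "p \<circ> q permutes E"
        using p q'(1) AB by (intro permutes_compose) (auto intro: permutes_subset)
      moreover have "g (p (q e)) = g e" if "e \<in> E" for e
      proof (cases "e \<in> A")
        case True
        then have "q e = e" using nAB q'(1) by (auto simp: permutes_not_in)
        moreover have "p e \<in> A" using True p by (simp add: permutes_in_image)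
        ultimately show ?thesis using True by (simp add: A_def)
      next
        case False
        then have "e \<in> B" using that AB(1) by auto
        then have "q e \<in> B" using q'(1) by (simp add: permutes_in_image)
        then have "p (q e) = q e" using nAB p by (auto simp: permutes_not_in)
        then show ?thesis using \<open>e \<in> B\<close> q'(2) by simp
      qed
      ultimately show "p \<circ> q \<in> lifts E g id" by (simp add: lifts_def)
    qed
    show "(\<lambda>q. (res A q, res B q)) ` lifts E g id \<subseteq> {p. p permutes A} \<times> lifts B g id"
    proof (rule image_subsetI)
      fix q assume q: "q \<in> lifts E g id"
      have q1: "q permutes E" "\<forall>e\<in>E. g (q e) = g e" using q by (auto simp: lifts_def)
      have "res A q permutes A" "res B q permutes B"
        using q1 by (auto intro!: res simp: A_def B_def)
      moreover have "\<forall>e\<in>B. g (res B q e) = g e"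
        using q1(2) by (auto simp: res_def B_def)
      ultimately show "(res A q, res B q) \<in> {p. p permutes A} \<times> lifts B g id"
        by (simp add: lifts_def)
    qed
  qed
  then have "card (lifts E g id) = card ({p. p permutes A} \<times> lifts B g id)"
    by (rule bij_betw_same_card[symmetric])
  also have "\<dots> = fact (card A) * card (lifts B g id)"
    using fin(1) by (simp add: card_cartesian_product card_permutations)
  also have "card (lifts B g id) = (\<Prod>y\<in>X. fact (card {e\<in>B. g e = y}))"
    by (rule insert.IH[OF fin(2)]) (use insert.prems(2) in \<open>auto simp: B_def\<close>)
  also have "(\<Prod>y\<in>X. fact (card {e\<in>B. g e = y})) = ((\<Prod>y\<in>X. fact (card {e\<in>E. g e = y})) :: nat)"
    using insert.hyps by (intro prod.cong refl arg_cong[where f = fact] arg_cong[where f = card]) (auto simp: B_def)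
  finally show ?case using insert.hyps by (simp add: A_def)
qed

text \<open>
  If one lift \<open>q0\<close> of \<open>\<pi>\<close> exists, then composition with it turns the lifts of the identity into the
  lifts of \<open>\<pi>\<close>.  One exists as soon as \<open>\<pi>\<close> maps fibres to fibres of the same size.
\<close>

lemma card_lifts:
  assumes fin: "finite X" "finite E" and g: "g ` E \<subseteq> X" and \<pi>: "inj_on \<pi> X"
  shows "card (lifts E g \<pi>) =
    (if \<forall>x\<in>X. card {e\<in>E. g e = \<pi> x} = card {e\<in>E. g e = x}
     then \<Prod>x\<in>X. fact (card {e\<in>E. g e = x}) else 0)"
proof (cases "\<forall>x\<in>X. card {e\<in>E. g e = \<pi> x} = card {e\<in>E. g e = x}")
  case True
  have "\<forall>x\<in>X. \<exists>h. bij_betw h {e\<in>E. g e = x} {e\<in>E. g e = \<pi> x}"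
  proof
    fix x assume "x \<in> X"
    show "\<exists>h. bij_betw h {e\<in>E. g e = x} {e\<in>E. g e = \<pi> x}"
      by (rule finite_same_card_bij) (use bspec[OF True \<open>x \<in> X\<close>] fin in simp_all)
  qed
  from bchoice[OF this] obtain h
    where h: "\<And>x. x \<in> X \<Longrightarrow> bij_betw (h x) {e\<in>E. g e = x} {e\<in>E. g e = \<pi> x}"
    by blast
  define q0 where "q0 e = (if e \<in> E then h (g e) e else e)" for e
  have q0E: "q0 e \<in> E" "g (q0 e) = \<pi> (g e)" if "e \<in> E" for e
    using bij_betwE[OF h[of "g e"]] g that by (auto simp: q0_def)
  have "inj_on q0 E"
  proof (rule inj_onI)
    fix e e' assume e: "e \<in> E" "e' \<in> E" and eq: "q0 e = q0 e'"
    have "\<pi> (g e) = \<pi> (g e')" using q0E e eq by metis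
    then have "g e = g e'" using inj_onD[OF \<pi>, of "g e" "g e'"] g e by auto
    then show "e = e'"
      using bij_betw_imp_inj_on[OF h[of "g e"]] g e eq by (auto simp: q0_def inj_on_def)
  qed
  moreover have "q0 ` E \<subseteq> E" using q0E by auto
  ultimately have q0: "q0 permutes E"
    using fin(2) by (intro bij_imp_permutes) (simp_all add: bij_betw_def endo_inj_surj, simp add: q0_def)
  have "bij_betw (\<lambda>q. q0 \<circ> q) (lifts E g id) (lifts E g \<pi>)"
  proof (rule bij_betw_byWitness[where f' = "\<lambda>q. inv q0 \<circ> q"])
    show "(\<lambda>q. q0 \<circ> q) ` lifts E g id \<subseteq> lifts E g \<pi>"
      using q0 q0E by (auto simp: lifts_def permutes_compose permutes_in_image)
    show "(\<lambda>q. inv q0 \<circ> q) ` lifts E g \<pi> \<subseteq> lifts E g id"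
    proof clarify
      fix q assume "q \<in> lifts E g \<pi>"
      then have q: "q permutes E" "\<forall>e\<in>E. g (q e) = \<pi> (g e)" by (auto simp: lifts_def)
      have "g (inv q0 (q e)) = g e" if "e \<in> E" for e
      proof -
        have "inv q0 (q e) \<in> E"
          using that q q0 by (simp add: permutes_in_image permutes_inv)
        then have "\<pi> (g (inv q0 (q e))) = g (q0 (inv q0 (q e)))" using q0E by simp
        also have "\<dots> = \<pi> (g e)" using q that q0 by (simp add: permutes_inverses)
        finally show ?thesis
          using inj_onD[OF \<pi>, of "g (inv q0 (q e))" "g e"] g that \<open>inv q0 (q e) \<in> E\<close> by auto
      qed
      then show "inv q0 \<circ> q \<in> lifts E g id"
        using q q0 by (simp add: lifts_def permutes_compose permutes_inv)
    qed
  qed (use q0 in \<open>simp_all add: fun_eq_iff permutes_inverses\<close>)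
  then show ?thesis
    unfolding if_P[OF True] card_lifts_id[OF fin g, symmetric] by (rule bij_betw_same_card[symmetric])
next
  case False
  have "lifts E g \<pi> = {}"
  proof (rule ccontr)
    assume "lifts E g \<pi> \<noteq> {}"
    then obtain q where q: "q permutes E" "\<forall>e\<in>E. g (q e) = \<pi> (g e)" by (auto simp: lifts_def)
    have "card {e\<in>E. g e = \<pi> x} = card {e\<in>E. g e = x}" if "x \<in> X" for x
    proof -
      have *: "q ` {e\<in>E. g e = x} = {e\<in>E. g e = \<pi> x}"
      proof (intro equalityI subsetI)
        fix y assume y: "y \<in> {e\<in>E. g e = \<pi> x}"
        have e: "inv q y \<in> E" "q (inv q y) = y"
          using y q(1) by (auto simp: permutes_in_image permutes_inv permutes_inverses)
        then have "\<pi> (g (inv q y)) = \<pi> x" using q(2) y by force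
        then have "g (inv q y) = x" using inj_onD[OF \<pi>, of "g (inv q y)" x] g that e(1) by auto
        then show "y \<in> q ` {e\<in>E. g e = x}" using e by (auto intro: image_eqI[of _ _ "inv q y"])
      qed (use q in \<open>auto simp: permutes_in_image\<close>)
      moreover have "inj_on q {e\<in>E. g e = x}"
        using permutes_inj[OF q(1)] by (auto simp: inj_on_def)
      ultimately show ?thesis using card_image[of q "{e\<in>E. g e = x}"] by simp
    qed
    then show False using False by simp
  qed
  then show ?thesis by (simp only: card.empty if_not_P[OF False])
qed

section \<open>Regular bipartite multigraphs as matrices\<close>

definition mat_aut :: "nat \<Rightarrow> (nat \<Rightarrow> nat \<Rightarrow> 'a) \<Rightarrow> ((nat \<Rightarrow> nat) \<times> (nat \<Rightarrow> nat)) set" where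
  "mat_aut k M = {(\<sigma>, \<tau>). \<sigma> permutes {..<k} \<and> \<tau> permutes {..<k} \<and>
     (\<forall>i<k. \<forall>j<k. M (\<sigma> i) (\<tau> j) = M i j)}"

lemma finite_mat_aut [simp]: "finite (mat_aut k M)"
  by (rule finite_subset[of _ "{p. p permutes {..<k}} \<times> {p. p permutes {..<k}}"])
     (auto simp: mat_aut_def finite_permutations)

definition line_sums :: "nat \<Rightarrow> 'a \<Rightarrow> (nat \<Rightarrow> nat \<Rightarrow> 'a::comm_monoid_add) \<Rightarrow> bool" where
  "line_sums k l M \<longleftrightarrow>
     (\<forall>i<k. (\<Sum>j<k. M i j) = l) \<and> (\<forall>j<k. (\<Sum>i<k. M i j) = l)"

text \<open>
  The action of the automorphism group on the edges alone; \<open>bl e\<close> and \<open>wh e\<close> are the numbers of the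
  black and the white end of \<open>e\<close>.
\<close>

definition edge_aut :: "nat \<Rightarrow> 'e set \<Rightarrow> ('e \<Rightarrow> nat) \<Rightarrow> ('e \<Rightarrow> nat) \<Rightarrow> ('e \<Rightarrow> 'e) set" where
  "edge_aut k E bl wh = {q. q permutes E \<and> (\<exists>\<sigma> \<tau>. \<sigma> permutes {..<k} \<and> \<tau> permutes {..<k} \<and>
     (\<forall>e\<in>E. bl (q e) = \<sigma> (bl e) \<and> wh (q e) = \<tau> (wh e)))}"

definition edge_data :: "nat \<Rightarrow> nat \<Rightarrow> 'e set \<Rightarrow> ('e \<Rightarrow> nat) \<Rightarrow> ('e \<Rightarrow> nat) \<Rightarrow> bool" where
  "edge_data k l E bl wh \<longleftrightarrow> finite E \<and> bl ` E \<subseteq> {..<k} \<and> wh ` E \<subseteq> {..<k} \<and>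
     (\<forall>i<k. card {e\<in>E. bl e = i} = l) \<and> (\<forall>j<k. card {e\<in>E. wh e = j} = l)"

lemma edge_data_surj:
  assumes "edge_data k l E bl wh" "l \<ge> 1" "i < k"
  shows "\<exists>e\<in>E. bl e = i" "\<exists>e\<in>E. wh e = i"
proof -
  have "card {e\<in>E. bl e = i} = l" "card {e\<in>E. wh e = i} = l"
    using assms by (auto simp: edge_data_def)
  then have "{e\<in>E. bl e = i} \<noteq> {}" "{e\<in>E. wh e = i} \<noteq> {}" using assms(2) by force+
  then show "\<exists>e\<in>E. bl e = i" "\<exists>e\<in>E. wh e = i" by auto
qed

lemma permutes_lessThan_eqI:
  assumes "\<sigma> permutes {..<k::nat}" "\<sigma>' permutes {..<k}" "\<And>i. i < k \<Longrightarrow> \<sigma> i = \<sigma>' i"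
  shows "\<sigma> = \<sigma>'"
proof
  fix i show "\<sigma> i = \<sigma>' i"
    using assms by (cases "i < k") (auto simp: permutes_not_in)
qed

text \<open>
  Every vertex has an edge, so an edge permutation induces at most one pair of vertex permutations.
  The group is therefore the disjoint union, over all pairs of vertex permutations, of the lifts of
  the pair, and a pair has lifts exactly if it preserves all multiplicities.
\<close>

lemma card_edge_aut:
  assumes ed: "edge_data k l E bl wh" and l: "l \<ge> 1"
    and M: "\<And>i j. i < k \<Longrightarrow> j < k \<Longrightarrow> M i j = card {e\<in>E. bl e = i \<and> wh e = j}"
  shows "card (edge_aut k E bl wh) = card (mat_aut k M) * (\<Prod>i<k. \<Prod>j<k. fact (M i j))"
proof -
  let ?P = "{p. p permutes {..<k}} \<times> {p. p permutes {..<k}}"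
  let ?X = "{..<k} \<times> {..<k}"
  define g where "g e = (bl e, wh e)" for e
  define Q where "Q = (\<lambda>(\<sigma>, \<tau>). lifts E g (map_prod \<sigma> \<tau>))"
  have fE: "finite E" and gE: "g ` E \<subseteq> ?X" using ed by (auto simp: edge_data_def g_def)
  have perm: "inj_on (map_prod \<sigma> \<tau>) ?X" if "\<sigma> permutes {..<k}" "\<tau> permutes {..<k}" for \<sigma> \<tau>
    using that by (intro map_prod_inj_on) (simp_all add: permutes_inj_on)
  have "edge_aut k E bl wh = (\<Union>\<pi>\<in>?P. Q \<pi>)"
    by (auto simp: edge_aut_def Q_def lifts_def g_def)
  moreover have "card (\<Union>\<pi>\<in>?P. Q \<pi>) = (\<Sum>\<pi>\<in>?P. card (Q \<pi>))"
  proof (rule card_UN_disjoint)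
    show "finite ?P" by (simp add: finite_permutations)
    show "\<forall>\<pi>\<in>?P. finite (Q \<pi>)"
      using fE by (auto simp: Q_def lifts_def intro: finite_subset[OF _ finite_permutations[OF fE]])
    show "\<forall>\<pi>\<in>?P. \<forall>\<pi>'\<in>?P. \<pi> \<noteq> \<pi>' \<longrightarrow> Q \<pi> \<inter> Q \<pi>' = {}"
    proof (intro ballI impI)
      fix \<pi> \<pi>' assume \<pi>: "\<pi> \<in> ?P" "\<pi>' \<in> ?P" "\<pi> \<noteq> \<pi>'"
      obtain \<sigma> \<tau> \<sigma>' \<tau>' where eqs: "\<pi> = (\<sigma>, \<tau>)" "\<pi>' = (\<sigma>', \<tau>')" by fastforce
      have p: "\<sigma> permutes {..<k}" "\<tau> permutes {..<k}" "\<sigma>' permutes {..<k}" "\<tau>' permutes {..<k}"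
        and ne: "\<not> (\<sigma> = \<sigma>' \<and> \<tau> = \<tau>')"
        using \<pi> by (auto simp: eqs)
      show "Q \<pi> \<inter> Q \<pi>' = {}" unfolding eqs
      proof (rule ccontr)
        assume "Q (\<sigma>, \<tau>) \<inter> Q (\<sigma>', \<tau>') \<noteq> {}"
        then obtain q where q: "\<forall>e\<in>E. g (q e) = map_prod \<sigma> \<tau> (g e)" "\<forall>e\<in>E. g (q e) = map_prod \<sigma>' \<tau>' (g e)"
          by (auto simp: Q_def lifts_def)
        have eq: "\<sigma> (bl e) = \<sigma>' (bl e)" "\<tau> (wh e) = \<tau>' (wh e)" if "e \<in> E" for e
          using that bspec[OF q(1), of e] bspec[OF q(2), of e] by (simp_all add: g_def)
        have "\<sigma> = \<sigma>'"
        proof (rule permutes_lessThan_eqI[OF p(1,3)])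
          fix i assume "i < k"
          then obtain e where "e \<in> E" "bl e = i" using edge_data_surj(1)[OF ed l] by blast
          then show "\<sigma> i = \<sigma>' i" using eq(1)[of e] by simp
        qed
        moreover have "\<tau> = \<tau>'"
        proof (rule permutes_lessThan_eqI[OF p(2,4)])
          fix i assume "i < k"
          then obtain e where "e \<in> E" "wh e = i" using edge_data_surj(2)[OF ed l] by blast
          then show "\<tau> i = \<tau>' i" using eq(2)[of e] by simp
        qed
        ultimately show False using ne by simp
      qed
    qed
  qed
  moreover have "card (Q \<pi>) = (if \<pi> \<in> mat_aut k M then \<Prod>i<k. \<Prod>j<k. fact (M i j) else 0)"
    if "\<pi> \<in> ?P" for \<pi>
  proof -
    obtain \<sigma> \<tau> where \<pi>: "\<pi> = (\<sigma>, \<tau>)" and p: "\<sigma> permutes {..<k}" "\<tau> permutes {..<k}"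
      using \<open>\<pi> \<in> ?P\<close> by (cases \<pi>) auto
    have fib: "card {e\<in>E. g e = x} = M (fst x) (snd x)" if "x \<in> ?X" for x
      using that M by (auto simp: g_def prod_eq_iff)
    have lt: "\<sigma> i < k" "\<tau> i < k" if "i < k" for i
      using p that permutes_in_image by fastforce+
    have "card (Q \<pi>) = (if \<forall>x\<in>?X. card {e\<in>E. g e = map_prod \<sigma> \<tau> x} = card {e\<in>E. g e = x}
       then \<Prod>x\<in>?X. fact (card {e\<in>E. g e = x}) else 0)"
      unfolding \<pi> Q_def prod.case by (rule card_lifts[OF _ fE gE perm[OF p]]) simp
    also have "(\<Prod>x\<in>?X. fact (card {e\<in>E. g e = x})) = (\<Prod>x\<in>?X. (fact (M (fst x) (snd x)) :: nat))"
      using fib by (intro prod.cong) auto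
    also have "\<dots> = (\<Prod>i<k. \<Prod>j<k. fact (M i j))"
      by (simp add: prod.cartesian_product case_prod_beta)
    also have "(\<forall>x\<in>?X. card {e\<in>E. g e = map_prod \<sigma> \<tau> x} = card {e\<in>E. g e = x}) \<longleftrightarrow> \<pi> \<in> mat_aut k M"
      using fib lt p by (auto simp: \<pi> mat_aut_def)
    finally show ?thesis .
  qed
  moreover have "mat_aut k M \<subseteq> ?P" by (auto simp: mat_aut_def)
  ultimately show ?thesis
    by (simp add: sum.If_cases finite_permutations Int_absorb1)
qed


lemma line_sums_edge_data:
  assumes "edge_data k l E bl wh"
  shows "line_sums k l (\<lambda>i j. card {e\<in>E. bl e = i \<and> wh e = j})"
proof -
  have E: "finite E" "bl ` E \<subseteq> {..<k}" "wh ` E \<subseteq> {..<k}" using assms by (auto simp: edge_data_def)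
  have "(\<Sum>j<k. card {e\<in>E. bl e = i \<and> wh e = j}) = card {e\<in>E. bl e = i}" for i
    using sum.group[of "{e\<in>E. bl e = i}" "{..<k}" wh "\<lambda>_. 1::nat"] E
    by (auto simp: conj_assoc)
  moreover have "(\<Sum>i<k. card {e\<in>E. bl e = i \<and> wh e = j}) = card {e\<in>E. wh e = j}" for j
    using sum.group[of "{e\<in>E. wh e = j}" "{..<k}" bl "\<lambda>_. 1::nat"] E
    by (simp add: conj_assoc conj_commute[of "bl _ = _"] subset_trans[OF image_mono[OF Collect_restrict]])
  ultimately show ?thesis
    using assms by (simp add: line_sums_def edge_data_def)
qed

text \<open>
  Transport of a permutation along a bijection, without leaving the total functions that are the
  identity outside their carrier.
\<close>

lemma ex_permutation_conjugate:
  assumes fin: "finite A" and \<beta>: "bij_betw \<beta> A B" and p: "inj_on p B" "p ` B \<subseteq> B"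
  shows "\<exists>\<sigma>. \<sigma> permutes A \<and> (\<forall>i\<in>A. \<beta> (\<sigma> i) = p (\<beta> i))"
proof -
  define \<sigma> where "\<sigma> i = (if i \<in> A then inv_into A \<beta> (p (\<beta> i)) else i)" for i
  have pB: "p (\<beta> i) \<in> B" if "i \<in> A" for i
    using bij_betwE[OF \<beta>] p(2) that by auto
  have eq: "\<beta> (\<sigma> i) = p (\<beta> i)" if "i \<in> A" for i
    using bij_betw_inv_into_right[OF \<beta> pB[OF that]] that by (simp add: \<sigma>_def)
  have "\<sigma> i \<in> A" if "i \<in> A" for i
    using bij_betwE[OF bij_betw_inv_into[OF \<beta>]] pB[OF that] that by (auto simp: \<sigma>_def)
  moreover have "inj_on \<sigma> A"
  proof (rule inj_onI)
    fix i j assume ij: "i \<in> A" "j \<in> A" "\<sigma> i = \<sigma> j"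
    then have "p (\<beta> i) = p (\<beta> j)" using eq by metis
    then have "\<beta> i = \<beta> j" using inj_onD[OF p(1)] bij_betwE[OF \<beta>] ij by blast
    then show "i = j" using bij_betw_imp_inj_on[OF \<beta>] ij by (auto dest: inj_onD)
  qed
  ultimately have "\<sigma> permutes A"
    using fin by (intro permutes_if_inj_on) (auto simp: \<sigma>_def)
  then show ?thesis using eq by blast
qed

text \<open>
  Restriction to the edges is injective on automorphisms: an edge at \<open>v\<close> and the colour of \<open>v\<close>
  determine the image of \<open>v\<close>.  Conversely, the vertex permutations that witness membership in
  \<open>edge_aut\<close> transfer to the vertices through the numberings.
\<close>

lemma card_Aut_eq_card_edge_aut:
  fixes \<Gamma> :: "('v, 'e, bw) coloured_multigraph"
  assumes kl: "kl_bipartite k l \<Gamma>" and l: "l \<ge> 1"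
    and \<beta>: "bij_betw \<beta> {..<k} {v \<in> verts \<Gamma>. colour \<Gamma> v = Black}"
    and \<omega>: "bij_betw \<omega> {..<k} {v \<in> verts \<Gamma>. colour \<Gamma> v = White}"
    and lab: "\<And>e. e \<in> edges \<Gamma> \<Longrightarrow>
      bl e < k \<and> wh e < k \<and> (\<beta> (bl e), e) \<in> inc \<Gamma> \<and> (\<omega> (wh e), e) \<in> inc \<Gamma>"
  shows "card (Aut \<Gamma>) = card (edge_aut k (edges \<Gamma>) bl wh)"
proof -
  let ?V = "verts \<Gamma>" and ?E = "edges \<Gamma>" and ?c = "colour \<Gamma>"
  have bw: "?c v = Black \<longleftrightarrow> ?c v \<noteq> White" for v by (cases "?c v") auto
  have \<beta>V: "\<beta> i \<in> ?V" "?c (\<beta> i) = Black" and \<omega>V: "\<omega> i \<in> ?V" "?c (\<omega> i) = White" if "i < k" for i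
    using bij_betwE[OF \<beta>] bij_betwE[OF \<omega>] that by auto
  have \<beta>I: "i = j" if "\<beta> i = \<beta> j" "i < k" "j < k" for i j
    using bij_betw_imp_inj_on[OF \<beta>] that by (auto dest: inj_onD)
  have \<omega>I: "i = j" if "\<omega> i = \<omega> j" "i < k" "j < k" for i j
    using bij_betw_imp_inj_on[OF \<omega>] that by (auto dest: inj_onD)
  have ex\<beta>: "\<exists>i<k. v = \<beta> i" if "v \<in> ?V" "?c v = Black" for v
    using bij_betw_imp_surj_on[OF \<beta>] that by auto
  have ex\<omega>: "\<exists>i<k. v = \<omega> i" if "v \<in> ?V" "?c v = White" for v
    using bij_betw_imp_surj_on[OF \<omega>] that by auto
  have inc: "(v, e) \<in> inc \<Gamma> \<longleftrightarrow> v = \<beta> (bl e) \<or> v = \<omega> (wh e)" if e: "e \<in> ?E" for v e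
  proof -
    let ?S = "{v \<in> ?V. (v, e) \<in> inc \<Gamma>}"
    have "card ?S = 2" "finite ?S" "?S = {v. (v, e) \<in> inc \<Gamma>}"
      using kl e by (auto simp: kl_bipartite_def is_multigraph_def)
    moreover have "{\<beta> (bl e), \<omega> (wh e)} \<subseteq> ?S" using lab[OF e] \<beta>V \<omega>V by auto
    moreover have "card {\<beta> (bl e), \<omega> (wh e)} = 2"
      using lab[OF e] \<beta>V(2)[of "bl e"] \<omega>V(2)[of "wh e"] by (auto simp: card_2_iff')
    ultimately have "{\<beta> (bl e), \<omega> (wh e)} = ?S" by (metis card_subset_eq)
    then show ?thesis using \<open>?S = {v. (v, e) \<in> inc \<Gamma>}\<close> by blast
  qed
  have incB: "v = \<beta> (bl e)" if "(v, e) \<in> inc \<Gamma>" "e \<in> ?E" "?c v = Black" for v e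
    using that inc[OF that(2)] lab[OF that(2)] \<omega>V bw by auto
  have incW: "v = \<omega> (wh e)" if "(v, e) \<in> inc \<Gamma>" "e \<in> ?E" "?c v = White" for v e
    using that inc[OF that(2)] lab[OF that(2)] \<beta>V bw by auto
  have AutD: "p permutes ?V" "q permutes ?E" "\<And>v. v \<in> ?V \<Longrightarrow> ?c (p v) = ?c v"
      "\<And>v e. v \<in> ?V \<Longrightarrow> e \<in> ?E \<Longrightarrow> (v, e) \<in> inc \<Gamma> \<longleftrightarrow> (p v, q e) \<in> inc \<Gamma>"
    if "(p, q) \<in> Aut \<Gamma>" for p q
    using that by (auto simp: Aut_def)
  have "inj_on snd (Aut \<Gamma>)"
  proof (rule inj_onI)
    fix x y assume xy: "x \<in> Aut \<Gamma>" "y \<in> Aut \<Gamma>" "snd x = snd y"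
    obtain p p' q where eqs: "x = (p, q)" "y = (p', q)" using xy(3) by (cases x, cases y) auto
    note A = AutD[OF xy(1)[unfolded eqs]] and A' = AutD[OF xy(2)[unfolded eqs]]
    have "p v = p' v" for v
    proof (cases "v \<in> ?V")
      case True
      have "card {e \<in> ?E. (v, e) \<in> inc \<Gamma>} = l" using kl True by (simp add: kl_bipartite_def)
      then have "{e \<in> ?E. (v, e) \<in> inc \<Gamma>} \<noteq> {}" using l by force
      then obtain e where e: "e \<in> ?E" "(v, e) \<in> inc \<Gamma>" by auto
      have qe: "q e \<in> ?E" using e(1) A(2) by (simp add: permutes_in_image)
      have "(p v, q e) \<in> inc \<Gamma>" "(p' v, q e) \<in> inc \<Gamma>" using A(4) A'(4) True e by auto
      moreover have "?c (p v) = ?c v" "?c (p' v) = ?c v" using A(3) A'(3) True by auto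
      ultimately show ?thesis
        using incB[OF _ qe] incW[OF _ qe] by (cases "?c v") metis+
    next
      case False
      then show ?thesis using A(1) A'(1) by (simp add: permutes_not_in)
    qed
    then show "x = y" by (auto simp: eqs)
  qed
  moreover have "snd ` Aut \<Gamma> \<subseteq> edge_aut k ?E bl wh"
  proof (rule image_subsetI)
    fix x assume x: "x \<in> Aut \<Gamma>"
    obtain p q where eqs: "x = (p, q)" by (cases x)
    note A = AutD[OF x[unfolded eqs]]
    have pV: "p v \<in> ?V" if "v \<in> ?V" for v using that A(1) by (simp add: permutes_in_image)
    have inj: "inj_on p S" for S using permutes_inj[OF A(1)] by (simp add: inj_on_def)
    have "p ` {v \<in> ?V. ?c v = Black} \<subseteq> {v \<in> ?V. ?c v = Black}" using pV A(3) by auto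
    from ex_permutation_conjugate[OF finite_lessThan \<beta> inj this] obtain \<sigma>
      where \<sigma>: "\<sigma> permutes {..<k}" "\<And>i. i < k \<Longrightarrow> \<beta> (\<sigma> i) = p (\<beta> i)" by blast
    have "p ` {v \<in> ?V. ?c v = White} \<subseteq> {v \<in> ?V. ?c v = White}" using pV A(3) by auto
    from ex_permutation_conjugate[OF finite_lessThan \<omega> inj this] obtain \<tau>
      where \<tau>: "\<tau> permutes {..<k}" "\<And>i. i < k \<Longrightarrow> \<omega> (\<tau> i) = p (\<omega> i)" by blast
    have "bl (q e) = \<sigma> (bl e) \<and> wh (q e) = \<tau> (wh e)" if e: "e \<in> ?E" for e
    proof -
      have qe: "q e \<in> ?E" using e A(2) by (simp add: permutes_in_image)
      have lt: "\<sigma> (bl e) < k" "\<tau> (wh e) < k"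
        using \<sigma>(1) \<tau>(1) lab[OF e] permutes_in_image by fastforce+
      have "(p (\<beta> (bl e)), q e) \<in> inc \<Gamma>" "(p (\<omega> (wh e)), q e) \<in> inc \<Gamma>"
        using A(4) \<beta>V \<omega>V lab[OF e] e by auto
      then have "\<beta> (\<sigma> (bl e)) = \<beta> (bl (q e))" "\<omega> (\<tau> (wh e)) = \<omega> (wh (q e))"
        using incB[OF _ qe] incW[OF _ qe] A(3) \<beta>V \<omega>V lab[OF e] \<sigma>(2) \<tau>(2) by auto
      then show ?thesis using \<beta>I \<omega>I lab[OF qe] lt by metis
    qed
    then show "snd x \<in> edge_aut k ?E bl wh" using A(2) \<sigma>(1) \<tau>(1) by (auto simp: edge_aut_def eqs)
  qed
  moreover have "q \<in> snd ` Aut \<Gamma>" if "q \<in> edge_aut k ?E bl wh" for q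
  proof -
    obtain \<sigma> \<tau> where q: "q permutes ?E" and st: "\<sigma> permutes {..<k}" "\<tau> permutes {..<k}"
      and lift: "\<And>e. e \<in> ?E \<Longrightarrow> bl (q e) = \<sigma> (bl e) \<and> wh (q e) = \<tau> (wh e)"
      using \<open>q \<in> edge_aut k ?E bl wh\<close> by (auto simp: edge_aut_def)
    have lt: "\<sigma> i < k" "\<tau> i < k" if "i < k" for i
      using st that permutes_in_image by fastforce+
    have sI: "\<sigma> i = \<sigma> j \<longleftrightarrow> i = j" "\<tau> i = \<tau> j \<longleftrightarrow> i = j" for i j
      using st[THEN permutes_inj] by (auto simp: inj_eq)
    define p where "p v = (if v \<notin> ?V then v
      else if ?c v = Black then \<beta> (\<sigma> (inv_into {..<k} \<beta> v)) else \<omega> (\<tau> (inv_into {..<k} \<omega> v)))" for v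
    have p\<beta>: "p (\<beta> i) = \<beta> (\<sigma> i)" if "i < k" for i
      using that \<beta>V bij_betw_inv_into_left[OF \<beta>, of i] by (simp add: p_def)
    have p\<omega>: "p (\<omega> i) = \<omega> (\<tau> i)" if "i < k" for i
      using that \<omega>V bij_betw_inv_into_left[OF \<omega>, of i] by (simp add: p_def)
    have cases: "(\<exists>i<k. v = \<beta> i) \<or> (\<exists>i<k. v = \<omega> i)" if "v \<in> ?V" for v
      using ex\<beta> ex\<omega> that bw by blast
    have pV: "p v \<in> ?V" "?c (p v) = ?c v" if "v \<in> ?V" for v
      using cases[OF that] p\<beta> p\<omega> lt \<beta>V \<omega>V by auto
    have \<beta>eq: "\<beta> i = \<beta> j \<longleftrightarrow> i = j" if "i < k" "j < k" for i j using \<beta>I that by auto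
    have \<omega>eq: "\<omega> i = \<omega> j \<longleftrightarrow> i = j" if "i < k" "j < k" for i j using \<omega>I that by auto
    have \<beta>\<omega>: "\<beta> i \<noteq> \<omega> j" if "i < k" "j < k" for i j
      using \<beta>V(2)[OF that(1)] \<omega>V(2)[OF that(2)] by auto
    have "inj_on p ?V"
    proof (rule inj_onI)
      fix v w assume vw: "v \<in> ?V" "w \<in> ?V" "p v = p w"
      then have "?c v = ?c w" using pV by metis
      then show "v = w"
        using cases[OF vw(1)] cases[OF vw(2)] vw(3) p\<beta> p\<omega> lt \<beta>V \<omega>V sI \<beta>eq \<omega>eq
        by (elim disjE exE conjE) auto
    qed
    moreover have "finite ?V" using kl by (simp add: kl_bipartite_def)
    moreover have "p ` ?V \<subseteq> ?V" using pV(1) by blast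
    ultimately have "p permutes ?V"
      by (intro permutes_if_inj_on) (simp_all add: p_def)
    moreover have "(v, e) \<in> inc \<Gamma> \<longleftrightarrow> (p v, q e) \<in> inc \<Gamma>" if v: "v \<in> ?V" and e: "e \<in> ?E" for v e
    proof -
      have qe: "q e \<in> ?E" using e q by (simp add: permutes_in_image)
      show ?thesis
        using cases[OF v] lab[OF e] lift[OF e] lt \<beta>\<omega>
        by (elim disjE exE conjE) (auto simp: inc[OF e] inc[OF qe] p\<beta> p\<omega> \<beta>eq \<omega>eq sI dest: sym)
    qed
    ultimately have "(p, q) \<in> Aut \<Gamma>" using q pV by (auto simp: Aut_def)
    then show ?thesis by force
  qed
  ultimately have "bij_betw snd (Aut \<Gamma>) (edge_aut k ?E bl wh)"
    by (auto simp: bij_betw_def)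
  then show ?thesis by (rule bij_betw_same_card)
qed

lemma aut_orders_edge_data:
  assumes "n \<in> aut_orders k l" "l \<ge> 1"
  obtains E :: "nat set" and bl wh where "edge_data k l E bl wh" "n = card (edge_aut k E bl wh)"
proof -
  obtain \<Gamma> :: "(nat, nat, bw) coloured_multigraph"
    where n: "n = card (Aut \<Gamma>)" and kl: "kl_bipartite k l \<Gamma>"
    using assms(1) by (auto simp: aut_orders_def)
  let ?B = "{v \<in> verts \<Gamma>. colour \<Gamma> v = Black}" and ?W = "{v \<in> verts \<Gamma>. colour \<Gamma> v = White}"
  let ?E = "edges \<Gamma>"
  have fin: "finite ?B" "finite ?W" "card ?B = k" "card ?W = k" "finite ?E"
    using kl unfolding kl_bipartite_def by simp_all
  have "\<exists>h. bij_betw h {..<k} ?B" "\<exists>h. bij_betw h {..<k} ?W"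
    using fin by (intro finite_same_card_bij; simp)+
  then obtain \<beta> \<omega> where \<beta>: "bij_betw \<beta> {..<k} ?B" and \<omega>: "bij_betw \<omega> {..<k} ?W" by blast
  have "\<exists>x. fst x < k \<and> snd x < k \<and> (\<beta> (fst x), e) \<in> inc \<Gamma> \<and> (\<omega> (snd x), e) \<in> inc \<Gamma>"
    if "e \<in> ?E" for e
  proof -
    obtain b w where bw: "(b, e) \<in> inc \<Gamma>" "(w, e) \<in> inc \<Gamma>" "colour \<Gamma> b = Black" "colour \<Gamma> w = White"
      using kl \<open>e \<in> ?E\<close> unfolding kl_bipartite_def by blast
    have "b \<in> ?B" "w \<in> ?W" using bw kl by (auto simp: kl_bipartite_def is_multigraph_def)
    then have "b \<in> \<beta> ` {..<k}" "w \<in> \<omega> ` {..<k}"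
      unfolding bij_betw_imp_surj_on[OF \<beta>] bij_betw_imp_surj_on[OF \<omega>] .
    then obtain i j where "i < k" "j < k" "b = \<beta> i" "w = \<omega> j" by auto
    then show ?thesis using bw by (intro exI[of _ "(i, j)"]) simp
  qed
  then have "\<exists>f. \<forall>e\<in>?E. fst (f e) < k \<and> snd (f e) < k \<and> (\<beta> (fst (f e)), e) \<in> inc \<Gamma> \<and>
      (\<omega> (snd (f e)), e) \<in> inc \<Gamma>"
    by (intro bchoice) blast
  then obtain f where f: "\<forall>e\<in>?E. fst (f e) < k \<and> snd (f e) < k \<and> (\<beta> (fst (f e)), e) \<in> inc \<Gamma> \<and>
      (\<omega> (snd (f e)), e) \<in> inc \<Gamma>" ..
  define bl wh where "bl e = fst (f e)" and "wh e = snd (f e)" for e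
  have lab: "\<And>e. e \<in> ?E \<Longrightarrow>
      bl e < k \<and> wh e < k \<and> (\<beta> (bl e), e) \<in> inc \<Gamma> \<and> (\<omega> (wh e), e) \<in> inc \<Gamma>"
    using f by (simp add: bl_def wh_def)
  have inc: "(\<beta> i, e) \<in> inc \<Gamma> \<longleftrightarrow> bl e = i" "(\<omega> i, e) \<in> inc \<Gamma> \<longleftrightarrow> wh e = i"
    if e: "e \<in> ?E" and i: "i < k" for e i
  proof -
    let ?S = "{v \<in> verts \<Gamma>. (v, e) \<in> inc \<Gamma>}"
    have "card ?S = 2" "?S = {v. (v, e) \<in> inc \<Gamma>}"
      using kl e by (auto simp: kl_bipartite_def is_multigraph_def)
    then obtain x y where xy: "{v. (v, e) \<in> inc \<Gamma>} = {x, y}" by (auto simp: card_2_iff)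
    have V: "\<beta> i' \<in> ?B" "\<omega> i' \<in> ?W" if "i' < k" for i'
      using bij_betwE[OF \<beta>] bij_betwE[OF \<omega>] that by auto
    have "\<beta> (bl e) \<noteq> \<omega> (wh e)" using V(1)[of "bl e"] V(2)[of "wh e"] lab[OF e] by auto
    then have "{v. (v, e) \<in> inc \<Gamma>} = {\<beta> (bl e), \<omega> (wh e)}"
    proof -
      have "\<beta> (bl e) \<in> {x, y}" "\<omega> (wh e) \<in> {x, y}"
        unfolding xy[symmetric] using lab[OF e] by simp_all
      then show ?thesis using \<open>\<beta> (bl e) \<noteq> \<omega> (wh e)\<close> unfolding xy by auto
    qed
    then have "(v, e) \<in> inc \<Gamma> \<longleftrightarrow> v = \<beta> (bl e) \<or> v = \<omega> (wh e)" for v by auto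
    moreover have "\<beta> i \<noteq> \<omega> (wh e)" "\<omega> i \<noteq> \<beta> (bl e)"
      using V(1)[OF i] V(2)[OF i] V(1)[of "bl e"] V(2)[of "wh e"] lab[OF e] by auto
    ultimately show "(\<beta> i, e) \<in> inc \<Gamma> \<longleftrightarrow> bl e = i" "(\<omega> i, e) \<in> inc \<Gamma> \<longleftrightarrow> wh e = i"
      using bij_betw_imp_inj_on[OF \<beta>] bij_betw_imp_inj_on[OF \<omega>] lab[OF e] i
      by (auto dest: inj_onD)
  qed
  have reg: "card {e \<in> ?E. (v, e) \<in> inc \<Gamma>} = l" if "v \<in> verts \<Gamma>" for v
    using kl that by (simp add: kl_bipartite_def)
  have "edge_data k l ?E bl wh"
    unfolding edge_data_def
  proof (intro conjI allI impI)
    fix i assume i: "i < k"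
    have "{e \<in> ?E. bl e = i} = {e \<in> ?E. (\<beta> i, e) \<in> inc \<Gamma>}"
      "{e \<in> ?E. wh e = i} = {e \<in> ?E. (\<omega> i, e) \<in> inc \<Gamma>}" using inc i by auto
    then show "card {e \<in> ?E. bl e = i} = l" "card {e \<in> ?E. wh e = i} = l"
      using reg bij_betwE[OF \<beta>] bij_betwE[OF \<omega>] i by auto
  qed (use fin lab in auto)
  then show thesis
    using that card_Aut_eq_card_edge_aut[OF kl assms(2) \<beta> \<omega> lab] n by blast
qed

lemma card_edge_aut_in_aut_orders:
  fixes E :: "'e set"
  assumes ed: "edge_data k l E bl wh" and l: "l \<ge> 1"
  shows "card (edge_aut k E bl wh) \<in> aut_orders k l"
proof -
  define \<Gamma> :: "(nat \<times> bw, 'e, bw) coloured_multigraph" where "\<Gamma> = \<lparr>verts = {..<k} \<times> (UNIV :: bw set), edges = E,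
    inc = {(v, e). e \<in> E \<and> (v = (bl e, Black) \<or> v = (wh e, White))}, colour = snd\<rparr>"
  have [simp]: "verts \<Gamma> = {..<k} \<times> UNIV" "edges \<Gamma> = E" "colour \<Gamma> = snd"
    and inc: "(v, e) \<in> inc \<Gamma> \<longleftrightarrow> e \<in> E \<and> (v = (bl e, Black) \<or> v = (wh e, White))" for v e
    by (auto simp: \<Gamma>_def)
  have E: "finite E" "\<And>e. e \<in> E \<Longrightarrow> bl e < k \<and> wh e < k" using ed by (auto simp: edge_data_def)
  have UNIV_bw: "(UNIV :: bw set) = {Black, White}" using bw.exhaust by auto
  have col: "{v \<in> {..<k} \<times> UNIV. snd v = c} = (\<lambda>i. (i, c)) ` {..<k}" for c :: bw by auto
  have "kl_bipartite k l \<Gamma>"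
    unfolding kl_bipartite_def is_multigraph_def
  proof (intro conjI)
    show "inc \<Gamma> \<subseteq> verts \<Gamma> \<times> edges \<Gamma>" using E by (auto simp: \<Gamma>_def)
    show "\<forall>e\<in>edges \<Gamma>. card {v \<in> verts \<Gamma>. (v, e) \<in> inc \<Gamma>} = 2"
    proof
      fix e assume e: "e \<in> edges \<Gamma>"
      then have "{v \<in> verts \<Gamma>. (v, e) \<in> inc \<Gamma>} = {(bl e, Black), (wh e, White)}"
        using E(2)[of e] by (auto simp: inc)
      then show "card {v \<in> verts \<Gamma>. (v, e) \<in> inc \<Gamma>} = 2" by simp
    qed
    show "finite (verts \<Gamma>)" "finite (edges \<Gamma>)" using E by (auto simp: UNIV_bw)
    show "card {v \<in> verts \<Gamma>. colour \<Gamma> v = Black} = k" "card {v \<in> verts \<Gamma>. colour \<Gamma> v = White} = k"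
      by (simp_all add: col card_image inj_on_def)
    show "\<forall>e\<in>edges \<Gamma>. \<exists>b w. (b, e) \<in> inc \<Gamma> \<and> (w, e) \<in> inc \<Gamma> \<and>
        colour \<Gamma> b = Black \<and> colour \<Gamma> w = White"
      by (auto simp: inc)
    show "\<forall>v\<in>verts \<Gamma>. card {e \<in> edges \<Gamma>. (v, e) \<in> inc \<Gamma>} = l"
    proof
      fix v assume v: "v \<in> verts \<Gamma>"
      obtain i c where ic: "v = (i, c)" "i < k" using v by auto
      show "card {e \<in> edges \<Gamma>. (v, e) \<in> inc \<Gamma>} = l"
        using ed ic by (cases c) (auto simp: inc edge_data_def eq_commute[of i] cong: conj_cong)
    qed
  qed
  moreover have "card (Aut \<Gamma>) = card (edge_aut k (edges \<Gamma>) bl wh)"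
    by (rule card_Aut_eq_card_edge_aut[OF \<open>kl_bipartite k l \<Gamma>\<close> l,
          of "\<lambda>i. (i, Black)" "\<lambda>i. (i, White)"])
      (use E in \<open>auto simp: bij_betw_def inj_on_def inc\<close>)
  ultimately show ?thesis using card_Aut_in_aut_orders by fastforce
qed

lemma aut_ordersE:
  assumes "n \<in> aut_orders k l" "l \<ge> 1"
  obtains M where "line_sums k l M" "n = card (mat_aut k M) * (\<Prod>i<k. \<Prod>j<k. fact (M i j))"
proof -
  obtain E :: "nat set" and bl wh where ed: "edge_data k l E bl wh" "n = card (edge_aut k E bl wh)"
    using aut_orders_edge_data[OF assms] .
  show thesis
    by (rule that[OF line_sums_edge_data[OF ed(1)]]) (simp add: ed(2) card_edge_aut[OF ed(1) assms(2)])
qed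

lemma aut_ordersI:
  assumes M: "line_sums k l M" and l: "l \<ge> 1"
  shows "card (mat_aut k M) * (\<Prod>i<k. \<Prod>j<k. fact (M i j)) \<in> aut_orders k l"
proof -
  define E where "E = (SIGMA i:{..<k}. SIGMA j:{..<k}. {..<M i j})"
  define bl :: "nat \<times> nat \<times> nat \<Rightarrow> nat" where "bl = fst"
  define wh :: "nat \<times> nat \<times> nat \<Rightarrow> nat" where "wh = (\<lambda>e. fst (snd e))"
  have [simp]: "finite E" by (auto simp: E_def)
  have "card {e\<in>E. bl e = i} = l" if "i < k" for i
  proof -
    have "{e\<in>E. bl e = i} = Pair i ` (SIGMA j:{..<k}. {..<M i j})"
      using that by (auto simp: E_def bl_def)
    then show ?thesis using M that by (simp add: card_image inj_on_def line_sums_def)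
  qed
  moreover have "card {e\<in>E. wh e = j} = l" if "j < k" for j
  proof -
    have "{e\<in>E. wh e = j} = (\<lambda>(i, t). (i, j, t)) ` (SIGMA i:{..<k}. {..<M i j})"
      using that by (auto simp: E_def wh_def image_iff)
    then show ?thesis using M that by (simp add: card_image inj_on_def line_sums_def)
  qed
  ultimately have ed: "edge_data k l E bl wh"
    by (auto simp: edge_data_def) (auto simp: E_def bl_def wh_def)
  have "M i j = card {e\<in>E. bl e = i \<and> wh e = j}" if "i < k" "j < k" for i j
  proof -
    have "{e\<in>E. bl e = i \<and> wh e = j} = (\<lambda>t. (i, j, t)) ` {..<M i j}"
      using that by (auto simp: E_def wh_def bl_def)
    then show ?thesis by (simp add: card_image inj_on_def)
  qed
  from card_edge_aut[OF ed l this] show ?thesis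
    using card_edge_aut_in_aut_orders[OF ed l] by simp
qed

section \<open>The largest automorphism group\<close>

text \<open>
  Every automorphism lifts its permutation of the black vertices, and a permutation of the black
  vertices has \<open>fact l ^ k\<close> lifts, one bijection between stars for each vertex.
\<close>

lemma card_edge_aut_le:
  assumes ed: "edge_data k l E bl wh"
  shows "card (edge_aut k E bl wh) \<le> fact k * fact l ^ k"
proof -
  let ?P = "{p. p permutes {..<k}}"
  have E: "finite E" "bl ` E \<subseteq> {..<k}" and l: "\<And>i. i < k \<Longrightarrow> card {e\<in>E. bl e = i} = l"
    using ed by (auto simp: edge_data_def)
  have finP: "finite ?P" by (simp add: finite_permutations)
  have fin: "finite (lifts E bl \<sigma>)" for \<sigma>
    unfolding lifts_def by (rule finite_subset[OF _ finite_permutations[OF E(1)]]) auto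
  have "card (edge_aut k E bl wh) \<le> card (\<Union>\<sigma>\<in>?P. lifts E bl \<sigma>)"
    using fin finP by (intro card_mono) (auto simp: edge_aut_def lifts_def)
  also have "\<dots> \<le> (\<Sum>\<sigma>\<in>?P. card (lifts E bl \<sigma>))"
    using finP by (rule card_UN_le)
  also have "\<dots> \<le> (\<Sum>\<sigma>\<in>?P. fact l ^ k)"
  proof (rule sum_mono)
    fix \<sigma> assume "\<sigma> \<in> ?P"
    then have "inj_on \<sigma> {..<k}" by (simp add: permutes_inj_on)
    from card_lifts[OF _ E this] show "card (lifts E bl \<sigma>) \<le> fact l ^ k"
      using l by simp
  qed
  also have "\<dots> = fact k * fact l ^ k"
    by (simp add: card_permutations)
  finally show ?thesis .
qed

lemma mu_eq:
  assumes l: "l \<ge> 1"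
  shows "mu k l = fact k * fact l ^ k"
  unfolding mu_def
proof (rule Max_eqI[OF finite_aut_orders])
  fix n assume "n \<in> aut_orders k l"
  from aut_orders_edge_data[OF this l] show "n \<le> fact k * fact l ^ k"
    using card_edge_aut_le by metis
next
  define M where "M i j = (if i = j then l else 0)" for i j :: nat
  have "line_sums k l M" by (simp add: line_sums_def M_def)
  moreover have "mat_aut k M = (\<lambda>\<sigma>. (\<sigma>, \<sigma>)) ` {\<sigma>. \<sigma> permutes {..<k}}"
  proof (intro equalityI subsetI)
    fix x assume "x \<in> mat_aut k M"
    then obtain \<sigma> \<tau> where x: "x = (\<sigma>, \<tau>)" and st: "\<sigma> permutes {..<k}" "\<tau> permutes {..<k}"
      and M: "\<And>i. i < k \<Longrightarrow> M (\<sigma> i) (\<tau> i) = M i i" by (auto simp: mat_aut_def)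
    have "\<sigma> = \<tau>"
    proof (rule permutes_lessThan_eqI[OF st])
      fix i assume "i < k" then show "\<sigma> i = \<tau> i" using M[of i] l by (simp add: M_def split: if_splits)
    qed
    then show "x \<in> (\<lambda>\<sigma>. (\<sigma>, \<sigma>)) ` {\<sigma>. \<sigma> permutes {..<k}}" using x st by auto
  next
    fix x assume "x \<in> (\<lambda>\<sigma>. (\<sigma>, \<sigma>)) ` {\<sigma>. \<sigma> permutes {..<k}}"
    then obtain \<sigma> where x: "x = (\<sigma>, \<sigma>)" "\<sigma> permutes {..<k}" by auto
    then show "x \<in> mat_aut k M"
      using permutes_inj[OF x(2)] by (auto simp: mat_aut_def M_def inj_eq)
  qed
  then have "card (mat_aut k M) = fact k"
    by (simp add: card_image inj_on_def card_permutations)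
  moreover have "(\<Prod>i<k. \<Prod>j<k. fact (M i j)) = (fact l ^ k :: nat)"
  proof -
    have "(\<Prod>j<k. fact (M i j)) = (fact l :: nat)" if "i < k" for i
      using that prod.delta[of "{..<k}" i "\<lambda>_. fact l :: nat"]
      by (simp add: M_def if_distrib eq_commute[of i] cong: if_cong)
    then show ?thesis by simp
  qed
  ultimately show "fact k * fact l ^ k \<in> aut_orders k l"
    using aut_ordersI[of k l M] l by simp
qed

section \<open>Two fixed-point-free involutions\<close>

text \<open>
  For two factors this is \<open>a + b \<le> a * b\<close>, valid for \<open>a, b \<ge> 2\<close>.
\<close>

lemma sum_le_prod:
  fixes f :: "'a \<Rightarrow> nat"
  assumes "finite A" "\<And>x. x \<in> A \<Longrightarrow> f x \<ge> 2"
  shows "sum f A \<le> prod f A"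
  using assms
proof (induction A rule: finite_induct)
  case (insert x A)
  show ?case
  proof (cases "A = {}")
    case False
    then obtain y where y: "y \<in> A" by auto
    have "2 \<le> f y" using insert.prems y by simp
    also have "\<dots> \<le> prod f A"
      using insert y by (intro dvd_imp_le dvd_prodI) (auto simp: prod_pos, force)
    finally have "f x + prod f A \<le> f x * prod f A"
      using insert.prems[of x] mult_le_mono[of 2 "f x" 2 "prod f A"]
      by (cases "f x"; cases "prod f A") auto
    then show ?thesis using insert by simp
  qed simp
qed simp

text \<open>
  The orbits of two fixed-point-free involutions are cycles of even length along which \<open>a\<close> and \<open>b\<close>
  alternate.  They are parametrised below by walks that apply \<open>a\<close> and \<open>b\<close> in turn, starting
  with \<open>a\<close>.
\<close>

locale involution_pair =
  fixes E :: "'e set" and a b :: "'e \<Rightarrow> 'e"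
  assumes finite_E: "finite E"
    and a: "e \<in> E \<Longrightarrow> a e \<in> E" "e \<in> E \<Longrightarrow> a (a e) = e" "e \<in> E \<Longrightarrow> a e \<noteq> e"
    and b: "e \<in> E \<Longrightarrow> b e \<in> E" "e \<in> E \<Longrightarrow> b (b e) = e" "e \<in> E \<Longrightarrow> b e \<noteq> e"
begin

definition step :: "nat \<Rightarrow> 'e \<Rightarrow> 'e" where
  "step n = (if even n then a else b)"

primrec walk :: "'e \<Rightarrow> nat \<Rightarrow> 'e" where
  "walk e 0 = e"
| "walk e (Suc n) = step n (walk e n)"

definition orb :: "'e \<Rightarrow> 'e set" where
  "orb e = range (walk e)"

lemma step: "e \<in> E \<Longrightarrow> step n e \<in> E" "e \<in> E \<Longrightarrow> step n (step n e) = e" "e \<in> E \<Longrightarrow> step n e \<noteq> e"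
  using a b by (auto simp: step_def)

lemma step_eq_if_even: "even (n + m) \<Longrightarrow> step n = step m"
  by (auto simp: step_def)

lemma step_inj: "e \<in> E \<Longrightarrow> f \<in> E \<Longrightarrow> step n e = step n f \<longleftrightarrow> e = f"
  using step(2) by metis

lemma walk_in: "e \<in> E \<Longrightarrow> walk e n \<in> E"
  by (induction n) (auto simp: step)

text \<open>
  If the walk met itself at times of different parity, then going one step inwards from both ends
  would give a shorter such coincidence, and finally a fixed point of \<open>a\<close> or \<open>b\<close>.
\<close>

lemma walk_odd_neq:
  assumes "e \<in> E"
  shows "walk e n \<noteq> walk e (n + Suc (2 * d))"
proof (induction d arbitrary: n)
  case 0
  show ?case using step(3)[OF walk_in[OF assms]] by (metis add_Suc_right mult_0_right walk.simps(2) add_0_right)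
next
  case (Suc d)
  show ?case
  proof
    assume "walk e n = walk e (n + Suc (2 * Suc d))"
    then have "step n (walk e n) = step n (walk e (Suc (n + 2 * Suc d)))" by simp
    also have "\<dots> = step n (step (n + 2 * Suc d) (walk e (n + 2 * Suc d)))" by simp
    also have "step (n + 2 * Suc d) = step n" by (rule step_eq_if_even) simp
    also have "step n (step n (walk e (n + 2 * Suc d))) = walk e (n + 2 * Suc d)"
      by (rule step(2)[OF walk_in[OF assms]])
    finally have "walk e (Suc n) = walk e (Suc n + Suc (2 * d))" by simp
    then show False using Suc.IH[of "Suc n"] by simp
  qed
qed

lemma walk_shift:
  assumes "e \<in> E" "even d"
  shows "walk e (n + d) = walk e n \<longleftrightarrow> walk e d = e"
proof (induction n)
  case (Suc n)
  have "step (n + d) = step n" using assms(2) by (intro step_eq_if_even) simp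
  then have "walk e (Suc n + d) = walk e (Suc n) \<longleftrightarrow> walk e (n + d) = walk e n"
    using step_inj walk_in[OF assms(1)] by simp
  then show ?case using Suc.IH by simp
qed simp

lemma ex_period:
  assumes "e \<in> E"
  obtains L where "even L" "walk e L = e" "L \<ge> N"
proof -
  have "\<not> inj (\<lambda>n. walk e (2 * n))"
    using finite_E walk_in[OF assms] finite_subset[of "range (\<lambda>n. walk e (2 * n))" E]
    by (auto dest: finite_imageD)
  then obtain i j where ij: "i < j" "walk e (2 * i) = walk e (2 * j)"
    unfolding inj_def by (metis linorder_neqE_nat)
  define d where "d = 2 * (j - i)"
  have d: "walk e d = e" "even d" "d > 0"
  proof -
    have "walk e (2 * i + d) = walk e (2 * i)" using ij by (simp add: d_def algebra_simps)
    then show "walk e d = e" using walk_shift[OF assms] d_def by simp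
  qed (use ij in \<open>auto simp: d_def\<close>)
  have "walk e (m * d) = e" for m
  proof (induction m)
    case (Suc m)
    have "walk e (m * d + d) = walk e (m * d)" using walk_shift[OF assms d(2)] d(1) by simp
    then show ?case using Suc by (simp add: add.commute)
  qed simp
  moreover have "N * d \<ge> N" using d(3) by simp
  moreover have "even (N * d)" using d(2) by simp
  ultimately show thesis using that by blast
qed

lemma walk_walk_even: "even i \<Longrightarrow> walk (walk e i) n = walk e (i + n)"
proof (induction n)
  case (Suc n)
  then have "step (i + n) = step n" by (intro step_eq_if_even) simp
  then show ?case using Suc by simp
qed simp

text \<open>
  A walk that restarts at an odd time applies \<open>a\<close> where the original walk has just applied it, and so
  runs backwards.
\<close>

lemma walk_walk_odd:
  assumes "e \<in> E" "odd i"
  shows "n \<le> i \<Longrightarrow> walk (walk e i) n = walk e (i - n)"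
proof (induction n)
  case (Suc n)
  have eq: "i - n = Suc (i - Suc n)" using Suc.prems by simp
  have "step n = step (i - Suc n)" using assms(2) Suc.prems by (intro step_eq_if_even) auto
  moreover have "walk e (i - n) = step (i - Suc n) (walk e (i - Suc n))"
    unfolding eq by simp
  ultimately show ?case using Suc step(2)[OF walk_in[OF assms(1)]] by simp
qed simp

lemma orbE:
  assumes "e \<in> E" "f \<in> orb e"
  obtains i where "f = walk e i" "i \<ge> N"
proof -
  obtain i where i: "f = walk e i" using assms(2) by (auto simp: orb_def)
  obtain L where "even L" "walk e L = e" "L \<ge> N" using ex_period[OF assms(1)] .
  moreover have "walk e (i + L) = walk e i \<longleftrightarrow> walk e L = e"
    using walk_shift[OF assms(1) \<open>even L\<close>] .
  ultimately have "f = walk e (i + L)" "i + L \<ge> N" using i by auto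
  then show thesis by (rule that)
qed

text \<open>
  All walks on one orbit have the same periods.  This makes \<open>walk e n \<mapsto> walk f n\<close> a well-defined
  bijection of the orbit.
\<close>

lemma walk_closes_iff:
  assumes e: "e \<in> E" and f: "f \<in> orb e" and d: "even d"
  shows "walk f d = f \<longleftrightarrow> walk e d = e"
proof -
  obtain i where i: "f = walk e i" "i \<ge> d" using orbE[OF e f] .
  show ?thesis
  proof (cases "even i")
    case True
    then show ?thesis using walk_walk_even walk_shift[OF e d] i by simp
  next
    case False
    then have "walk f d = walk e (i - d)" using walk_walk_odd[OF e] i by simp
    moreover have "walk e ((i - d) + d) = f" using i by simp
    ultimately show ?thesis using walk_shift[OF e d, of "i - d"] by auto
  qed
qed

lemma walk_eq_iff:
  assumes e: "e \<in> E"
  shows "walk e n = walk e m \<longleftrightarrow> even (n + m) \<and> walk e (max n m - min n m) = e"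
proof -
  have "walk e n = walk e m \<longleftrightarrow> even (n + m) \<and> walk e (m - n) = e" if "n \<le> m" for n m
  proof (cases "even (n + m)")
    case True
    then have "even (m - n)" by simp
    from walk_shift[OF e this, of n] show ?thesis using True that by auto
  next
    case False
    then have "odd (m - n)" using that by simp
    then obtain d where "m - n = 2 * d + 1" by (rule oddE)
    then have m: "m = n + Suc (2 * d)" using that by simp
    have "walk e n \<noteq> walk e m" unfolding m by (rule walk_odd_neq[OF e])
    then show ?thesis using False by simp
  qed
  from this[of n m] this[of m n] show ?thesis
    by (cases "n \<le> m") (auto simp: max_def min_def add.commute)
qed

lemma walk_eq_transfer:
  assumes e: "e \<in> E" and f: "f \<in> orb e"
  shows "walk f n = walk f m \<longleftrightarrow> walk e n = walk e m"
proof -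
  have "f \<in> E" using e f walk_in by (auto simp: orb_def)
  then show ?thesis
    unfolding walk_eq_iff[OF e] walk_eq_iff[OF \<open>f \<in> E\<close>]
    by (intro conj_cong refl walk_closes_iff[OF e f]) (auto simp: max_def min_def)
qed

lemma orb_subset: assumes "e \<in> E" "f \<in> orb e" shows "orb f \<subseteq> orb e"
proof
  fix g assume "g \<in> orb f"
  then obtain n where n: "g = walk f n" by (auto simp: orb_def)
  obtain i where i: "f = walk e i" "i \<ge> n" using orbE[OF assms] .
  show "g \<in> orb e"
    using walk_walk_even walk_walk_odd[OF assms(1)] i n by (cases "even i") (auto simp: orb_def)
qed

lemma orb_sym: assumes "e \<in> E" "f \<in> orb e" shows "e \<in> orb f"
proof -
  obtain i where i: "f = walk e i" using assms(2) by (auto simp: orb_def)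
  show ?thesis
  proof (cases "even i")
    case True
    obtain L where "even L" "walk e L = e" "L \<ge> i" using ex_period[OF assms(1)] .
    then have "walk f (L - i) = e" using True i walk_walk_even[OF True, of e "L - i"] by simp
    then show ?thesis by (auto simp: orb_def)
  next
    case False
    then have "walk f i = e" using walk_walk_odd[OF assms(1) False, of i] i by simp
    then show ?thesis by (auto simp: orb_def)
  qed
qed

lemma orb_eq: assumes "e \<in> E" "f \<in> orb e" shows "orb f = orb e"
proof -
  have "f \<in> E" using assms walk_in by (auto simp: orb_def)
  then show ?thesis using orb_subset orb_sym assms by blast
qed

lemma orb_in: "e \<in> E \<Longrightarrow> orb e \<subseteq> E"
  using walk_in by (auto simp: orb_def)

lemma self_in_orb: "e \<in> orb e"
  unfolding orb_def using walk.simps(1) by (metis rangeI)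

lemma card_orb: assumes "e \<in> E" shows "card (orb e) \<ge> 2"
proof -
  have "walk e (Suc 0) \<in> orb e" unfolding orb_def by (rule rangeI)
  then have "{e, a e} \<subseteq> orb e" using self_in_orb by (simp add: step_def)
  moreover have "card {e, a e} = 2" using a(3)[OF assms] by simp
  moreover have "finite (orb e)" using orb_in[OF assms] finite_E finite_subset by blast
  ultimately show ?thesis by (metis card_mono)
qed

text \<open>
  Pick a representative \<open>r X\<close> of each orbit \<open>X\<close>.  For every choice \<open>g\<close> of one further element of each
  orbit, the map that sends \<open>walk (r X) n\<close> to \<open>walk (g X) n\<close> commutes with \<open>a\<close> and \<open>b\<close>, and it
  determines \<open>g\<close>.  This gives as many permutations as the product of the orbit sizes.
\<close>

lemma card_centraliser:
  "card E \<le> card {q. q permutes E \<and> (\<forall>e\<in>E. q (a e) = a (q e) \<and> q (b e) = b (q e))}"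
proof -
  define P where "P = orb ` E"
  define r where "r X = (SOME e. e \<in> X)" for X :: "'e set"
  have finP: "finite P" using finite_E by (simp add: P_def)
  have r: "r X \<in> X" "r X \<in> E" "orb (r X) = X" "X \<subseteq> E" if "X \<in> P" for X
  proof -
    obtain e where e: "e \<in> E" "X = orb e" using \<open>X \<in> P\<close> by (auto simp: P_def)
    show rO: "r X \<in> X" unfolding r_def by (rule someI[of _ e]) (simp add: e self_in_orb)
    show "X \<subseteq> E" using e orb_in by simp
    then show "r X \<in> E" using rO by auto
    show "orb (r X) = X" using orb_eq[OF e(1)] rO e(2) by simp
  qed
  \<comment> \<open>the time at which \<open>x\<close> is reached does not matter, by \<open>walk_eq_transfer\<close>\<close>
  define \<phi> where "\<phi> g x = (if x \<in> E then walk (g (orb x)) (SOME n. walk (r (orb x)) n = x) else x)"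
    for g :: "'e set \<Rightarrow> 'e" and x
  have gO: "g X \<in> X" "g X \<in> E" "g X \<in> orb (r X)" "orb (g X) = X" if "g \<in> PiE P (\<lambda>X. X)" "X \<in> P" for g X
  proof -
    show 1: "g X \<in> X" using that by auto
    then show "g X \<in> E" "g X \<in> orb (r X)" using r[OF that(2)] by auto
    then show "orb (g X) = X" using orb_eq r[OF that(2)] by metis
  qed
  have \<phi>: "\<phi> g (walk (r X) n) = walk (g X) n" if "g \<in> PiE P (\<lambda>X. X)" "X \<in> P" for g X n
  proof -
    let ?x = "walk (r X) n"
    have x: "?x \<in> E" using walk_in r that by simp
    have o: "orb ?x = X" using orb_eq[of "r X" ?x] r[OF that(2)] by (simp add: orb_def)
    have "walk (r X) (SOME m. walk (r X) m = ?x) = ?x" by (rule someI[of _ n]) simp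
    then have "walk (g X) (SOME m. walk (r X) m = ?x) = walk (g X) n"
      using walk_eq_transfer[OF r(2) gO(3)] that by simp
    then show ?thesis using x o by (simp add: \<phi>_def)
  qed
  \<comment> \<open>a positive time, so that both neighbours of \<open>x\<close> on the walk have a time\<close>
  have repr: "\<exists>X n. X \<in> P \<and> x = walk (r X) (Suc n)" if x: "x \<in> E" for x
  proof -
    have X: "orb x \<in> P" using x by (simp add: P_def)
    have "x \<in> orb (r (orb x))" using r(3)[OF X] self_in_orb by simp
    then obtain n where "x = walk (r (orb x)) n" "n \<ge> Suc 0" using orbE[OF r(2)[OF X]] by metis
    then show ?thesis using X by (metis Suc_le_D)
  qed
  let ?C = "{q. q permutes E \<and> (\<forall>e\<in>E. q (a e) = a (q e) \<and> q (b e) = b (q e))}"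
  have "\<phi> g \<in> ?C" if g: "g \<in> PiE P (\<lambda>X. X)" for g
  proof -
    have "\<phi> g permutes E"
    proof (rule permutes_if_inj_on[OF finite_E])
      show "inj_on (\<phi> g) E"
      proof (rule inj_onI)
        fix x y assume xy: "x \<in> E" "y \<in> E" and eq: "\<phi> g x = \<phi> g y"
        obtain X n where x: "X \<in> P" "x = walk (r X) (Suc n)" using repr xy by blast
        obtain X' m where y: "X' \<in> P" "y = walk (r X') (Suc m)" using repr xy by blast
        have w: "walk (g X) (Suc n) = walk (g X') (Suc m)"
          using eq \<phi>[OF g x(1)] \<phi>[OF g y(1)] x(2) y(2) by metis
        have "orb (walk (g X) (Suc n)) = X" if "X \<in> P" for X n
          using orb_eq[OF gO(2)[OF g that], of "walk (g X) (Suc n)"] gO(4)[OF g that]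
          unfolding orb_def by blast
        then have "X = X'" using w x(1) y(1) by metis
        then show "x = y"
          using w walk_eq_transfer[OF r(2)[OF x(1)] gO(3)[OF g x(1)]] x(2) y(2) by metis
      qed
      show "\<phi> g ` E \<subseteq> E"
      proof (rule image_subsetI)
        fix x assume "x \<in> E"
        then obtain X n where x: "X \<in> P" "x = walk (r X) (Suc n)" using repr by blast
        then show "\<phi> g x \<in> E"
          unfolding x(2) \<phi>[OF g x(1)] using walk_in[OF gO(2)[OF g x(1)]] by blast
      qed
    qed (simp add: \<phi>_def)
    moreover have "\<phi> g (step i x) = step i (\<phi> g x)" if "x \<in> E" for x i
    proof -
      obtain X n where x: "X \<in> P" "x = walk (r X) (Suc n)" using repr[OF \<open>x \<in> E\<close>] by blast
      have rg: "r X \<in> E" "g X \<in> E" using r gO g x(1) by auto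
      show ?thesis
      proof (cases "even (i + n)")
        case True
        then have s: "step n = step i" by (intro step_eq_if_even) auto
        have 1: "step i x = walk (r X) n" using x(2) s step(2)[OF walk_in[OF rg(1)]] by simp
        have 2: "step i (\<phi> g x) = walk (g X) n"
          using \<phi>[OF g x(1), of "Suc n"] x(2) s step(2)[OF walk_in[OF rg(2)]] by simp
        show ?thesis unfolding 1 2 by (rule \<phi>[OF g x(1)])
      next
        case False
        then have s: "step (Suc n) = step i" by (intro step_eq_if_even) auto
        have 1: "step i x = walk (r X) (Suc (Suc n))" using x(2) s by simp
        have 2: "step i (\<phi> g x) = walk (g X) (Suc (Suc n))"
          using \<phi>[OF g x(1), of "Suc n"] x(2) s by simp
        show ?thesis unfolding 1 2 by (rule \<phi>[OF g x(1)])
      qed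
    qed
    from this[of _ 0] this[of _ 1] have "\<forall>e\<in>E. \<phi> g (a e) = a (\<phi> g e) \<and> \<phi> g (b e) = b (\<phi> g e)"
      by (simp add: step_def)
    ultimately show ?thesis by simp
  qed
  then have "\<phi> ` PiE P (\<lambda>X. X) \<subseteq> ?C" by blast
  moreover have "inj_on \<phi> (PiE P (\<lambda>X. X))"
  proof (rule inj_onI)
    fix g h assume g: "g \<in> PiE P (\<lambda>X. X)" "h \<in> PiE P (\<lambda>X. X)" and eq: "\<phi> g = \<phi> h"
    show "g = h"
    proof (rule PiE_ext[OF g])
      fix X assume X: "X \<in> P"
      show "g X = h X" using \<phi>[OF g(1) X, of 0] \<phi>[OF g(2) X, of 0] eq by simp
    qed
  qed
  moreover have "finite ?C"
    by (rule finite_subset[OF _ finite_permutations[OF finite_E]]) auto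
  ultimately have "card (PiE P (\<lambda>X. X)) \<le> card ?C"
    by (intro card_inj_on_le[of \<phi>])
  moreover have "card (PiE P (\<lambda>X. X)) = (\<Prod>X\<in>P. card X)"
    using finP by (rule card_PiE)
  moreover have "(\<Sum>X\<in>P. card X) \<le> (\<Prod>X\<in>P. card X)"
    using finP card_orb by (intro sum_le_prod) (auto simp: P_def)
  moreover have "card E = (\<Sum>X\<in>P. card X)"
  proof -
    have "E = \<Union>P" using orb_in self_in_orb by (fastforce simp: P_def)
    moreover have "disjoint P"
    proof (rule disjointI)
      fix A B assume AB: "A \<in> P" "B \<in> P" "A \<noteq> B"
      then obtain e f where ef: "e \<in> E" "f \<in> E" "A = orb e" "B = orb f" by (auto simp: P_def)
      show "A \<inter> B = {}"
      proof (rule ccontr)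
        assume "A \<inter> B \<noteq> {}"
        then obtain g where "g \<in> orb e" "g \<in> orb f" using ef by auto
        then have "orb e = orb f" using orb_eq ef by metis
        then show False using ef AB by simp
      qed
    qed
    moreover have "finite A" if "A \<in> P" for A using r(4)[OF that] finite_E finite_subset by blast
    ultimately show ?thesis using card_Union_disjoint[of P] by simp
  qed
  ultimately show ?thesis by linarith
qed

end

section \<open>Two-regular graphs\<close>

text \<open>
  With two edges at every vertex, the partner of an edge is the other edge at its end.
\<close>

lemma ex_partner:
  assumes fib: "\<And>i. i < k \<Longrightarrow> card {e\<in>E. bl e = i} = 2" and bl: "bl ` E \<subseteq> {..<k}"
  obtains a where "\<And>e. e \<in> E \<Longrightarrow> a e \<in> E" "\<And>e. e \<in> E \<Longrightarrow> a (a e) = e" "\<And>e. e \<in> E \<Longrightarrow> a e \<noteq> e"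
    "\<And>e e'. e \<in> E \<Longrightarrow> e' \<in> E \<Longrightarrow> bl e' = bl e \<longleftrightarrow> e' = e \<or> e' = a e"
proof -
  have "\<exists>e'. \<forall>f\<in>E. e' \<in> E \<and> e' \<noteq> e \<and> (bl f = bl e \<longleftrightarrow> f = e \<or> f = e')" if e: "e \<in> E" for e
  proof -
    let ?F = "{f\<in>E. bl f = bl e}"
    have "card ?F = 2" using fib bl e by auto
    then obtain x y where xy: "?F = {x, y}" "x \<noteq> y" unfolding card_2_iff by blast
    have "e \<in> {x, y}" unfolding xy(1)[symmetric] using e by simp
    then obtain e' where F: "?F = {e, e'}" "e' \<noteq> e"
      using xy by (cases "e = x") (auto simp: insert_commute)
    have "e' \<in> ?F" unfolding F(1) by simp
    moreover have "bl f = bl e \<longleftrightarrow> f \<in> ?F" if "f \<in> E" for f using that by simp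
    ultimately have "\<forall>f\<in>E. e' \<in> E \<and> e' \<noteq> e \<and> (bl f = bl e \<longleftrightarrow> f = e \<or> f = e')"
      using F by auto
    then show ?thesis by (rule exI)
  qed
  then have "\<forall>e\<in>E. \<exists>e'. \<forall>f\<in>E. e' \<in> E \<and> e' \<noteq> e \<and> (bl f = bl e \<longleftrightarrow> f = e \<or> f = e')" by simp
  from bchoice[OF this] obtain a
    where A: "\<forall>e\<in>E. \<forall>f\<in>E. a e \<in> E \<and> a e \<noteq> e \<and> (bl f = bl e \<longleftrightarrow> f = e \<or> f = a e)" ..
  have aE: "a e \<in> E" "a e \<noteq> e" if "e \<in> E" for e using A that by simp_all
  have A': "bl f = bl e \<longleftrightarrow> f = e \<or> f = a e" if "e \<in> E" "f \<in> E" for e f using A that by simp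
  show thesis
  proof (rule that[of a])
    show "a (a e) = e" if "e \<in> E" for e
    proof -
      have "bl e = bl (a e)" using A'[OF that aE(1)[OF that]] by simp
      then show ?thesis using A'[OF aE(1)[OF that] that] aE(2)[OF that] by auto
    qed
  qed (use A' aE in simp_all)
qed

lemma ex_induced_permutation:
  assumes fin: "finite E" and bl: "bl ` E \<subseteq> {..<k::nat}" and surj: "\<And>i. i < k \<Longrightarrow> \<exists>e\<in>E. bl e = i"
    and q: "q permutes E" and pres: "\<And>e e'. e \<in> E \<Longrightarrow> e' \<in> E \<Longrightarrow> bl e = bl e' \<Longrightarrow> bl (q e) = bl (q e')"
  shows "\<exists>\<sigma>. \<sigma> permutes {..<k} \<and> (\<forall>e\<in>E. bl (q e) = \<sigma> (bl e))"
proof -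
  define \<sigma> where "\<sigma> i = (if i < k then bl (q (SOME e. e \<in> E \<and> bl e = i)) else i)" for i
  have qE: "q e \<in> E" if "e \<in> E" for e using that q by (simp add: permutes_in_image)
  have \<sigma>: "bl (q e) = \<sigma> (bl e)" if e: "e \<in> E" for e
  proof -
    have some: "(SOME e'. e' \<in> E \<and> bl e' = bl e) \<in> E \<and> bl (SOME e'. e' \<in> E \<and> bl e' = bl e) = bl e"
      by (rule someI[of _ e]) (simp add: e)
    have "bl e < k" using bl e by auto
    then have "\<sigma> (bl e) = bl (q (SOME e'. e' \<in> E \<and> bl e' = bl e))" by (simp add: \<sigma>_def)
    also have "\<dots> = bl (q e)" using some by (intro pres[OF _ e]) simp_all
    finally show ?thesis by simp
  qed
  have "{..<k} \<subseteq> \<sigma> ` {..<k}"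
  proof
    fix i assume "i \<in> {..<k}"
    then obtain e where e: "e \<in> E" "bl e = i" using surj by auto
    have inv: "inv q e \<in> E" "q (inv q e) = e"
      using e(1) permutes_in_image[OF permutes_inv[OF q]] permutes_inverses(1)[OF q] by simp_all
    have "i = \<sigma> (bl (inv q e))" using \<sigma>[OF inv(1)] inv(2) e(2) by simp
    moreover have "bl (inv q e) \<in> {..<k}" using bl inv(1) by blast
    ultimately show "i \<in> \<sigma> ` {..<k}" by (rule image_eqI)
  qed
  moreover have "\<sigma> ` {..<k} \<subseteq> {..<k}"
  proof (rule image_subsetI)
    fix i assume "i \<in> {..<k}"
    then obtain e where e: "e \<in> E" "bl e = i" using surj by auto
    have "bl (q e) \<in> {..<k}" using bl qE[OF e(1)] by blast
    then show "\<sigma> i \<in> {..<k}" using \<sigma>[OF e(1)] e(2) by simp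
  qed
  ultimately have im: "\<sigma> ` {..<k} = {..<k}" by simp
  then have "inj_on \<sigma> {..<k}" by (intro eq_card_imp_inj_on) simp_all
  then have "\<sigma> permutes {..<k}" using im by (intro permutes_if_inj_on) (auto simp: \<sigma>_def)
  then show ?thesis using \<sigma> by blast
qed

lemma aut_orders_2_ge:
  assumes "n \<in> aut_orders k 2"
  shows "n \<ge> 2 * k"
proof -
  obtain E :: "nat set" and bl wh where ed: "edge_data k 2 E bl wh" and n: "n = card (edge_aut k E bl wh)"
    using aut_orders_edge_data[OF assms] one_le_numeral by blast
  have E: "finite E" "bl ` E \<subseteq> {..<k}" "wh ` E \<subseteq> {..<k}"
    and fib: "\<And>i. i < k \<Longrightarrow> card {e\<in>E. bl e = i} = 2" "\<And>i. i < k \<Longrightarrow> card {e\<in>E. wh e = i} = 2"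
    using ed by (auto simp: edge_data_def)
  obtain a where a: "\<And>e. e \<in> E \<Longrightarrow> a e \<in> E" "\<And>e. e \<in> E \<Longrightarrow> a (a e) = e" "\<And>e. e \<in> E \<Longrightarrow> a e \<noteq> e"
    and a4: "\<And>e e'. e \<in> E \<Longrightarrow> e' \<in> E \<Longrightarrow> bl e' = bl e \<longleftrightarrow> e' = e \<or> e' = a e"
    using ex_partner[of k E bl] fib(1) E(2) by blast
  obtain b where b: "\<And>e. e \<in> E \<Longrightarrow> b e \<in> E" "\<And>e. e \<in> E \<Longrightarrow> b (b e) = e" "\<And>e. e \<in> E \<Longrightarrow> b e \<noteq> e"
    and b4: "\<And>e e'. e \<in> E \<Longrightarrow> e' \<in> E \<Longrightarrow> wh e' = wh e \<longleftrightarrow> e' = e \<or> e' = b e"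
    using ex_partner[of k E wh] fib(2) E(3) by blast
  interpret involution_pair E a b by unfold_locales (use E a b in auto)
  let ?C = "{q. q permutes E \<and> (\<forall>e\<in>E. q (a e) = a (q e) \<and> q (b e) = b (q e))}"
  have "?C \<subseteq> edge_aut k E bl wh"
  proof
    fix q assume "q \<in> ?C"
    then have q: "q permutes E" "\<And>e. e \<in> E \<Longrightarrow> q (a e) = a (q e)" "\<And>e. e \<in> E \<Longrightarrow> q (b e) = b (q e)"
      by auto
    have qE: "q e \<in> E" if "e \<in> E" for e using that q(1) by (simp add: permutes_in_image)
    have "\<exists>\<sigma>. \<sigma> permutes {..<k} \<and> (\<forall>e\<in>E. bl (q e) = \<sigma> (bl e))"
    proof (rule ex_induced_permutation[OF E(1,2) _ q(1)])
      show "\<exists>e\<in>E. bl e = i" if "i < k" for i by (rule edge_data_surj(1)[OF ed _ that]) simp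
      show "bl (q e) = bl (q e')" if "e \<in> E" "e' \<in> E" "bl e = bl e'" for e e'
        using a4[OF that(2,1)] that(3) a4[OF qE[OF that(2)] qE[OF that(1)]] q(2)[OF that(2)] by auto
    qed
    moreover have "\<exists>\<sigma>. \<sigma> permutes {..<k} \<and> (\<forall>e\<in>E. wh (q e) = \<sigma> (wh e))"
    proof (rule ex_induced_permutation[OF E(1,3) _ q(1)])
      show "\<exists>e\<in>E. wh e = i" if "i < k" for i by (rule edge_data_surj(2)[OF ed _ that]) simp
      show "wh (q e) = wh (q e')" if "e \<in> E" "e' \<in> E" "wh e = wh e'" for e e'
        using b4[OF that(2,1)] that(3) b4[OF qE[OF that(2)] qE[OF that(1)]] q(3)[OF that(2)] by auto
    qed
    ultimately show "q \<in> edge_aut k E bl wh" using q(1) by (auto simp: edge_aut_def)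
  qed
  moreover have "finite (edge_aut k E bl wh)"
    unfolding edge_aut_def by (rule finite_subset[OF _ finite_permutations[OF E(1)]]) auto
  ultimately have "card E \<le> n"
    unfolding n using card_centraliser by (intro order.trans[OF card_centraliser card_mono])
  moreover have "card E = 2 * k"
    using sum.group[of E "{..<k}" bl "\<lambda>_. 1::nat"] E fib(1) by simp
  ultimately show ?thesis by simp
qed

text \<open>
  The cycle of length \<open>2 * k\<close> attains the bound: a symmetry is determined by the image of the edge at
  position \<open>(0, 0)\<close>, because every further vertex is the second neighbour of the one before.
\<close>

lemma chi_2:
  assumes k: "k \<ge> 3"
  shows "chi k 2 = 2 * k"
proof -
  define M :: "nat \<Rightarrow> nat \<Rightarrow> nat" where "M i j = (if j = i \<or> j = Suc i mod k then 1 else 0)" for i j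
  have Suc_mod: "Suc i mod k = (if Suc i = k then 0 else Suc i)" if "i < k" for i
    using that by auto
  have M1: "M i j = 1 \<longleftrightarrow> j = i \<or> j = Suc i mod k" for i j by (simp add: M_def)
  have row: "j = j'" if "M i j = 1" "M i j' = 1" "M i m = 1" "j \<noteq> m" "j' \<noteq> m" for i j j' m
    using that unfolding M1 by auto
  have col: "i = i'" if "M i j = 1" "M i' j = 1" "M m j = 1" "i \<noteq> m" "i' \<noteq> m" "i < k" "i' < k" "m < k"
    for i i' j m
    using that unfolding M1 by (auto simp: Suc_mod split: if_splits)
  have "line_sums k 2 M"
    unfolding line_sums_def
  proof (intro conjI allI impI)
    fix i assume i: "i < k"
    have "(\<Sum>j<k. M i j) = (\<Sum>j\<in>{i, Suc i mod k}. 1)"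
      using i k by (intro sum.mono_neutral_cong_right) (auto simp: M_def)
    also have "\<dots> = 2" using i k by (auto simp: Suc_mod)
    finally show "(\<Sum>j<k. M i j) = 2" .
    have "(\<Sum>j<k. M j i) = (\<Sum>j\<in>{i, if i = 0 then k - 1 else i - 1}. 1)"
      using i k by (intro sum.mono_neutral_cong_right) (auto simp: M_def Suc_mod split: if_splits)
    also have "\<dots> = 2" using i k by auto
    finally show "(\<Sum>j<k. M j i) = 2" .
  qed
  then have "card (mat_aut k M) * (\<Prod>i<k. \<Prod>j<k. fact (M i j)) \<in> aut_orders k 2"
    by (rule aut_ordersI) simp
  moreover have "(\<Prod>i<k. \<Prod>j<k. fact (M i j)) = (1 :: nat)"
    by (intro prod.neutral ballI) (simp add: M_def)
  ultimately have mem: "card (mat_aut k M) \<in> aut_orders k 2" by simp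
  let ?S = "{(i, j). i < k \<and> j < k \<and> M i j = 1}"
  have "card (mat_aut k M) \<le> card ?S"
  proof (rule card_inj_on_le)
    show "finite ?S" by (rule finite_subset[of _ "{..<k} \<times> {..<k}"]) auto
    show "(\<lambda>x. (fst x 0, snd x 0)) ` mat_aut k M \<subseteq> ?S"
    proof (rule image_subsetI)
      fix x assume "x \<in> mat_aut k M"
      then obtain \<sigma> \<tau> where x: "x = (\<sigma>, \<tau>)" and p: "\<sigma> permutes {..<k}" "\<tau> permutes {..<k}"
        and M: "\<And>i j. i < k \<Longrightarrow> j < k \<Longrightarrow> M (\<sigma> i) (\<tau> j) = M i j" by (auto simp: mat_aut_def)
      have "\<sigma> 0 < k" "\<tau> 0 < k" using p k permutes_in_image[of _ "{..<k}" 0] by auto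
      then show "(fst x 0, snd x 0) \<in> ?S" using M[of 0 0] M1[of 0 0] k by (simp add: x)
    qed
    show "inj_on (\<lambda>x. (fst x 0, snd x 0)) (mat_aut k M)"
    proof (rule inj_onI)
      fix x y assume xy: "x \<in> mat_aut k M" "y \<in> mat_aut k M" and eq: "(fst x 0, snd x 0) = (fst y 0, snd y 0)"
      obtain \<sigma> \<tau> where x: "x = (\<sigma>, \<tau>)" and p: "\<sigma> permutes {..<k}" "\<tau> permutes {..<k}"
        and M: "\<And>i j. i < k \<Longrightarrow> j < k \<Longrightarrow> M (\<sigma> i) (\<tau> j) = M i j" using xy(1) by (auto simp: mat_aut_def)
      obtain \<sigma>' \<tau>' where y: "y = (\<sigma>', \<tau>')" and p': "\<sigma>' permutes {..<k}" "\<tau>' permutes {..<k}"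
        and M': "\<And>i j. i < k \<Longrightarrow> j < k \<Longrightarrow> M (\<sigma>' i) (\<tau>' j) = M i j" using xy(2) by (auto simp: mat_aut_def)
      have inj: "\<rho> i = \<rho> j \<longleftrightarrow> i = j" if "\<rho> permutes {..<k}" for \<rho> i j
        using permutes_inj[OF that] by (simp add: inj_eq)
      have lt: "\<rho> i < k" if "\<rho> permutes {..<k}" "i < k" for \<rho> i
        using that permutes_in_image[of \<rho> "{..<k}" i] by simp
      have "\<sigma> i = \<sigma>' i \<and> \<tau> i = \<tau>' i" if "i < k" for i
        using that
      proof (induction i)
        case 0
        then show ?case using eq by (simp add: x y)
      next
        case (Suc i)
        then have IH: "\<sigma> i = \<sigma>' i" "\<tau> i = \<tau>' i" and i: "i < k" by auto
        have 1: "M i i = 1" "M i (Suc i) = 1" "M (Suc i) (Suc i) = 1"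
          using Suc.prems unfolding M1 by (auto simp: Suc_mod)
        have ne: "\<tau> (Suc i) \<noteq> \<tau> i" "\<tau>' (Suc i) \<noteq> \<tau> i" "\<sigma> (Suc i) \<noteq> \<sigma> i" "\<sigma>' (Suc i) \<noteq> \<sigma> i"
          using inj[OF p(1)] inj[OF p(2)] inj[OF p'(1)] inj[OF p'(2)]
          by (simp_all add: IH(1) IH(2)) (simp_all flip: IH)
        have t: "\<tau> (Suc i) = \<tau>' (Suc i)"
          by (rule row[of "\<sigma> i" _ _ "\<tau> i"])
            (use IH 1 M[OF i Suc.prems] M'[OF i Suc.prems] M[OF i i] ne in auto)
        have "\<sigma> (Suc i) = \<sigma>' (Suc i)"
          by (rule col[of _ "\<tau> (Suc i)" _ "\<sigma> i"])
            (use IH 1 t M[OF i Suc.prems] M[OF Suc.prems Suc.prems] M'[OF Suc.prems Suc.prems]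
               ne lt p p' i Suc.prems in auto)
        then show ?case using t by simp
      qed
      then have "\<sigma> = \<sigma>'" "\<tau> = \<tau>'"
        using permutes_lessThan_eqI p p' by blast+
      then show "x = y" by (simp add: x y)
    qed
  qed
  also have "card ?S \<le> card ((\<lambda>i. (i, i)) ` {..<k} \<union> (\<lambda>i. (i, Suc i mod k)) ` {..<k})"
    unfolding M1 by (rule card_mono) auto
  also have "\<dots> \<le> 2 * k"
  proof -
    have "card (f ` {..<k}) \<le> k" for f :: "nat \<Rightarrow> nat \<times> nat"
      using card_image_le[of "{..<k}" f] by simp
    then show ?thesis
      unfolding mult_2 by (intro order.trans[OF card_Un_le] add_mono)
  qed
  finally have "card (mat_aut k M) = 2 * k" using aut_orders_2_ge[OF mem] by simp
  then show ?thesis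
    unfolding chi_def using mem aut_orders_2_ge finite_aut_orders by (intro Min_eqI) auto
qed

section \<open>Sources of symmetry of a matrix\<close>

lemma id_in_mat_aut: "(id, id) \<in> mat_aut k D"
  by (simp add: mat_aut_def permutes_id)

lemma card_mat_aut_pos: "card (mat_aut k D) \<ge> 1"
  using id_in_mat_aut[of k D] card_gt_0_iff[of "mat_aut k D"] finite_mat_aut[of k D] by fastforce

lemma card_mat_aut_ge_2:
  assumes "(\<sigma>, \<tau>) \<in> mat_aut k D" "\<sigma> \<noteq> id"
  shows "card (mat_aut k D) \<ge> 2"
proof -
  have "card {(\<sigma>, \<tau>), (id, id)} \<le> card (mat_aut k D)"
    using assms id_in_mat_aut by (intro card_mono) auto
  then show ?thesis using assms(2) by simp
qed

lemma mat_aut_cong: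
  assumes "\<And>i j i' j'. i < k \<Longrightarrow> j < k \<Longrightarrow> i' < k \<Longrightarrow> j' < k \<Longrightarrow> D i j = D i' j' \<longleftrightarrow> D' i j = D' i' j'"
  shows "mat_aut k D = mat_aut k D'"
proof -
  have "\<sigma> i < k" if "\<sigma> permutes {..<k}" "i < k" for \<sigma> i
    using that permutes_in_image[of \<sigma> "{..<k}" i] by simp
  then show ?thesis using assms by (auto simp: mat_aut_def)
qed

lemma line_sums_transpose: "line_sums k c D \<Longrightarrow> line_sums k c (\<lambda>i j. D j i)"
  by (simp add: line_sums_def)

definition row_types :: "nat \<Rightarrow> (nat \<Rightarrow> nat \<Rightarrow> 'a) \<Rightarrow> (nat \<Rightarrow> 'a) set" where
  "row_types k D = (\<lambda>i. restrict (D i) {..<k}) ` {..<k}"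

lemma two_power_le_fact: "2 ^ (n - 1) \<le> (fact n :: nat)"
proof (induction n)
  case (Suc n)
  then show ?case
    by (cases n) (auto simp: algebra_simps intro: order.trans[OF mult_le_mono])
qed simp

text \<open>
  A class of \<open>n\<close> equally labelled elements contributes \<open>fact n \<ge> 2 ^ (n - 1)\<close>, so every element beyond
  the first of its class yields a factor 2.
\<close>

lemma card_lifts_id_ge:
  assumes "finite A"
  shows "2 ^ (card A - card (g ` A)) \<le> card (lifts A g id)"
proof -
  have fib: "card {e\<in>A. g e = x} \<ge> 1" if "x \<in> g ` A" for x
    using that assms by (auto simp: Suc_le_eq card_gt_0_iff)
  have "(\<Sum>x\<in>g ` A. card {e\<in>A. g e = x}) = card A"
    using sum.group[of A "g ` A" g "\<lambda>_. 1::nat"] assms by simp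
  moreover have "(\<Sum>x\<in>g ` A. card {e\<in>A. g e = x} - 1) = (\<Sum>x\<in>g ` A. card {e\<in>A. g e = x}) - (\<Sum>x\<in>g ` A. 1)"
    using fib by (intro sum_subtractf_nat)
  ultimately have "card A - card (g ` A) = (\<Sum>x\<in>g ` A. card {e\<in>A. g e = x} - 1)" by simp
  then have "2 ^ (card A - card (g ` A)) = (\<Prod>x\<in>g ` A. 2 ^ (card {e\<in>A. g e = x} - 1) :: nat)"
    by (simp add: power_sum)
  also have "\<dots> \<le> (\<Prod>x\<in>g ` A. fact (card {e\<in>A. g e = x}))"
    by (intro prod_mono conjI two_power_le_fact) simp
  also have "\<dots> = card (lifts A g id)"
    using assms by (intro card_lifts_id[symmetric]) auto
  finally show ?thesis .
qed

text \<open>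
  Equal rows can be permuted freely, and so can equal columns, independently of the rows.
\<close>

lemma card_mat_aut_ge_types:
  "2 ^ (k - card (row_types k D)) * 2 ^ (k - card (row_types k (\<lambda>i j. D j i))) \<le> card (mat_aut k D)"
proof -
  let ?r = "\<lambda>i. restrict (D i) {..<k}" and ?c = "\<lambda>j. restrict (\<lambda>i. D i j) {..<k}"
  have "lifts {..<k} ?r id \<times> lifts {..<k} ?c id \<subseteq> mat_aut k D"
  proof
    fix x assume "x \<in> lifts {..<k} ?r id \<times> lifts {..<k} ?c id"
    then obtain \<sigma> \<tau> where x: "x = (\<sigma>, \<tau>)" and p: "\<sigma> permutes {..<k}" "\<tau> permutes {..<k}"
      and r: "\<And>i. i < k \<Longrightarrow> ?r (\<sigma> i) = ?r i" and c: "\<And>j. j < k \<Longrightarrow> ?c (\<tau> j) = ?c j"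
      by (auto simp: lifts_def)
    have "D (\<sigma> i) (\<tau> j) = D i j" if "i < k" "j < k" for i j
    proof -
      have "\<tau> j < k" using p(2) that(2) permutes_in_image[of \<tau> "{..<k}" j] by simp
      then have "D (\<sigma> i) (\<tau> j) = D i (\<tau> j)" using fun_cong[OF r[OF that(1)], of "\<tau> j"] by simp
      also have "\<dots> = D i j" using fun_cong[OF c[OF that(2)], of i] that(1) by simp
      finally show ?thesis .
    qed
    then show "x \<in> mat_aut k D" using x p by (simp add: mat_aut_def)
  qed
  then have "card (lifts {..<k} ?r id \<times> lifts {..<k} ?c id) \<le> card (mat_aut k D)"
    by (intro card_mono) simp_all
  moreover have "2 ^ (k - card (row_types k D)) \<le> card (lifts {..<k} ?r id)"
    using card_lifts_id_ge[of "{..<k}" ?r] by (simp add: row_types_def)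
  moreover have "2 ^ (k - card (row_types k (\<lambda>i j. D j i))) \<le> card (lifts {..<k} ?c id)"
    using card_lifts_id_ge[of "{..<k}" ?c] by (simp add: row_types_def)
  ultimately show ?thesis
    by (auto simp: card_cartesian_product intro: order.trans[OF mult_le_mono])
qed

text \<open>
  In graph terms: a connected component with just two vertices, joined by an entry \<open>w\<close>.
\<close>

definition isolated_entry :: "nat \<Rightarrow> (nat \<Rightarrow> nat \<Rightarrow> int) \<Rightarrow> int \<Rightarrow> nat \<Rightarrow> nat \<Rightarrow> bool" where
  "isolated_entry k D w i j \<longleftrightarrow> i < k \<and> j < k \<and> D i j = w \<and>
     (\<forall>j'<k. j' \<noteq> j \<longrightarrow> D i j' = 0) \<and> (\<forall>i'<k. i' \<noteq> i \<longrightarrow> D i' j = 0)"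

text \<open>
  All these components are isomorphic, so they can be permuted arbitrarily.
\<close>

lemma fact_isolated_entries_le:
  assumes w: "w \<noteq> 0"
  shows "fact (card {i. \<exists>j. isolated_entry k D w i j}) \<le> card (mat_aut k D)"
proof -
  define K where "K = {i. \<exists>j. isolated_entry k D w i j}"
  have Kk: "K \<subseteq> {..<k}" by (auto simp: K_def isolated_entry_def)
  then have finK: "finite K" using finite_subset by blast
  have "\<forall>i\<in>K. \<exists>j. isolated_entry k D w i j" by (simp add: K_def)
  from bchoice[OF this] obtain c where c: "\<And>i. i \<in> K \<Longrightarrow> isolated_entry k D w i (c i)" by blast
  have ck: "c i < k" if "i \<in> K" for i using c[OF that] by (simp add: isolated_entry_def)
  have row: "D i j = (if j = c i then w else 0)" if "i \<in> K" "j < k" for i j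
    using c[OF that(1)] that(2) by (auto simp: isolated_entry_def)
  have col: "D i' (c i) = (if i' = i then w else 0)" if "i \<in> K" "i' < k" for i i'
    using c[OF that(1)] that(2) by (auto simp: isolated_entry_def)
  have "inj_on c K"
  proof (rule inj_onI)
    fix i i' assume i: "i \<in> K" "i' \<in> K" "c i = c i'"
    then have "D i (c i') = w" using c[OF i(1)] by (simp add: isolated_entry_def)
    then show "i = i'" using col[OF i(2), of i] Kk i(1) w by (auto split: if_splits)
  qed
  then have bij: "bij_betw c K (c ` K)" by (simp add: bij_betw_def)
  have "\<exists>\<tau>. (\<kappa>, \<tau>) \<in> mat_aut k D" if \<kappa>: "\<kappa> permutes K" for \<kappa>
  proof -
    have "\<exists>\<tau>. \<tau> permutes c ` K \<and> (\<forall>j\<in>c ` K. inv_into K c (\<tau> j) = \<kappa> (inv_into K c j))"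
      using finK permutes_inj_on[OF \<kappa>] permutes_image[OF \<kappa>]
      by (intro ex_permutation_conjugate[OF _ bij_betw_inv_into[OF bij]]) auto
    then obtain \<tau> where \<tau>: "\<tau> permutes c ` K"
      and "\<forall>j\<in>c ` K. inv_into K c (\<tau> j) = \<kappa> (inv_into K c j)" by blast
    then have inv: "inv_into K c (\<tau> (c i)) = \<kappa> i" if "i \<in> K" for i
      using that bij_betw_inv_into_left[OF bij that] by auto
    have \<kappa>K: "\<kappa> i \<in> K \<longleftrightarrow> i \<in> K" for i using permutes_in_image[OF \<kappa>] .
    have \<tau>c: "\<tau> (c i) = c (\<kappa> i)" if "i \<in> K" for i
    proof -
      have "\<tau> (c i) \<in> c ` K" using that permutes_in_image[OF \<tau>] by simp
      then show ?thesis using inv[OF that] f_inv_into_f by metis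
    qed
    have "D (\<kappa> i) (\<tau> j) = D i j" if ij: "i < k" "j < k" for i j
    proof (cases "j \<in> c ` K")
      case True
      then obtain i' where i': "i' \<in> K" "j = c i'" by auto
      have "\<kappa> i < k" using Kk \<kappa>K[of i] permutes_not_in[OF \<kappa>, of i] ij by (cases "i \<in> K") auto
      then show ?thesis
        using col[of "\<kappa> i'" "\<kappa> i"] col[of i' i] i' \<kappa>K ij \<tau>c[OF i'(1)] permutes_inj[OF \<kappa>]
        by (simp add: inj_eq)
    next
      case False
      then have "\<tau> j = j" using permutes_not_in[OF \<tau>] by blast
      show ?thesis
      proof (cases "i \<in> K")
        case True
        then have "j \<noteq> c i" "j \<noteq> c (\<kappa> i)" using False \<kappa>K by auto
        then show ?thesis using row[OF True ij(2)] row[of "\<kappa> i" j] True \<kappa>K ij \<open>\<tau> j = j\<close> by simp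
      next
        case False
        then show ?thesis using permutes_not_in[OF \<kappa>] \<open>\<tau> j = j\<close> by simp
      qed
    qed
    moreover have "\<kappa> permutes {..<k}" using \<kappa> Kk by (rule permutes_subset)
    moreover have "\<tau> permutes {..<k}" using \<tau> by (rule permutes_subset) (use ck in auto)
    ultimately show ?thesis by (auto simp: mat_aut_def)
  qed
  then have "{\<kappa>. \<kappa> permutes K} \<subseteq> fst ` mat_aut k D" by force
  then have "card {\<kappa>. \<kappa> permutes K} \<le> card (fst ` mat_aut k D)"
    by (intro card_mono) simp_all
  also have "\<dots> \<le> card (mat_aut k D)" by (rule card_image_le) simp
  finally show ?thesis using card_permutations[OF refl finK] by (simp add: K_def)
qed

lemma sum_nat_eq_1:
  fixes f :: "'a \<Rightarrow> nat"
  assumes "finite A" "sum f A = 1"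
  obtains x where "x \<in> A" "f x = 1" "\<And>y. y \<in> A \<Longrightarrow> y \<noteq> x \<Longrightarrow> f y = 0"
proof -
  obtain x where x: "x \<in> A" "f x \<noteq> 0" using assms by (metis sum.neutral zero_neq_one)
  have "sum f A = f x + sum f (A - {x})" using assms(1) x(1) by (rule sum.remove)
  then have "f x = 1" "sum f (A - {x}) = 0" using x assms(2) by auto
  then show thesis using that[OF x(1)] assms(1) by auto
qed

lemma unit_difference:
  fixes f :: "'a \<Rightarrow> int"
  assumes "finite A" "sum f A = 0" "(\<Sum>x\<in>A. nat (- f x)) = 1"
  obtains p n where "p \<in> A" "n \<in> A" "p \<noteq> n"
    "\<And>y. y \<in> A \<Longrightarrow> f y = (if y = p then 1 else if y = n then -1 else 0)"
proof -
  have "int (\<Sum>x\<in>A. nat (f x)) - int (\<Sum>x\<in>A. nat (- f x)) = sum f A"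
    unfolding of_nat_sum sum_subtractf[symmetric] by (intro sum.cong) auto
  then have "(\<Sum>x\<in>A. nat (f x)) = 1" using assms(2,3) by linarith
  from sum_nat_eq_1[OF assms(1) this] obtain p
    where p: "p \<in> A" "nat (f p) = 1" "\<And>y. y \<in> A \<Longrightarrow> y \<noteq> p \<Longrightarrow> nat (f y) = 0" by metis
  from sum_nat_eq_1[OF assms(1,3)] obtain n
    where n: "n \<in> A" "nat (- f n) = 1" "\<And>y. y \<in> A \<Longrightarrow> y \<noteq> n \<Longrightarrow> nat (- f y) = 0" by metis
  have "p \<noteq> n" using p(2) n(2) by auto
  show thesis
  proof (rule that[OF p(1) n(1) \<open>p \<noteq> n\<close>])
    fix y assume "y \<in> A"
    then have "y \<noteq> p \<Longrightarrow> f y \<le> 0" "y \<noteq> n \<Longrightarrow> f y \<ge> 0" using p(3)[of y] n(3)[of y] by auto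
    moreover have "f p = 1" "f n = -1" using p(2) n(2) by auto
    ultimately show "f y = (if y = p then 1 else if y = n then -1 else 0)"
      using \<open>p \<noteq> n\<close> by (cases "y = p"; cases "y = n") force+
  qed
qed

text \<open>
  Every row and every column has exactly one entry 1 and one entry -1, so the matrix is a union of
  cycles with alternating signs.  Moving each row to the one whose -1 stands in the column of its
  1 rotates all cycles by two edges, and no row is fixed.
\<close>

lemma rotation_of_signed_cycles:
  fixes D :: "nat \<Rightarrow> nat \<Rightarrow> int"
  assumes fin: "finite R" "finite C" and ne: "R \<noteq> {}"
    and row: "\<And>i. i \<in> R \<Longrightarrow> (\<Sum>j\<in>C. D i j) = 0" "\<And>i. i \<in> R \<Longrightarrow> (\<Sum>j\<in>C. nat (- D i j)) = 1"
    and col: "\<And>j. j \<in> C \<Longrightarrow> (\<Sum>i\<in>R. D i j) = 0" "\<And>j. j \<in> C \<Longrightarrow> (\<Sum>i\<in>R. nat (- D i j)) = 1"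
  obtains \<sigma> \<tau> where "\<sigma> permutes R" "\<tau> permutes C" "\<sigma> \<noteq> id"
    "\<And>i j. i \<in> R \<Longrightarrow> j \<in> C \<Longrightarrow> D (\<sigma> i) (\<tau> j) = D i j"
proof -
  have "\<forall>i\<in>R. \<exists>x. fst x \<in> C \<and> snd x \<in> C \<and> fst x \<noteq> snd x \<and>
      (\<forall>j\<in>C. D i j = (if j = fst x then 1 else if j = snd x then -1 else 0))"
  proof
    fix i assume "i \<in> R"
    from unit_difference[OF fin(2) row[OF this]] obtain p n where "p \<in> C" "n \<in> C" "p \<noteq> n"
      "\<And>y. y \<in> C \<Longrightarrow> D i y = (if y = p then 1 else if y = n then -1 else 0)" by metis
    then show "\<exists>x. fst x \<in> C \<and> snd x \<in> C \<and> fst x \<noteq> snd x \<and>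
      (\<forall>j\<in>C. D i j = (if j = fst x then 1 else if j = snd x then -1 else 0))"
      by (intro exI[of _ "(p, n)"]) simp
  qed
  from bchoice[OF this] obtain f where f: "\<forall>i\<in>R. fst (f i) \<in> C \<and> snd (f i) \<in> C \<and> fst (f i) \<noteq> snd (f i) \<and>
      (\<forall>j\<in>C. D i j = (if j = fst (f i) then 1 else if j = snd (f i) then -1 else 0))" ..
  define p n where "p i = fst (f i)" and "n i = snd (f i)" for i
  have pn: "p i \<in> C" "n i \<in> C" "p i \<noteq> n i" if "i \<in> R" for i
    using f that by (auto simp: p_def n_def)
  have D: "D i j = (if j = p i then 1 else if j = n i then -1 else 0)" if "i \<in> R" "j \<in> C" for i j
    using f that by (auto simp: p_def n_def)
  have Dp: "D i j = 1 \<longleftrightarrow> j = p i" and Dn: "D i j = -1 \<longleftrightarrow> j = n i" if "i \<in> R" "j \<in> C" for i j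
    using D[OF that] pn(3)[OF that(1)] by auto
  have colE: "\<exists>x y. x \<in> R \<and> y \<in> R \<and> (\<forall>i\<in>R. (D i j = 1 \<longleftrightarrow> i = x) \<and> (D i j = -1 \<longleftrightarrow> i = y))" if "j \<in> C" for j
  proof -
    obtain x y where "x \<in> R" "y \<in> R" "x \<noteq> y"
      "\<And>i. i \<in> R \<Longrightarrow> D i j = (if i = x then 1 else if i = y then -1 else 0)"
      using unit_difference[OF fin(1) col[OF \<open>j \<in> C\<close>]] by metis
    then show ?thesis by (intro exI[of _ x] exI[of _ y]) auto
  qed
  have bij_p: "bij_betw p R C"
    unfolding bij_betw_def
  proof (intro conjI inj_onI equalityI subsetI)
    fix i i' assume i: "i \<in> R" "i' \<in> R" "p i = p i'"
    then have "D i (p i) = 1" "D i' (p i) = 1" using Dp pn(1) by auto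
    then show "i = i'" using colE[OF pn(1)[OF i(1)]] i by metis
  next
    fix j assume "j \<in> C"
    then obtain x where "x \<in> R" "D x j = 1" using colE by metis
    then show "j \<in> p ` R" using Dp \<open>j \<in> C\<close> by blast
  qed (use pn in auto)
  have bij_n: "bij_betw n R C"
    unfolding bij_betw_def
  proof (intro conjI inj_onI equalityI subsetI)
    fix i i' assume i: "i \<in> R" "i' \<in> R" "n i = n i'"
    then have "D i (n i) = -1" "D i' (n i) = -1" using Dn pn(2) by auto
    then show "i = i'" using colE[OF pn(2)[OF i(1)]] i by metis
  next
    fix j assume "j \<in> C"
    then obtain x where "x \<in> R" "D x j = -1" using colE by metis
    then show "j \<in> n ` R" using Dn \<open>j \<in> C\<close> by blast
  qed (use pn in auto)
  have pinj: "p i = p i' \<longleftrightarrow> i = i'" and ninj: "n i = n i' \<longleftrightarrow> i = i'" if "i \<in> R" "i' \<in> R" for i i'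
    using bij_betw_imp_inj_on[OF bij_p] bij_betw_imp_inj_on[OF bij_n] that by (auto dest: inj_onD)
  \<comment> \<open>the column symmetry takes the negative entry of a row to its positive entry\<close>
  define \<tau> where "\<tau> j = (if j \<in> C then p (inv_into R n j) else j)" for j
  have \<tau>n: "\<tau> (n i) = p i" if "i \<in> R" for i
    using that pn bij_betw_inv_into_left[OF bij_n that] by (simp add: \<tau>_def)
  have "bij_betw (p \<circ> inv_into R n) C C"
    using bij_betw_trans[OF bij_betw_inv_into[OF bij_n] bij_p] .
  then have "bij_betw \<tau> C C" by (rule bij_betw_cong[THEN iffD1, rotated]) (simp add: \<tau>_def)
  then have \<tau>: "\<tau> permutes C" by (rule bij_imp_permutes) (simp add: \<tau>_def)
  obtain \<sigma> where \<sigma>: "\<sigma> permutes R" "\<And>i. i \<in> R \<Longrightarrow> n (\<sigma> i) = \<tau> (n i)"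
    using ex_permutation_conjugate[OF fin(1) bij_n permutes_inj_on[OF \<tau>]]
      permutes_image[OF \<tau>] bij_betwE[OF bij_n] by (metis order_refl)
  have \<sigma>R: "\<sigma> i \<in> R" if "i \<in> R" for i using \<sigma>(1) that permutes_in_image by metis
  have n\<sigma>: "n (\<sigma> i) = p i" if "i \<in> R" for i using \<sigma>(2) \<tau>n that by simp
  have p\<sigma>: "p (\<sigma> i) = \<tau> (p i)" if "i \<in> R" for i using n\<sigma>[OF that] \<tau>n[OF \<sigma>R[OF that]] by simp
  have inj\<tau>: "\<tau> j = \<tau> j' \<longleftrightarrow> j = j'" for j j' using permutes_inj[OF \<tau>] by (simp add: inj_eq)
  show thesis
  proof (rule that[OF \<sigma>(1) \<tau>])
    obtain i where i: "i \<in> R" using ne by auto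
    then have "\<sigma> i \<noteq> i" using n\<sigma>[OF i] pn(3)[OF i] by metis
    then show "\<sigma> \<noteq> id" by auto
    show "D (\<sigma> i) (\<tau> j) = D i j" if ij: "i \<in> R" "j \<in> C" for i j
    proof -
      have "\<tau> j \<in> C" using ij(2) permutes_in_image[OF \<tau>] by simp
      then have "D (\<sigma> i) (\<tau> j) = (if \<tau> j = p (\<sigma> i) then 1 else if \<tau> j = n (\<sigma> i) then -1 else 0)"
        using D \<sigma>R ij(1) by blast
      also have "\<dots> = (if j = p i then 1 else if j = n i then -1 else 0)"
        by (simp only: p\<sigma>[OF ij(1)] \<sigma>(2)[OF ij(1)] inj\<tau>)
      finally show ?thesis using D ij by simp
    qed
  qed
qed

section \<open>Few negative entries force symmetry\<close>

definition neg_mass :: "nat \<Rightarrow> (nat \<Rightarrow> nat \<Rightarrow> int) \<Rightarrow> nat" where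
  "neg_mass k D = (\<Sum>i<k. \<Sum>j<k. nat (- D i j))"

lemma neg_mass_transpose: "neg_mass k (\<lambda>i j. D j i) = neg_mass k D"
  unfolding neg_mass_def by (rule sum.swap)

text \<open>
  The columns are treated by passing to the transposed matrix \<open>\<lambda>i j. D j i\<close>.
\<close>

definition neg_rows :: "nat \<Rightarrow> (nat \<Rightarrow> nat \<Rightarrow> int) \<Rightarrow> nat set" where
  "neg_rows k D = {i. i < k \<and> (\<exists>j<k. D i j < 0)}"

lemma neg_rows_finite [simp]: "finite (neg_rows k D)"
  by (simp add: neg_rows_def)

lemma not_neg_row: "i < k \<Longrightarrow> i \<notin> neg_rows k D \<Longrightarrow> j < k \<Longrightarrow> D i j \<ge> 0"
  by (rule ccontr) (auto simp: neg_rows_def not_le)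

lemma neg_row_mass:
  assumes "i \<in> neg_rows k D"
  shows "(\<Sum>j<k. nat (- D i j)) \<ge> 1"
proof -
  obtain j where j: "j < k" "D i j < 0" using assms by (auto simp: neg_rows_def)
  have "1 \<le> nat (- D i j)" using j(2) by simp
  also have "\<dots> \<le> (\<Sum>j<k. nat (- D i j))" using j(1) by (intro member_le_sum) auto
  finally show ?thesis .
qed

lemma neg_mass_eq: "neg_mass k D = (\<Sum>i\<in>neg_rows k D. \<Sum>j<k. nat (- D i j))"
  unfolding neg_mass_def by (rule sum.mono_neutral_right) (auto simp: neg_rows_def not_less)

lemma card_neg_rows_le: "card (neg_rows k D) \<le> neg_mass k D"
  unfolding neg_mass_eq using sum_mono[of "neg_rows k D" "\<lambda>_. 1", OF neg_row_mass] by simp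

lemma neg_row_mass_eq_1:
  assumes "card (neg_rows k D) = neg_mass k D" "i \<in> neg_rows k D"
  shows "(\<Sum>j<k. nat (- D i j)) = 1"
proof (rule ccontr)
  assume "(\<Sum>j<k. nat (- D i j)) \<noteq> 1"
  then have "(\<Sum>j<k. nat (- D i j)) > 1" using neg_row_mass[OF assms(2)] by simp
  then have "(\<Sum>i\<in>neg_rows k D. 1) < (\<Sum>i\<in>neg_rows k D. \<Sum>j<k. nat (- D i j))"
    using assms(2) neg_row_mass by (intro sum_strict_mono_ex1) auto
  then show False using assms(1) by (simp add: neg_mass_eq)
qed

text \<open>
  A row without negative entries has non-negative entries with sum 0.
\<close>

lemma card_row_types_zero_sums:
  assumes D: "line_sums k 0 D" and less: "card (neg_rows k D) < k"
  shows "card (row_types k D) \<le> card (neg_rows k D) + 1"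
    and "\<And>i. i < k \<Longrightarrow> i \<notin> neg_rows k D \<Longrightarrow> j < k \<Longrightarrow> D i j = 0"
proof -
  show zero: "D i j = 0" if "i < k" "i \<notin> neg_rows k D" "j < k" for i j
  proof -
    have "D i j \<ge> 0" if "j \<in> {..<k}" for j using not_neg_row[OF \<open>i < k\<close> \<open>i \<notin> neg_rows k D\<close>] that by simp
    moreover have "(\<Sum>j<k. D i j) = 0" using D that by (simp add: line_sums_def)
    ultimately show ?thesis using sum_nonneg_eq_0_iff[of "{..<k}" "D i"] that by simp
  qed
  have "row_types k D \<subseteq> insert (restrict (\<lambda>_. 0) {..<k}) ((\<lambda>i. restrict (D i) {..<k}) ` neg_rows k D)"
    unfolding row_types_def
  proof (rule image_subsetI)
    fix i assume "i \<in> {..<k}"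
    then show "restrict (D i) {..<k} \<in> insert (restrict (\<lambda>_. 0) {..<k}) ((\<lambda>i. restrict (D i) {..<k}) ` neg_rows k D)"
      using zero[of i] by (cases "i \<in> neg_rows k D") (auto intro!: restrict_ext)
  qed
  then have "card (row_types k D) \<le> card (insert (restrict (\<lambda>_. 0) {..<k}) ((\<lambda>i. restrict (D i) {..<k}) ` neg_rows k D))"
    by (intro card_mono) auto
  also have "\<dots> \<le> Suc (card ((\<lambda>i. restrict (D i) {..<k}) ` neg_rows k D))"
    by (rule card_insert_le_m1) auto
  also have "\<dots> \<le> Suc (card (neg_rows k D))"
    using card_image_le[of "neg_rows k D"] by simp
  finally show "card (row_types k D) \<le> card (neg_rows k D) + 1" by simp
qed

lemma two_powers_le:
  assumes "a \<le> (b::nat) + c" "2 ^ b * 2 ^ c \<le> (N::nat)"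
  shows "2 ^ a \<le> N"
proof -
  have "2 ^ a \<le> (2::nat) ^ (b + c)" using assms(1) by (intro power_increasing) auto
  then show ?thesis using assms(2) by (simp add: power_add)
qed

text \<open>
  There are at least \<open>k - x\<close> zero rows and as many zero columns, where \<open>x\<close> is the negative mass.
  Permuting them gives at least \<open>2 ^ (2 * (k - x - 1))\<close> symmetries, which is enough unless
  \<open>x = k - 1\<close> and there is exactly one zero row and one zero column.  In that case every other line
  has negative mass 1, and \<open>rotation_of_signed_cycles\<close> applies.
\<close>

lemma card_mat_aut_zero_sums:
  fixes D :: "nat \<Rightarrow> nat \<Rightarrow> int"
  assumes k: "k \<ge> 2" and D: "line_sums k 0 D"
  shows "2 ^ (k - neg_mass k D) \<le> card (mat_aut k D)"
proof (cases "neg_mass k D < k")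
  case False
  then show ?thesis using card_mat_aut_pos by simp
next
  case less: True
  let ?T = "\<lambda>i j. D j i"
  let ?R = "neg_rows k D" and ?C = "neg_rows k ?T"
  have DT: "line_sums k 0 ?T" using D by (rule line_sums_transpose)
  have le: "card ?R \<le> neg_mass k D" "card ?C \<le> neg_mass k D"
    using card_neg_rows_le[of k D] card_neg_rows_le[of k ?T] neg_mass_transpose[of k D] by simp_all
  have types: "card (row_types k D) \<le> card ?R + 1" "card (row_types k ?T) \<le> card ?C + 1"
    using card_row_types_zero_sums(1)[OF D] card_row_types_zero_sums(1)[OF DT] le less by auto
  note bound = card_mat_aut_ge_types[of k D]
  define x where "x = neg_mass k D"
  show ?thesis
  proof (cases "x = k - 1 \<and> card ?R = x \<and> card ?C = x")
    case False
    have "k - x \<le> (k - card (row_types k D)) + (k - card (row_types k ?T))"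
      using False types le less unfolding x_def[symmetric] by auto
    from two_powers_le[OF this bound] show ?thesis by (simp add: x_def)
  next
    case True
    have massR: "(\<Sum>j<k. nat (- D i j)) = 1" if "i \<in> ?R" for i
      using neg_row_mass_eq_1[OF _ that] True by (simp add: x_def)
    have massC: "(\<Sum>i<k. nat (- D i j)) = 1" if "j \<in> ?C" for j
      using neg_row_mass_eq_1[OF _ that] True neg_mass_transpose[of k D] by (simp add: x_def)
    have zeroR: "D i j = 0" if "i < k" "i \<notin> ?R" "j < k" for i j
      using card_row_types_zero_sums(2)[OF D _ that] le less by simp
    have zeroC: "D i j = 0" if "j < k" "j \<notin> ?C" "i < k" for i j
      using card_row_types_zero_sums(2)[OF DT _ that] le less by simp
    have sub: "?R \<subseteq> {..<k}" "?C \<subseteq> {..<k}" by (auto simp: neg_rows_def)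
    have restC: "(\<Sum>j\<in>?C. f (D i j)) = (\<Sum>j<k. f (D i j))" if "i < k" "f 0 = 0" for i and f :: "int \<Rightarrow> 'b::comm_monoid_add"
      using sub zeroC[of _ i] that by (intro sum.mono_neutral_left) auto
    have restR: "(\<Sum>i\<in>?R. f (D i j)) = (\<Sum>i<k. f (D i j))" if "j < k" "f 0 = 0" for j and f :: "int \<Rightarrow> 'b::comm_monoid_add"
      using sub zeroR[of _ j] that by (intro sum.mono_neutral_left) auto
    have "card ?R \<noteq> 0" using True k by simp
    then have neR: "?R \<noteq> {}" by auto
    have r: "(\<Sum>j\<in>?C. D i j) = 0" "(\<Sum>j\<in>?C. nat (- D i j)) = 1" if "i \<in> ?R" for i
    proof -
      have i: "i < k" using sub that by blast
      show "(\<Sum>j\<in>?C. D i j) = 0" using restC[OF i, of "\<lambda>x. x"] D i by (simp add: line_sums_def)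
      show "(\<Sum>j\<in>?C. nat (- D i j)) = 1" using restC[OF i, of "\<lambda>x. nat (- x)"] massR[OF that] by simp
    qed
    have c: "(\<Sum>i\<in>?R. D i j) = 0" "(\<Sum>i\<in>?R. nat (- D i j)) = 1" if "j \<in> ?C" for j
    proof -
      have j: "j < k" using sub that by blast
      show "(\<Sum>i\<in>?R. D i j) = 0" using restR[OF j, of "\<lambda>x. x"] D j by (simp add: line_sums_def)
      show "(\<Sum>i\<in>?R. nat (- D i j)) = 1" using restR[OF j, of "\<lambda>x. nat (- x)"] massC[OF that] by simp
    qed
    obtain \<sigma> \<tau> where st: "\<sigma> permutes ?R" "\<tau> permutes ?C" "\<sigma> \<noteq> id"
      "\<And>i j. i \<in> ?R \<Longrightarrow> j \<in> ?C \<Longrightarrow> D (\<sigma> i) (\<tau> j) = D i j"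
      using rotation_of_signed_cycles[OF _ _ neR r c] by (metis neg_rows_finite)
    have stk: "\<sigma> permutes {..<k}" "\<tau> permutes {..<k}"
      using permutes_subset[OF st(1) sub(1)] permutes_subset[OF st(2) sub(2)] .
    have lt: "\<sigma> i < k" "\<tau> i < k" if "i < k" for i
      using stk that permutes_in_image[of \<sigma> "{..<k}" i] permutes_in_image[of \<tau> "{..<k}" i] by auto
    have "D (\<sigma> i) (\<tau> j) = D i j" if ij: "i < k" "j < k" for i j
    proof (cases "i \<in> ?R \<and> j \<in> ?C")
      case False
      then have "\<sigma> i \<notin> ?R \<or> \<tau> j \<notin> ?C"
        by (simp add: permutes_in_image[OF st(1)] permutes_in_image[OF st(2)])
      then have "D (\<sigma> i) (\<tau> j) = 0" using zeroR zeroC lt ij by blast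
      moreover have "D i j = 0" using False zeroR zeroC ij by blast
      ultimately show ?thesis by simp
    qed (use st(4) in blast)
    then have "(\<sigma>, \<tau>) \<in> mat_aut k D" using stk by (simp add: mat_aut_def)
    then have "2 \<le> card (mat_aut k D)" using st(3) by (rule card_mat_aut_ge_2)
    moreover have "k - neg_mass k D = 1" using True k by (simp add: x_def)
    ultimately show ?thesis by simp
  qed
qed

subsection \<open>Line sums one\<close>

text \<open>
  If all lines sum to 1, a row without negative entries is a unit vector: a leaf of the graph of
  non-zero entries, attached to the column \<open>attach k D i\<close>.  A pair row is a leaf attached to a leaf.
\<close>

definition leaf_rows :: "nat \<Rightarrow> (nat \<Rightarrow> nat \<Rightarrow> int) \<Rightarrow> nat set" where
  "leaf_rows k D = {..<k} - neg_rows k D"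

definition attach :: "nat \<Rightarrow> (nat \<Rightarrow> nat \<Rightarrow> int) \<Rightarrow> nat \<Rightarrow> nat" where
  "attach k D i = (THE j. j < k \<and> D i j = 1)"

lemma leaf_row:
  assumes D: "line_sums k 1 D" and i: "i \<in> leaf_rows k D"
  shows "attach k D i < k" "j < k \<Longrightarrow> D i j = (if j = attach k D i then 1 else 0)"
proof -
  have nn: "D i j \<ge> 0" if "j < k" for j
    using i that by (intro not_neg_row) (auto simp: leaf_rows_def)
  have "(\<Sum>j<k. D i j) = 1" using D i by (auto simp: line_sums_def leaf_rows_def)
  moreover have "int (\<Sum>j<k. nat (D i j)) = (\<Sum>j<k. D i j)"
    unfolding of_nat_sum using nn by (intro sum.cong) auto
  ultimately have "(\<Sum>j<k. nat (D i j)) = 1" by linarith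
  from sum_nat_eq_1[OF finite_lessThan this] obtain x where x: "x \<in> {..<k}" "nat (D i x) = 1"
    "\<And>y. y \<in> {..<k} \<Longrightarrow> y \<noteq> x \<Longrightarrow> nat (D i y) = 0" by blast
  have val: "D i y = (if y = x then 1 else 0)" if "y < k" for y
    using x(2) x(3)[of y] nn[OF that] that by (cases "y = x") auto
  have "attach k D i = x" unfolding attach_def using x(1) val by (intro the_equality) (auto split: if_splits)
  then show "attach k D i < k" "j < k \<Longrightarrow> D i j = (if j = attach k D i then 1 else 0)" using x(1) val by auto
qed

lemma finite_leaf_rows [simp]: "finite (leaf_rows k D)"
  by (simp add: leaf_rows_def)

definition pair_rows :: "nat \<Rightarrow> (nat \<Rightarrow> nat \<Rightarrow> int) \<Rightarrow> nat set" where
  "pair_rows k D = {i \<in> leaf_rows k D. attach k D i \<in> leaf_rows k (\<lambda>i j. D j i)}"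

lemma pair_rows_attach:
  assumes D: "line_sums k 1 D" and i: "i \<in> pair_rows k D"
  shows "attach k D i \<in> pair_rows k (\<lambda>i j. D j i)" "attach k (\<lambda>i j. D j i) (attach k D i) = i"
proof -
  let ?T = "\<lambda>i j. D j i"
  have DT: "line_sums k 1 ?T" using D by (rule line_sums_transpose)
  have i': "i \<in> leaf_rows k D" "attach k D i \<in> leaf_rows k ?T" "i < k"
    using i by (auto simp: pair_rows_def leaf_rows_def)
  have "D i (attach k D i) = 1" using leaf_row[OF D i'(1)] by simp
  then show eq: "attach k ?T (attach k D i) = i"
    using leaf_row(2)[OF DT i'(2) i'(3)] by (auto split: if_splits)
  then show "attach k D i \<in> pair_rows k ?T" using i' by (simp add: pair_rows_def)
qed

lemma card_pair_rows_transpose: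
  assumes D: "line_sums k 1 D"
  shows "card (pair_rows k (\<lambda>i j. D j i)) = card (pair_rows k D)"
proof -
  have le: "card (pair_rows k D) \<le> card (pair_rows k (\<lambda>i j. D j i))" if "line_sums k 1 D" for D
  proof (rule card_inj_on_le[of "attach k D"])
    show "inj_on (attach k D) (pair_rows k D)"
      using pair_rows_attach(2)[OF that] by (rule inj_on_inverseI)
    show "attach k D ` pair_rows k D \<subseteq> pair_rows k (\<lambda>i j. D j i)"
      using pair_rows_attach(1)[OF that] by blast
  qed (simp add: pair_rows_def)
  show ?thesis using le[OF D] le[OF line_sums_transpose[OF D]] by simp
qed

lemma pair_rows_isolated:
  assumes D: "line_sums k 1 D" and i: "i \<in> pair_rows k D"
  shows "isolated_entry k D 1 i (attach k D i)"
proof -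
  have DT: "line_sums k 1 (\<lambda>i j. D j i)" using D by (rule line_sums_transpose)
  have i': "i \<in> leaf_rows k D" "attach k D i \<in> leaf_rows k (\<lambda>i j. D j i)" "i < k"
    using i by (auto simp: pair_rows_def leaf_rows_def)
  show ?thesis
    unfolding isolated_entry_def
    using leaf_row[OF D i'(1)] leaf_row[OF DT i'(2)] pair_rows_attach(2)[OF D i] i'(3) by auto
qed

lemma attach_cover:
  assumes D: "line_sums k 1 D"
  shows "attach k D ` leaf_rows k D \<subseteq> neg_rows k (\<lambda>i j. D j i) \<union> attach k D ` pair_rows k D"
  using leaf_row(1)[OF D] by (auto simp: pair_rows_def leaf_rows_def)

text \<open>
  Leaves attached to the same column are equal rows.
\<close>

lemma card_row_types_unit_sums:
  assumes D: "line_sums k 1 D"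
  shows "card (row_types k D) \<le>
    card (neg_rows k D) + card (attach k D ` leaf_rows k D)"
proof -
  let ?r = "\<lambda>i. restrict (D i) {..<k}" and ?e = "\<lambda>m. restrict (\<lambda>j. if j = m then 1 else 0 :: int) {..<k}"
  have "row_types k D \<subseteq> ?r ` neg_rows k D \<union> ?e ` attach k D ` leaf_rows k D"
    unfolding row_types_def
  proof (rule image_subsetI)
    fix i assume "i \<in> {..<k}"
    show "?r i \<in> ?r ` neg_rows k D \<union> ?e ` attach k D ` leaf_rows k D"
    proof (cases "i \<in> neg_rows k D")
      case False
      then have i: "i \<in> leaf_rows k D" using \<open>i \<in> {..<k}\<close> by (simp add: leaf_rows_def)
      have "?r i = ?e (attach k D i)" using leaf_row(2)[OF D i] by (intro restrict_ext) simp
      then show ?thesis using i by blast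
    qed blast
  qed
  then have "card (row_types k D) \<le> card (?r ` neg_rows k D \<union> ?e ` attach k D ` leaf_rows k D)"
    by (intro card_mono) auto
  also have "\<dots> \<le> card (?r ` neg_rows k D) + card (?e ` attach k D ` leaf_rows k D)"
    by (rule card_Un_le)
  also have "\<dots> \<le> card (neg_rows k D) + card (attach k D ` leaf_rows k D)"
    by (intro add_mono card_image_le) auto
  finally show ?thesis .
qed

lemma card_attach_le:
  assumes D: "line_sums k 1 D"
  shows "card (attach k D ` leaf_rows k D) \<le> card (neg_rows k (\<lambda>i j. D j i)) + card (pair_rows k D)"
proof -
  have fin: "finite (pair_rows k D)" by (simp add: pair_rows_def)
  have "card (attach k D ` leaf_rows k D) \<le> card (neg_rows k (\<lambda>i j. D j i) \<union> attach k D ` pair_rows k D)"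
    using fin by (intro card_mono[OF _ attach_cover[OF D]]) auto
  also have "\<dots> \<le> card (neg_rows k (\<lambda>i j. D j i)) + card (attach k D ` pair_rows k D)"
    by (rule card_Un_le)
  also have "\<dots> \<le> card (neg_rows k (\<lambda>i j. D j i)) + card (pair_rows k D)"
    using card_image_le[OF fin] by simp
  finally show ?thesis .
qed

text \<open>
  Here \<open>a\<close> is the number of pairs and \<open>u = k - 2 * x\<close>.  If \<open>a\<close> is small, then many leaves share a column
  and the second bound suffices; if \<open>a\<close> is large, permuting the pairs suffices.
\<close>

lemma unit_sums_arith:
  fixes N s u a :: nat
  assumes "fact a \<le> N" "2 ^ (2 * (u - a)) \<le> N" "s \<ge> 1" "2 * s - 1 \<le> u" "\<not> (s = 1 \<and> u = 1 \<and> a = 1)"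
  shows "2 ^ s \<le> N"
proof (cases "s \<le> 2 * (u - a)")
  case True
  then have "2 ^ s \<le> (2::nat) ^ (2 * (u - a))" by (intro power_increasing) auto
  also note assms(2)
  finally show ?thesis .
next
  case False
  have "a \<ge> s + 1"
  proof (cases "s = 1")
    case True
    then show ?thesis using False assms(4,5) by auto
  next
    case False
    then show ?thesis using \<open>\<not> s \<le> 2 * (u - a)\<close> assms(3,4) by linarith
  qed
  then have "2 ^ s \<le> (2::nat) ^ (a - 1)" by (intro power_increasing) auto
  also note two_power_le_fact[of a]
  also note assms(1)
  finally show ?thesis .
qed

text \<open>
  In the borderline case each row with a negative entry has exactly one leaf column attached to it.
  The leaf takes the whole row sum, so that the rest of the row sums to 0.
\<close>

lemma unit_sums_off_leaves:
  fixes D :: "nat \<Rightarrow> nat \<Rightarrow> int"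
  defines "T \<equiv> \<lambda>i j. D j i"
  assumes D: "line_sums k 1 D"
    and inj: "inj_on (attach k T) (leaf_rows k T)"
    and cov: "neg_rows k D \<subseteq> attach k T ` leaf_rows k T"
    and tight: "card (neg_rows k D) = neg_mass k D"
    and i: "i \<in> neg_rows k D"
  shows "(\<Sum>j\<in>neg_rows k T. D i j) = 0" "(\<Sum>j\<in>neg_rows k T. nat (- D i j)) = 1"
proof -
  have T: "line_sums k 1 T" unfolding T_def using D by (rule line_sums_transpose)
  have ik: "i < k" using i by (simp add: neg_rows_def)
  have split: "{..<k} = neg_rows k T \<union> leaf_rows k T" "neg_rows k T \<inter> leaf_rows k T = {}"
    by (auto simp: leaf_rows_def neg_rows_def)
  have leaf: "D i j = (if i = attach k T j then 1 else 0)" if "j \<in> leaf_rows k T" for j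
    using leaf_row(2)[OF T that ik] by (simp add: T_def)
  obtain j0 where j0: "j0 \<in> leaf_rows k T" "attach k T j0 = i" using cov i by blast
  have "(\<Sum>j\<in>leaf_rows k T. D i j) = (\<Sum>j\<in>leaf_rows k T. if j = j0 then 1 else 0)"
    using leaf j0 inj by (intro sum.cong) (auto dest: inj_onD)
  also have "\<dots> = 1" using j0(1) by simp
  finally have leafsum: "(\<Sum>j\<in>leaf_rows k T. D i j) = 1" .
  have "(\<Sum>j<k. D i j) = (\<Sum>j\<in>neg_rows k T. D i j) + (\<Sum>j\<in>leaf_rows k T. D i j)"
    unfolding split(1) by (rule sum.union_disjoint) (use split(2) in auto)
  moreover have "(\<Sum>j<k. D i j) = 1" using D ik by (simp add: line_sums_def)
  ultimately show "(\<Sum>j\<in>neg_rows k T. D i j) = 0" using leafsum by simp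
  have "(\<Sum>j<k. nat (- D i j)) = (\<Sum>j\<in>neg_rows k T. nat (- D i j)) + (\<Sum>j\<in>leaf_rows k T. nat (- D i j))"
    unfolding split(1) by (rule sum.union_disjoint) (use split(2) in auto)
  moreover have "(\<Sum>j\<in>leaf_rows k T. nat (- D i j)) = 0" using leaf by (intro sum.neutral) simp
  ultimately show "(\<Sum>j\<in>neg_rows k T. nat (- D i j)) = 1"
    using neg_row_mass_eq_1[OF tight i] by simp
qed

text \<open>
  A symmetry of the part without leaves carries the leaves along.
\<close>

lemma extend_to_leaves:
  fixes D :: "nat \<Rightarrow> nat \<Rightarrow> int"
  assumes inj: "inj_on (attach k D) (leaf_rows k D)"
    and cov: "neg_rows k (\<lambda>i j. D j i) \<subseteq> attach k D ` leaf_rows k D"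
    and \<tau>0: "\<tau>0 permutes neg_rows k (\<lambda>i j. D j i)"
  obtains \<sigma>1 where "\<sigma>1 permutes {i \<in> leaf_rows k D. attach k D i \<in> neg_rows k (\<lambda>i j. D j i)}"
    "\<And>i. i \<in> {i \<in> leaf_rows k D. attach k D i \<in> neg_rows k (\<lambda>i j. D j i)} \<Longrightarrow>
       attach k D (\<sigma>1 i) = \<tau>0 (attach k D i)"
proof -
  let ?C = "neg_rows k (\<lambda>i j. D j i)"
  let ?L = "{i \<in> leaf_rows k D. attach k D i \<in> ?C}"
  have "bij_betw (attach k D) ?L ?C"
    using cov inj by (auto simp: bij_betw_def inj_on_def)
  from ex_permutation_conjugate[OF _ this permutes_inj_on[OF \<tau>0]] show thesis
    using that permutes_image[OF \<tau>0] by auto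
qed

text \<open>
  The borderline case: away from the leaves the matrix is a union of cycles with alternating signs.
  Their rotation extends to the leaves, and it fixes the pairs.
\<close>

lemma mat_aut_nontrivial_unit_sums:
  fixes D :: "nat \<Rightarrow> nat \<Rightarrow> int"
  defines "T \<equiv> \<lambda>i j. D j i"
  assumes D: "line_sums k 1 D"
    and inj: "inj_on (attach k D) (leaf_rows k D)" "inj_on (attach k T) (leaf_rows k T)"
    and cov: "neg_rows k T \<subseteq> attach k D ` leaf_rows k D" "neg_rows k D \<subseteq> attach k T ` leaf_rows k T"
    and tight: "card (neg_rows k D) = neg_mass k D" "card (neg_rows k T) = neg_mass k T"
    and pos: "neg_mass k D > 0"
  shows "2 \<le> card (mat_aut k D)"
proof -
  let ?R = "neg_rows k D" and ?C = "neg_rows k T" and ?L = "leaf_rows k D" and ?L' = "leaf_rows k T"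
  have TT: "(\<lambda>i j. T j i) = D" by (simp add: T_def)
  have T: "line_sums k 1 T" unfolding T_def using D by (rule line_sums_transpose)
  have neR: "?R \<noteq> {}" using tight(1) pos by force
  note row = unit_sums_off_leaves[OF D inj(2)[unfolded T_def] cov(2)[unfolded T_def] tight(1), folded T_def]
  have col: "(\<Sum>i\<in>?R. D i j) = 0" "(\<Sum>i\<in>?R. nat (- D i j)) = 1" if "j \<in> ?C" for j
    using unit_sums_off_leaves[OF T, unfolded TT, OF inj(1) cov(1) tight(2) that] by (simp_all add: T_def)
  obtain \<sigma>0 \<tau>0 where st: "\<sigma>0 permutes ?R" "\<tau>0 permutes ?C" "\<sigma>0 \<noteq> id"
    and Dst: "\<And>i j. i \<in> ?R \<Longrightarrow> j \<in> ?C \<Longrightarrow> D (\<sigma>0 i) (\<tau>0 j) = D i j"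
    using rotation_of_signed_cycles[OF _ _ neR row col] by (metis neg_rows_finite)
  let ?L1 = "{i \<in> ?L. attach k D i \<in> ?C}" and ?L1' = "{j \<in> ?L'. attach k T j \<in> ?R}"
  obtain \<sigma>1 where \<sigma>1: "\<sigma>1 permutes ?L1" "\<And>i. i \<in> ?L1 \<Longrightarrow> attach k D (\<sigma>1 i) = \<tau>0 (attach k D i)"
    using extend_to_leaves[OF inj(1) cov(1)[unfolded T_def] st(2)[unfolded T_def]]
    unfolding T_def[symmetric] by blast
  obtain \<tau>1 where \<tau>1: "\<tau>1 permutes ?L1'" "\<And>j. j \<in> ?L1' \<Longrightarrow> attach k T (\<tau>1 j) = \<sigma>0 (attach k T j)"
    using extend_to_leaves[OF inj(2), unfolded TT, OF cov(2) st(1)] by blast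
  define \<sigma> where "\<sigma> = \<sigma>0 \<circ> \<sigma>1"
  define \<tau> where "\<tau> = \<tau>0 \<circ> \<tau>1"
  have Lk: "i \<in> ?L \<longleftrightarrow> i < k \<and> i \<notin> ?R" "i \<in> ?L' \<longleftrightarrow> i < k \<and> i \<notin> ?C" for i by (auto simp: leaf_rows_def)
  have Rk: "i \<in> ?R \<Longrightarrow> i < k" "i \<in> ?C \<Longrightarrow> i < k" for i by (auto simp: neg_rows_def)
  have sub: "?R \<subseteq> {..<k}" "?C \<subseteq> {..<k}" "?L1 \<subseteq> {..<k}" "?L1' \<subseteq> {..<k}" using Lk Rk by auto
  have perm: "\<sigma> permutes {..<k}" "\<tau> permutes {..<k}"
    unfolding \<sigma>_def \<tau>_def
    using permutes_compose[OF permutes_subset[OF \<sigma>1(1) sub(3)] permutes_subset[OF st(1) sub(1)]]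
      permutes_compose[OF permutes_subset[OF \<tau>1(1) sub(4)] permutes_subset[OF st(2) sub(2)]] .
  have inj\<sigma>: "\<sigma> i = \<sigma> i' \<longleftrightarrow> i = i'" and inj\<tau>: "\<tau> i = \<tau> i' \<longleftrightarrow> i = i'" for i i'
    using perm[THEN permutes_inj] by (auto simp: inj_eq)
  have \<sigma>R: "\<sigma> i = \<sigma>0 i" "\<sigma> i \<in> ?R" if "i \<in> ?R" for i
    using permutes_not_in[OF \<sigma>1(1), of i] permutes_in_image[OF st(1), of i] that Lk by (auto simp: \<sigma>_def)
  have \<tau>C: "\<tau> i = \<tau>0 i" "\<tau> i \<in> ?C" if "i \<in> ?C" for i
    using permutes_not_in[OF \<tau>1(1), of i] permutes_in_image[OF st(2), of i] that Lk by (auto simp: \<tau>_def)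
  have \<sigma>L1: "\<sigma> i = \<sigma>1 i" "\<sigma> i \<in> ?L1" if "i \<in> ?L1" for i
  proof -
    have "\<sigma>1 i \<in> ?L1" using permutes_in_image[OF \<sigma>1(1)] that by blast
    then show "\<sigma> i = \<sigma>1 i" "\<sigma> i \<in> ?L1"
      using permutes_not_in[OF st(1), of "\<sigma>1 i"] Lk by (auto simp: \<sigma>_def)
  qed
  have \<tau>L1: "\<tau> i = \<tau>1 i" "\<tau> i \<in> ?L1'" if "i \<in> ?L1'" for i
  proof -
    have "\<tau>1 i \<in> ?L1'" using permutes_in_image[OF \<tau>1(1)] that by blast
    then show "\<tau> i = \<tau>1 i" "\<tau> i \<in> ?L1'"
      using permutes_not_in[OF st(2), of "\<tau>1 i"] Lk by (auto simp: \<tau>_def)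
  qed
  have \<sigma>fix: "\<sigma> i = i" if "i \<in> ?L" "attach k D i \<notin> ?C" for i
    using permutes_not_in[OF \<sigma>1(1), of i] permutes_not_in[OF st(1), of i] that Lk by (auto simp: \<sigma>_def)
  have \<tau>fix: "\<tau> i = i" if "i \<in> ?L'" "attach k T i \<notin> ?R" for i
    using permutes_not_in[OF \<tau>1(1), of i] permutes_not_in[OF st(2), of i] that Lk by (auto simp: \<tau>_def)
  have att: "\<sigma> i \<in> ?L \<and> attach k D (\<sigma> i) = \<tau> (attach k D i)" if i: "i \<in> ?L" for i
  proof (cases "attach k D i \<in> ?C")
    case True
    then have "i \<in> ?L1" using i by simp
    then show ?thesis using \<sigma>L1 \<sigma>1(2) \<tau>C(1)[OF True] by auto
  next
    case False
    then have p: "i \<in> pair_rows k D" using i leaf_row(1)[OF D i] Lk by (simp add: pair_rows_def flip: T_def)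
    have "attach k D i \<in> ?L'" "attach k T (attach k D i) = i"
      using pair_rows_attach[OF D p] by (simp_all add: pair_rows_def T_def)
    then have "\<tau> (attach k D i) = attach k D i" using \<tau>fix i Lk by simp
    then show ?thesis using \<sigma>fix[OF i False] i by simp
  qed
  have att': "\<tau> j \<in> ?L' \<and> attach k T (\<tau> j) = \<sigma> (attach k T j)" if j: "j \<in> ?L'" for j
  proof (cases "attach k T j \<in> ?R")
    case True
    then have "j \<in> ?L1'" using j by simp
    then show ?thesis using \<tau>L1 \<tau>1(2) \<sigma>R(1)[OF True] by auto
  next
    case False
    then have p: "j \<in> pair_rows k T" using j leaf_row(1)[OF T j] Lk by (simp add: pair_rows_def TT)
    have "attach k T j \<in> ?L" "attach k D (attach k T j) = j"
      using pair_rows_attach[OF T p] by (simp_all add: pair_rows_def TT)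
    then have "\<sigma> (attach k T j) = attach k T j" using \<sigma>fix j Lk by simp
    then show ?thesis using \<tau>fix[OF j False] j by simp
  qed
  have lt: "\<sigma> i < k" "\<tau> i < k" if "i < k" for i
    using perm that permutes_in_image[of \<sigma> "{..<k}" i] permutes_in_image[of \<tau> "{..<k}" i] by auto
  have "D (\<sigma> i) (\<tau> j) = D i j" if ij: "i < k" "j < k" for i j
  proof -
    consider "i \<in> ?L" | "j \<in> ?L'" | "i \<in> ?R" "j \<in> ?C" using Lk ij by blast
    then show ?thesis
    proof cases
      case 1
      then show ?thesis
        using leaf_row(2)[OF D 1 ij(2)] leaf_row(2)[OF D, of "\<sigma> i" "\<tau> j"] att[OF 1] lt(2)[OF ij(2)] inj\<tau>
        by simp
    next
      case 2
      then show ?thesis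
        using leaf_row(2)[OF T 2 ij(1)] leaf_row(2)[OF T, of "\<tau> j" "\<sigma> i"] att'[OF 2] lt(1)[OF ij(1)] inj\<sigma>
        by (simp add: T_def)
    next
      case 3
      then show ?thesis using Dst \<sigma>R(1) \<tau>C(1) by simp
    qed
  qed
  then have "(\<sigma>, \<tau>) \<in> mat_aut k D" using perm by (simp add: mat_aut_def)
  moreover have "\<sigma> \<noteq> id"
  proof
    assume "\<sigma> = id"
    then have "\<sigma>0 i = i" for i using \<sigma>R(1)[of i] permutes_not_in[OF st(1), of i] by (cases "i \<in> ?R") auto
    then show False using st(3) by auto
  qed
  ultimately show ?thesis by (rule card_mat_aut_ge_2)
qed

text \<open>
  Let \<open>x\<close> be the negative mass and \<open>a\<close> the number of pairs.  At most \<open>x\<close> rows and \<open>x\<close> columns have a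
  negative entry, so there are at most \<open>2 * x + a\<close> different rows, and the same holds for columns.
  Equal lines and pairs give the two bounds of \<open>unit_sums_arith\<close>.  The case left open there has
  \<open>k = 2 * x + 1\<close> and one pair; unless two lines coincide, all estimates are then equalities.
\<close>

lemma card_mat_aut_unit_sums:
  fixes D :: "nat \<Rightarrow> nat \<Rightarrow> int"
  assumes k: "k \<ge> 2" and D: "line_sums k 1 D"
  shows "2 ^ ((k + 1) div 2 - neg_mass k D) \<le> card (mat_aut k D)"
proof (cases "neg_mass k D < (k + 1) div 2")
  case False
  then show ?thesis using card_mat_aut_pos by simp
next
  case less: True
  define T where "T = (\<lambda>i j. D j i)"
  define x where "x = neg_mass k D"
  define a where "a = card (pair_rows k D)"
  let ?N = "card (mat_aut k D)"
  have T: "line_sums k 1 T" unfolding T_def using D by (rule line_sums_transpose)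
  have TT: "(\<lambda>i j. T j i) = D" by (simp add: T_def)
  have xT: "neg_mass k T = x" unfolding T_def x_def by (rule neg_mass_transpose)
  have aT: "card (pair_rows k T) = a" unfolding T_def a_def by (rule card_pair_rows_transpose[OF D])
  have R: "card (neg_rows k D) \<le> x" "card (neg_rows k T) \<le> x"
    using card_neg_rows_le[of k D] card_neg_rows_le[of k T] xT by (simp_all add: x_def)
  have att: "card (attach k D ` leaf_rows k D) \<le> card (neg_rows k T) + a"
    "card (attach k T ` leaf_rows k T) \<le> card (neg_rows k D) + a"
    using card_attach_le[OF D] card_attach_le[OF T] by (simp_all add: TT aT flip: T_def a_def)
  have types: "card (row_types k D) \<le> card (neg_rows k D) + card (attach k D ` leaf_rows k D)"
    "card (row_types k T) \<le> card (neg_rows k T) + card (attach k T ` leaf_rows k T)"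
    using card_row_types_unit_sums[OF D] card_row_types_unit_sums[OF T] .
  note bound = card_mat_aut_ge_types[of k D, folded T_def]
  have isol: "fact a \<le> ?N"
  proof -
    have "{i. \<exists>j. isolated_entry k D 1 i j} \<subseteq> {..<k}" by (auto simp: isolated_entry_def)
    then have "a \<le> card {i. \<exists>j. isolated_entry k D 1 i j}"
      unfolding a_def using pair_rows_isolated[OF D] by (intro card_mono finite_subset[OF _ finite_lessThan]) auto
    then have "fact a \<le> (fact (card {i. \<exists>j. isolated_entry k D 1 i j}) :: nat)" by (rule fact_mono)
    also have "\<dots> \<le> ?N" by (rule fact_isolated_entries_le) simp
    finally show ?thesis .
  qed
  have type_bound: "2 ^ (2 * (k - 2 * x - a)) \<le> ?N"
    using two_powers_le[OF _ bound, of "2 * (k - 2 * x - a)"] types att R by simp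
  define s where "s = (k + 1) div 2 - x"
  have s: "s \<ge> 1" "2 * s - 1 \<le> k - 2 * x" using less by (auto simp: s_def x_def)
  have "2 ^ s \<le> ?N"
  proof (cases "s = 1 \<and> k - 2 * x = 1 \<and> a = 1")
    case False
    with unit_sums_arith[OF isol type_bound s] show ?thesis by blast
  next
    case True
    then have "k - 2 * x = 1" by simp
    then have kx: "k = 2 * x + 1" by arith
    show ?thesis
    proof (cases "card (row_types k D) < k \<or> card (row_types k T) < k")
      case one: True
      have "2 ^ 1 \<le> ?N" by (rule two_powers_le[OF _ bound]) (use one in auto)
      then show ?thesis using True by simp
    next
      case False
      then have eq: "card (neg_rows k D) = x" "card (neg_rows k T) = x"
        "card (attach k D ` leaf_rows k D) = x + 1" "card (attach k T ` leaf_rows k T) = x + 1"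
        using types att R True kx by linarith+
      have subk: "neg_rows k D \<subseteq> {..<k}" "neg_rows k T \<subseteq> {..<k}" by (auto simp: neg_rows_def)
      have "card (leaf_rows k D) = x + 1" "card (leaf_rows k T) = x + 1"
        unfolding leaf_rows_def using eq(1,2) subk kx by (simp_all add: card_Diff_subset)
      then have inj: "inj_on (attach k D) (leaf_rows k D)" "inj_on (attach k T) (leaf_rows k T)"
        using eq(3,4) by (auto intro: eq_card_imp_inj_on)
      have cov: "neg_rows k (\<lambda>i j. D j i) \<subseteq> attach k D ` leaf_rows k D" if D: "line_sums k 1 D"
        "card (attach k D ` leaf_rows k D) = x + 1" "card (neg_rows k (\<lambda>i j. D j i)) = x"
        "card (pair_rows k D) = 1" for D
      proof -
        let ?U = "neg_rows k (\<lambda>i j. D j i) \<union> attach k D ` pair_rows k D"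
        have "card ?U \<le> x + 1"
          using card_Un_le[of "neg_rows k (\<lambda>i j. D j i)" "attach k D ` pair_rows k D"]
            card_image_le[of "pair_rows k D" "attach k D"] that by (simp add: pair_rows_def)
        moreover have "finite ?U" by (simp add: pair_rows_def)
        ultimately have "attach k D ` leaf_rows k D = ?U"
          using attach_cover[OF D(1)] that(2) by (metis card_seteq)
        then show ?thesis by simp
      qed
      have "2 \<le> ?N"
      proof (rule mat_aut_nontrivial_unit_sums[OF D])
        show "neg_rows k (\<lambda>i j. D j i) \<subseteq> attach k D ` leaf_rows k D"
          using cov[OF D] eq True by (simp add: a_def flip: T_def)
        show "neg_rows k D \<subseteq> attach k (\<lambda>i j. D j i) ` leaf_rows k (\<lambda>i j. D j i)"
          using cov[OF T] eq True aT by (simp add: TT flip: T_def)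
        show "neg_mass k D > 0" using kx k by (simp add: x_def)
      qed (use inj eq xT in \<open>simp_all add: x_def flip: T_def\<close>)
      then show ?thesis using True by simp
    qed
  qed
  then show ?thesis by (simp add: s_def x_def)
qed

subsection \<open>Line sums two\<close>

text \<open>
  Without negative entries \<open>D\<close> is the matrix of a two-regular graph, whose automorphism group has
  order at least \<open>2 * k\<close>.  If at most one entry is 2, then at most a factor 2 of this comes from
  parallel edges; two entries 2 are interchangeable.
\<close>

lemma card_mat_aut_two_sums:
  fixes D :: "nat \<Rightarrow> nat \<Rightarrow> int"
  assumes k: "k \<ge> 2" and D: "line_sums k 2 D"
  shows "2 ^ (1 - neg_mass k D) \<le> card (mat_aut k D)"
proof (cases "neg_mass k D = 0")
  case False
  then have "1 - neg_mass k D = 0" by simp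
  then show ?thesis using card_mat_aut_pos by simp
next
  case zero: True
  then have nn: "D i j \<ge> 0" if "i < k" "j < k" for i j
    using that by (auto simp: neg_mass_def)
  define M where "M i j = nat (D i j)" for i j
  have DM: "D i j = int (M i j)" if "i < k" "j < k" for i j using nn that by (simp add: M_def)
  have "int (\<Sum>j<k. M i j) = 2" "int (\<Sum>j<k. M j i) = 2" if "i < k" for i
    using D that DM unfolding line_sums_def of_nat_sum by (auto cong: sum.cong_simp)
  then have "(\<Sum>j<k. M i j) = 2" "(\<Sum>j<k. M j i) = 2" if "i < k" for i
    using that by (metis of_nat_eq_iff of_nat_numeral)+
  then have M: "line_sums k 2 M" by (simp add: line_sums_def)
  have row0: "M i j' = 0" if "i < k" "j < k" "M i j = 2" "j' < k" "j' \<noteq> j" for i j j'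
  proof -
    have "(\<Sum>j<k. M i j) = M i j + sum (M i) ({..<k} - {j})" using that by (intro sum.remove) auto
    then have "sum (M i) ({..<k} - {j}) = 0" using M that by (simp add: line_sums_def)
    then show ?thesis using that by simp
  qed
  have col0: "M i' j = 0" if "i < k" "j < k" "M i j = 2" "i' < k" "i' \<noteq> i" for i j i'
  proof -
    have "(\<Sum>i<k. M i j) = M i j + sum (\<lambda>i. M i j) ({..<k} - {i})" using that by (intro sum.remove) auto
    then have "sum (\<lambda>i. M i j) ({..<k} - {i}) = 0" using M that by (simp add: line_sums_def)
    then show ?thesis using that by simp
  qed
  have le2: "M i j \<le> 2" if "i < k" "j < k" for i j
    using member_le_sum[of j "{..<k}" "M i"] M that by (simp add: line_sums_def)
  define K where "K = {i. \<exists>j. isolated_entry k D 2 i j}"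
  have Kk: "K \<subseteq> {..<k}" by (auto simp: K_def isolated_entry_def)
  have iso: "isolated_entry k D 2 i j" if "i < k" "j < k" "M i j = 2" for i j
    using that row0[OF that] col0[OF that] DM by (simp add: isolated_entry_def)
  have fact_K: "fact (card K) \<le> card (mat_aut k D)" unfolding K_def by (rule fact_isolated_entries_le) simp
  have "2 \<le> card (mat_aut k D)"
  proof (cases "card K \<ge> 2")
    case True
    then have "fact 2 \<le> (fact (card K) :: nat)" by (rule fact_mono)
    then show ?thesis using fact_K by (simp add: numeral_2_eq_2)
  next
    case False
    have "(\<Prod>j<k. fact (M i j)) \<le> (if i \<in> K then 2 else 1 :: nat)" if i: "i < k" for i
    proof (cases "\<exists>j<k. M i j = 2")
      case True
      then obtain j where j: "j < k" "M i j = 2" by auto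
      then have "(\<Prod>j<k. fact (M i j)) = (fact (M i j) * (\<Prod>j\<in>{..<k} - {j}. fact (M i j)) :: nat)"
        by (intro prod.remove) auto
      also have "(\<Prod>j\<in>{..<k} - {j}. fact (M i j)) = (1 :: nat)"
        using row0[OF i j] by (intro prod.neutral) auto
      finally show ?thesis using iso[OF i j] j by (auto simp: K_def numeral_2_eq_2)
    next
      case False
      have le1: "M i j \<le> 1" if "j < k" for j
      proof -
        have "M i j \<noteq> 2" "M i j \<le> 2" using False le2[OF i that] that by auto
        then show ?thesis by simp
      qed
      then have "fact (M i j) = (1 :: nat)" if "j < k" for j
        using le1[OF that] by (auto simp: le_Suc_eq)
      then show ?thesis by simp
    qed
    then have "(\<Prod>i<k. \<Prod>j<k. fact (M i j)) \<le> (\<Prod>i<k. if i \<in> K then 2 else 1 :: nat)"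
      by (intro prod_mono) auto
    also have "\<dots> = 2 ^ card K"
      using Kk by (subst prod.inter_restrict[symmetric]) (auto simp: Int_absorb1)
    also have "\<dots> \<le> 2 ^ 1" using False by (intro power_increasing) auto
    finally have P: "(\<Prod>i<k. \<Prod>j<k. fact (M i j)) \<le> (2::nat)" by simp
    have "2 * k \<le> card (mat_aut k M) * (\<Prod>i<k. \<Prod>j<k. fact (M i j))"
      by (rule aut_orders_2_ge[OF aut_ordersI[OF M]]) simp
    also have "\<dots> \<le> card (mat_aut k M) * 2" using P by (rule mult_le_mono2)
    also have "mat_aut k M = mat_aut k D"
      by (rule mat_aut_cong) (simp add: DM)
    finally show ?thesis using k by simp
  qed
  then show ?thesis using zero by simp
qed

section \<open>Lower bounds for products of factorials\<close>

text \<open>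
  Starting from \<open>fact q\<close>, each step upwards multiplies by at least \<open>q + 1\<close>, and each step downwards
  divides by at most \<open>q\<close>.  The truncated differences make one of the two powers trivial.
\<close>

lemma fact_weight: "fact q * (q + 1) ^ (m - q) \<le> fact m * q ^ (q - m)"
proof (cases "q \<le> m")
  case True
  have "fact q * (q + 1) ^ d \<le> fact (q + d)" for d :: nat
  proof (induction d)
    case (Suc d)
    have "fact q * (q + 1) ^ Suc d = (q + 1) * (fact q * (q + 1) ^ d)" by (simp add: algebra_simps)
    also have "\<dots> \<le> (q + d + 1) * fact (q + d)" using Suc by (intro mult_le_mono) auto
    finally show ?case by simp
  qed simp
  from this[of "m - q"] show ?thesis using True by simp
next
  case False
  have "fact (m + d) \<le> fact m * (m + d) ^ d" for d :: nat
  proof (induction d)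
    case (Suc d)
    have "fact (m + Suc d) = (m + Suc d) * fact (m + d)" by simp
    also have "\<dots> \<le> (m + Suc d) * (fact m * (m + d) ^ d)" using Suc by (rule mult_le_mono2)
    also have "\<dots> \<le> (m + Suc d) * (fact m * (m + Suc d) ^ d)"
      by (intro mult_le_mono2 power_mono) auto
    finally show ?case by (simp add: algebra_simps)
  qed simp
  from this[of "q - m"] show ?thesis using False by simp
qed

lemma prod_fact_weight:
  fixes M :: "nat \<Rightarrow> nat \<Rightarrow> nat"
  shows "fact q ^ (k ^ 2) * (q + 1) ^ (\<Sum>i<k. \<Sum>j<k. M i j - q)
    \<le> (\<Prod>i<k. \<Prod>j<k. fact (M i j)) * q ^ (\<Sum>i<k. \<Sum>j<k. q - M i j)"
proof -
  have "(\<Prod>i<k. \<Prod>j<k. fact q * (q + 1) ^ (M i j - q)) \<le> (\<Prod>i<k. \<Prod>j<k. fact (M i j) * q ^ (q - M i j))"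
    by (intro prod_mono conjI prod_nonneg fact_weight) auto
  then show ?thesis
    by (simp add: prod.distrib power_sum power2_eq_square power_mult)
qed

text \<open>
  \<open>T\<close> is the product of factorials for negative mass \<open>h\<close>, \<open>X\<close> is the product for negative mass \<open>x\<close>, and
  \<open>A\<close> is the number of symmetries.  A missing unit of negative mass saves at most the factor
  \<open>(Q + 1) / Q \<le> 2\<close> and costs a factor 2.
\<close>

lemma weight_tradeoff:
  fixes A F Q T X a b h x :: nat
  assumes Q: "Q \<ge> 1"
    and X: "F * (Q + 1) ^ (a + x) \<le> X * Q ^ (b + x)"
    and T: "T * Q ^ (b + h) = F * (Q + 1) ^ (a + h)"
    and A: "2 ^ (h - x) \<le> A"
  shows "T \<le> A * X"
proof (cases "h \<le> x")
  case True
  have "T * Q ^ (b + x) = (T * Q ^ (b + h)) * Q ^ (x - h)"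
    using True by (simp flip: power_add)
  also have "\<dots> \<le> (F * (Q + 1) ^ (a + h)) * (Q + 1) ^ (x - h)"
    unfolding T by (intro mult_le_mono2 power_mono) auto
  also have "\<dots> = F * (Q + 1) ^ (a + x)" using True by (simp flip: power_add)
  also note X
  finally have "T \<le> X" using Q by simp
  also have "\<dots> \<le> A * X" using A True by simp
  finally show ?thesis .
next
  case False
  have "T * Q ^ (b + h) = (F * (Q + 1) ^ (a + x)) * (Q + 1) ^ (h - x)"
    unfolding T using False by (simp flip: power_add)
  also have "\<dots> \<le> (X * Q ^ (b + x)) * (2 * Q) ^ (h - x)"
    using Q by (intro mult_le_mono[OF X] power_mono) auto
  also have "\<dots> = 2 ^ (h - x) * X * Q ^ (b + h)"
    using False by (simp add: power_mult_distrib flip: power_add)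
  also have "\<dots> \<le> A * X * Q ^ (b + h)" using A by (intro mult_le_mono1)
  finally show ?thesis using Q by simp
qed

section \<open>Rigid matrices\<close>

text \<open>
  Once all rows are fixed, a column can only move to an equal column.
\<close>

lemma card_mat_aut_eq_1:
  assumes rows: "\<And>\<sigma> \<tau> i. (\<sigma>, \<tau>) \<in> mat_aut k D \<Longrightarrow> i < k \<Longrightarrow> \<sigma> i = i"
    and cols: "\<And>j j'. j < k \<Longrightarrow> j' < k \<Longrightarrow> (\<And>i. i < k \<Longrightarrow> D i j = D i j') \<Longrightarrow> j = j'"
  shows "card (mat_aut k D) = 1"
proof -
  have "(\<sigma>, \<tau>) = (id, id)" if st: "(\<sigma>, \<tau>) \<in> mat_aut k D" for \<sigma> \<tau>
  proof -
    have p: "\<sigma> permutes {..<k}" "\<tau> permutes {..<k}"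
      and D: "\<And>i j. i < k \<Longrightarrow> j < k \<Longrightarrow> D (\<sigma> i) (\<tau> j) = D i j" using st by (auto simp: mat_aut_def)
    have "\<tau> j = j" if j: "j < k" for j
    proof (rule cols)
      show "\<tau> j < k" using j p(2) permutes_in_image[of \<tau> "{..<k}" j] by simp
      show "D i (\<tau> j) = D i j" if "i < k" for i using D[OF that j] rows[OF st that] by simp
    qed fact
    then have "\<tau> = id" by (intro permutes_lessThan_eqI[OF p(2) permutes_id]) simp
    moreover have "\<sigma> = id" using rows[OF st] by (intro permutes_lessThan_eqI[OF p(1) permutes_id]) simp
    ultimately show ?thesis by simp
  qed
  then have "mat_aut k D = {(id, id)}" using id_in_mat_aut by fast
  then show ?thesis by simp
qed

lemma mat_autD:
  assumes "(\<sigma>, \<tau>) \<in> mat_aut k D"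
  shows "i < k \<Longrightarrow> \<sigma> i < k" "j < k \<Longrightarrow> \<tau> j < k" "\<sigma> i = \<sigma> i' \<longleftrightarrow> i = i'" "\<tau> j = \<tau> j' \<longleftrightarrow> j = j'"
    "i < k \<Longrightarrow> j < k \<Longrightarrow> D (\<sigma> i) (\<tau> j) = D i j" "j < k \<Longrightarrow> \<exists>c<k. \<tau> c = j"
proof -
  have p: "\<sigma> permutes {..<k}" "\<tau> permutes {..<k}" using assms by (auto simp: mat_aut_def)
  show "i < k \<Longrightarrow> \<sigma> i < k" "j < k \<Longrightarrow> \<tau> j < k"
    using p permutes_in_image[of \<sigma> "{..<k}" i] permutes_in_image[of \<tau> "{..<k}" j] by simp_all
  show "\<sigma> i = \<sigma> i' \<longleftrightarrow> i = i'" "\<tau> j = \<tau> j' \<longleftrightarrow> j = j'"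
    using p[THEN permutes_inj] by (simp_all add: inj_eq)
  show "i < k \<Longrightarrow> j < k \<Longrightarrow> D (\<sigma> i) (\<tau> j) = D i j" using assms by (simp add: mat_aut_def)
  show "j < k \<Longrightarrow> \<exists>c<k. \<tau> c = j" using permutes_image[OF p(2)] by (metis imageE lessThan_iff)
qed

subsection \<open>Two directed cycles through a common vertex\<close>

text \<open>
  A figure eight: the cycle \<open>0 \<rightarrow> 1 \<rightarrow> \<dots> \<rightarrow> n - 2 \<rightarrow> 0\<close> and the cycle \<open>0 \<rightarrow> n - 1 \<rightarrow> 0\<close>.
\<close>

definition fig8 :: "nat \<Rightarrow> nat \<Rightarrow> nat \<Rightarrow> bool" where
  "fig8 n i j \<longleftrightarrow> j = Suc i \<and> Suc i < n - 1 \<or> i = n - 2 \<and> j = 0 \<or> i = 0 \<and> j = n - 1 \<or> i = n - 1 \<and> j = 0"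

text \<open>
  Vertex 0 is the only one with two successors, and \<open>n - 1\<close> is the only one that both precedes and
  succeeds it, since the other cycle has length at least 3.  The rest follows along the long cycle.
\<close>

lemma fig8_rigid:
  assumes n: "n \<ge> 4" and inj: "inj_on f {..<n}" and f: "\<And>i. i < n \<Longrightarrow> f i < n"
    and hom: "\<And>i j. i < n \<Longrightarrow> j < n \<Longrightarrow> fig8 n i j \<Longrightarrow> fig8 n (f i) (f j)"
    and i: "i < n"
  shows "f i = i"
proof -
  have neq: "f i \<noteq> f j" if "i < n" "j < n" "i \<noteq> j" for i j
    using inj that by (auto dest: inj_onD)
  have uniq: "j = j'" if "fig8 n i j" "fig8 n i j'" "i \<noteq> 0" for i j j'
    using that n by (auto simp: fig8_def)
  have "fig8 n 0 1" "fig8 n 0 (n - 1)" using n by (auto simp: fig8_def)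
  then have "fig8 n (f 0) (f 1)" "fig8 n (f 0) (f (n - 1))" using n by (auto intro!: hom)
  moreover have "f 1 \<noteq> f (n - 1)" using n by (intro neq) auto
  ultimately have f0: "f 0 = 0" using uniq by blast
  have "fig8 n 0 (f (n - 1))" "fig8 n (f (n - 1)) 0"
    using hom[of 0 "n - 1"] hom[of "n - 1" 0] f0 n by (auto simp: fig8_def)
  then have last: "f (n - 1) = n - 1" using n by (auto simp: fig8_def)
  have "fig8 n 0 (f 1)" using hom[OF _ _ \<open>fig8 n 0 1\<close>] f0 n by simp
  moreover have "f 1 \<noteq> n - 1" using neq[of 1 "n - 1"] last n by simp
  ultimately have f1: "f 1 = 1" using n by (auto simp: fig8_def)
  have "Suc i < n - 1 \<longrightarrow> f (Suc i) = Suc i" for i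
  proof (induction i)
    case 0
    then show ?case using f1 by simp
  next
    case (Suc i)
    show ?case
    proof
      assume lt: "Suc (Suc i) < n - 1"
      then have "fig8 n (Suc i) (Suc (Suc i))" by (simp add: fig8_def)
      then have "fig8 n (f (Suc i)) (f (Suc (Suc i)))" using lt by (intro hom) auto
      then have "fig8 n (Suc i) (f (Suc (Suc i)))" using Suc lt by simp
      moreover have "fig8 n (Suc i) (Suc (Suc i))" using lt by (simp add: fig8_def)
      ultimately show "f (Suc (Suc i)) = Suc (Suc i)" using uniq by blast
    qed
  qed
  then have mid: "i < n - 1 \<Longrightarrow> f i = i" using f0 by (cases i) auto
  show ?thesis
  proof (cases "i < n - 1")
    case False
    then have "i = n - 1" using i by simp
    then show ?thesis using last by simp
  qed (rule mid)
qed

lemma sum_point: "finite A \<Longrightarrow> (\<Sum>x\<in>A. of_bool (x = a)) = (of_bool (a \<in> A) :: int)"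
  by (simp add: of_bool_def)

text \<open>
  Rows are the vertices of a figure eight, columns are its arcs, with 1 at the source and -1 at the
  target.  A figure eight has one more arc than vertices, which leaves room for one zero row.
  Writing the size as \<open>n + 3\<close> avoids subtraction.
\<close>

lemma ex_rigid_zero_sums_aux:
  assumes n: "n \<ge> 2"
  obtains D :: "nat \<Rightarrow> nat \<Rightarrow> int" where "line_sums (n + 3) 0 D" "\<And>i j. D i j \<in> {-1, 0, 1}"
    "neg_mass (n + 3) D = n + 3" "card (mat_aut (n + 3) D) = 1"
proof -
  define src where "src c = (if c < n + 1 then c else if c = n + 1 then 0 else n + 1)" for c
  define dst where "dst c = (if c < n then Suc c else if c = n + 1 then n + 1 else 0)" for c
  define D :: "nat \<Rightarrow> nat \<Rightarrow> int" where "D i c = of_bool (i = src c) - of_bool (i = dst c)" for i c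
  have lt: "src c < n + 2" "dst c < n + 2" and ne: "src c \<noteq> dst c" for c
    using n by (auto simp: src_def dst_def)
  have D1: "D i c = 1 \<longleftrightarrow> i = src c" and Dm: "D i c = -1 \<longleftrightarrow> i = dst c" for i c
    using ne[of c] by (auto simp: D_def)
  have "line_sums (n + 3) 0 D"
    unfolding line_sums_def
  proof (intro conjI allI impI)
    fix c assume "c < n + 3"
    show "(\<Sum>i<(n + 3). D i c) = 0"
      unfolding D_def sum_subtractf using lt[of c] by (simp add: sum_point)
  next
    fix i assume i: "i < n + 3"
    consider "i = 0" | "0 < i" "i < n + 1" | "i = n + 1" | "i = n + 2" using i by linarith
    then show "(\<Sum>c<(n + 3). D i c) = 0"
    proof cases
      case 1
      have "D i c = of_bool (c = 0) + of_bool (c = n + 1) - of_bool (c = n) - of_bool (c = n + 2)"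
        if "c < n + 3" for c
        using that n 1 by (auto simp: D_def src_def dst_def)
      then show ?thesis using n by (simp add: sum.distrib sum_subtractf sum_point)
    next
      case 2
      have "D i c = of_bool (c = i) - of_bool (c = i - 1)" if "c < n + 3" for c
        using that n 2 by (auto simp: D_def src_def dst_def)
      then show ?thesis using 2 by (simp add: sum_subtractf sum_point)
    next
      case 3
      have "D i c = of_bool (c = n + 2) - of_bool (c = n + 1)" if "c < n + 3" for c
        using that n 3 by (auto simp: D_def src_def dst_def)
      then show ?thesis using n by (simp add: sum_subtractf sum_point)
    next
      case 4
      have "D i c = 0" if "c < n + 3" for c
        using that n 4 lt[of c] by (auto simp: D_def)
      then show ?thesis by simp
    qed
  qed
  moreover have "neg_mass (n + 3) D = n + 3"
  proof -
    have "(\<Sum>i<(n + 3). nat (- D i c)) = 1" for c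
    proof -
      have "nat (- D i c) = (if i = dst c then 1 else 0)" for i using ne[of c] by (auto simp: D_def)
      then show ?thesis using lt(2)[of c] by simp
    qed
    then have "(\<Sum>c<(n + 3). \<Sum>i<(n + 3). nat (- D i c)) = n + 3" by simp
    then show ?thesis unfolding neg_mass_def by (subst sum.swap)
  qed
  moreover have "card (mat_aut (n + 3) D) = 1"
  proof (rule card_mat_aut_eq_1)
    fix \<sigma> \<tau> i assume st: "(\<sigma>, \<tau>) \<in> mat_aut (n + 3) D" and i: "i < n + 3"
    note A = mat_autD[OF st]
    have srcE: "\<exists>c<(n + 3). src c = i" if "i < n + 2" for i
      using that n by (intro exI[of _ "if i < n + 1 then i else n + 2"]) (auto simp: src_def)
    have zero: "D (\<sigma> (n + 2)) j = 0" if "j < n + 3" for j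
    proof -
      obtain c where c: "c < n + 3" "\<tau> c = j" using A(6)[OF \<open>j < n + 3\<close>] by blast
      then show ?thesis using A(5)[of "n + 2" c] lt[of c] n by (auto simp: D_def)
    qed
    have last: "\<sigma> (n + 2) = n + 2"
    proof (rule ccontr)
      assume "\<sigma> (n + 2) \<noteq> n + 2"
      then have "\<sigma> (n + 2) < n + 2" using A(1)[of "n + 2"] n by linarith
      then obtain c where "c < n + 3" "src c = \<sigma> (n + 2)" using srcE by blast
      then have "D (\<sigma> (n + 2)) c = 1" using D1 by simp
      then show False using zero[OF \<open>c < n + 3\<close>] by simp
    qed
    have lt': "\<sigma> i < n + 2" if "i < n + 2" for i
      using A(1)[of i] A(3)[of i "n + 2"] last that by linarith
    have fig: "fig8 (n + 2) i j \<longleftrightarrow> (\<exists>c<(n + 3). i = src c \<and> j = dst c)" if "i < n + 2" "j < n + 2" for i j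
    proof
      assume "fig8 (n + 2) i j"
      then consider "j = Suc i" "i < n" | "i = n" "j = 0" | "i = 0" "j = n + 1" | "i = n + 1" "j = 0"
        by (auto simp: fig8_def)
      then show "\<exists>c<n + 3. i = src c \<and> j = dst c"
      proof cases
        case 1
        then show ?thesis by (intro exI[of _ i]) (auto simp: src_def dst_def)
      next
        case 2
        then show ?thesis by (intro exI[of _ n]) (auto simp: src_def dst_def)
      next
        case 3
        then show ?thesis by (intro exI[of _ "n + 1"]) (auto simp: src_def dst_def)
      next
        case 4
        then show ?thesis by (intro exI[of _ "n + 2"]) (auto simp: src_def dst_def)
      qed
    qed (use n in \<open>auto simp: fig8_def src_def dst_def split: if_splits\<close>)
    show "\<sigma> i = i"
    proof (cases "i = n + 2")
      case False
      show ?thesis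
      proof (rule fig8_rigid[of "n + 2" \<sigma> i])
        show "inj_on \<sigma> {..<n + 2}" using A(3) by (simp add: inj_on_def)
        show "fig8 (n + 2) (\<sigma> i) (\<sigma> j)" if "i < n + 2" "j < n + 2" "fig8 (n + 2) i j" for i j
        proof -
          obtain c where c: "c < n + 3" "i = src c" "j = dst c"
            using fig[OF \<open>i < n + 2\<close> \<open>j < n + 2\<close>] \<open>fig8 (n + 2) i j\<close> by blast
          then have "D i c = 1" "D j c = -1" using D1 Dm by auto
          then have "D (\<sigma> i) (\<tau> c) = 1" "D (\<sigma> j) (\<tau> c) = -1" using A(5) c(1) that by auto
          then have "\<sigma> i = src (\<tau> c)" "\<sigma> j = dst (\<tau> c)" using D1 Dm by auto
          then show ?thesis using fig[OF lt'[OF that(1)] lt'[OF that(2)]] A(2)[OF c(1)] by blast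
        qed
      qed (use n i False lt' in auto)
    qed (use last in simp)
  next
    fix c c' assume c: "c < n + 3" "c' < n + 3" and eq: "\<And>i. i < n + 3 \<Longrightarrow> D i c = D i c'"
    have "src c < n + 3" "dst c < n + 3" using lt[of c] by auto
    then have "src c = src c'" "dst c = dst c'" using eq D1 Dm by metis+
    then show "c = c'" using c n by (auto simp: src_def dst_def split: if_splits)
  qed
  moreover have "D i j \<in> {-1, 0, 1}" for i j by (auto simp: D_def)
  ultimately show thesis using that by blast
qed

lemma ex_rigid_zero_sums:
  assumes "k \<ge> 5"
  obtains D :: "nat \<Rightarrow> nat \<Rightarrow> int" where "line_sums k 0 D" "\<And>i j. D i j \<in> {-1, 0, 1}"
    "neg_mass k D = k" "card (mat_aut k D) = 1"
proof -
  define n where "n = k - 3"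
  have k: "k = n + 3" and n: "n \<ge> 2" using assms by (simp_all add: n_def)
  show thesis using ex_rigid_zero_sums_aux[OF n] that unfolding k by blast
qed

text \<open>
  Put -1 on the diagonal of a block of size \<open>m + 2\<close>, half of \<open>k\<close> rounded up, and 1 at the arcs of a
  figure eight on this block.  All lines of the block then sum to 0, except that the line of the
  double point sums to 1.  Attaching a leaf to each other row and column of the block corrects this.
  If \<open>k\<close> is even, one row and one column remain and form a pair.  The diagonal entries force the
  columns of the block to move like its rows, hence along an automorphism of the figure eight.
\<close>

lemma ex_rigid_unit_sums:
  assumes k: "k \<ge> 7"
  obtains D :: "nat \<Rightarrow> nat \<Rightarrow> int" where "line_sums k 1 D" "\<And>i j. D i j \<in> {-1, 0, 1}"
    "neg_mass k D = (k + 1) div 2" "card (mat_aut k D) = 1"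
proof -
  define m where "m = (k + 1) div 2 - 2"
  have h: "m \<ge> 2" "2 * m + 3 \<le> k" "k \<le> 2 * m + 4" and half: "(k + 1) div 2 = m + 2"
    using k by (auto simp: m_def)
  define nxt where "nxt i = (if i < m then Suc i else 0)" for i
  define prv where "prv i = (if i = 0 then m else if i = m + 1 then 0 else i - 1)" for i
  define oth where "oth i = (if i = 0 then m + 1 else if i < m + 2 then m + 1 + i
    else if i = 2 * m + 3 then i else i - (m + 1))" for i
  \<comment> \<open>\<open>oth\<close> is the second successor for vertex 0, the leaf for the rest of the block, and the
    attachment of a leaf; \<open>prv\<close> and \<open>oth\<close> describe the columns in the same way\<close>
  define D :: "nat \<Rightarrow> nat \<Rightarrow> int" where
    "D i j = (if i < m + 2 then of_bool (j = nxt i) + of_bool (j = oth i) - of_bool (j = i) else of_bool (j = oth i))" for i j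
  have D': "D i j = (if j < m + 2 then of_bool (i = prv j) + of_bool (i = oth j) - of_bool (i = j) else of_bool (i = oth j))"
    if "i < k" "j < k" for i j
  proof -
    consider "i < m + 2" "j < m + 2" | "i < m + 2" "j \<ge> m + 2" | "i \<ge> m + 2" "j < m + 2" | "i \<ge> m + 2" "j \<ge> m + 2" by linarith
    then show ?thesis
    proof cases
      case 1
      have "(j = nxt i \<or> j = oth i) = (i = prv j \<or> i = oth j)" "nxt i \<noteq> oth i" "prv j \<noteq> oth j"
        using 1 h by (auto simp: nxt_def prv_def oth_def)
      then have "of_bool (j = nxt i) + of_bool (j = oth i) = (of_bool (i = prv j) + of_bool (i = oth j) :: int)"
        by (auto simp: of_bool_def)
      then show ?thesis using 1 by (simp add: D_def eq_commute[of i j])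
    next
      case 2
      then have "j \<noteq> nxt i" "j = oth i \<longleftrightarrow> i = oth j" "j \<noteq> i"
        using h by (auto simp: nxt_def oth_def)
      then show ?thesis using 2 by (simp add: D_def)
    next
      case 3
      then have "i \<noteq> prv j" "j = oth i \<longleftrightarrow> i = oth j" "j \<noteq> i"
        using h by (auto simp: prv_def oth_def)
      then show ?thesis using 3 by (simp add: D_def)
    next
      case 4
      then have "j = oth i \<longleftrightarrow> i = oth j" using h that by (auto simp: oth_def)
      then show ?thesis using 4 by (simp add: D_def)
    qed
  qed
  have fig: "D i j = 1 \<longleftrightarrow> fig8 (m + 2) i j" if "i < m + 2" "j < m + 2" for i j
    using that h by (auto simp: D_def fig8_def nxt_def oth_def)
  have Dm: "D i j = -1 \<longleftrightarrow> i < m + 2 \<and> j = i" for i j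
    using h by (auto simp: D_def nxt_def oth_def)
  have hi: "D i j = 1 \<longleftrightarrow> j = oth i" if "i \<ge> m + 2" for i j
    using that by (auto simp: D_def)
  have oth_lt: "oth i < k" if "i < k" for i using that h by (auto simp: oth_def)
  have "line_sums k 1 D"
    unfolding line_sums_def
  proof (intro conjI allI impI)
    fix i assume i: "i < k"
    show "(\<Sum>j<k. D i j) = 1"
      using i h oth_lt[OF i] by (cases "i < m + 2") (auto simp: D_def sum.distrib sum_subtractf sum_point nxt_def)
  next
    fix j assume j: "j < k"
    have "(\<Sum>i<k. D i j) = (\<Sum>i<k. if j < m + 2 then of_bool (i = prv j) + of_bool (i = oth j) - of_bool (i = j) else of_bool (i = oth j))"
      using D' j by (intro sum.cong) auto
    also have "\<dots> = 1"
      using j h oth_lt[OF j] by (cases "j < m + 2") (auto simp: sum.distrib sum_subtractf sum_point prv_def)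
    finally show "(\<Sum>i<k. D i j) = 1" .
  qed
  moreover have "D i j \<in> {-1, 0, 1}" for i j
    using h by (auto simp: D_def nxt_def oth_def)
  moreover have "neg_mass k D = m + 2"
  proof -
    have "nat (- D i j) = (if i < m + 2 \<and> j = i then 1 else 0)" for i j
      using h by (auto simp: D_def nxt_def oth_def)
    then have "neg_mass k D = (\<Sum>i<k. if i < m + 2 then 1 else 0)"
      unfolding neg_mass_def by (intro sum.cong) auto
    also have "\<dots> = card ({..<k} \<inter> {i. i < m + 2})" by (simp add: sum.If_cases)
    also have "{..<k} \<inter> {i. i < m + 2} = {..<m + 2}" using h by auto
    finally show ?thesis by simp
  qed
  moreover have "card (mat_aut k D) = 1"
  proof (rule card_mat_aut_eq_1)
    fix \<sigma> \<tau> i assume st: "(\<sigma>, \<tau>) \<in> mat_aut k D" and i: "i < k"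
    note A = mat_autD[OF st]
    have hk: "i < k" if "i < m + 2" for i using that h by simp
    have core: "\<sigma> i < m + 2" "\<tau> i = \<sigma> i" if "i < m + 2" for i
      using A(5)[OF hk[OF that] hk[OF that]] Dm that by metis+
    have \<sigma>h: "\<sigma> i = i" if "i < m + 2" for i
    proof (rule fig8_rigid[of "m + 2" \<sigma> i])
      show "m + 2 \<ge> 4" using h by simp
      show "\<sigma> i < m + 2" if "i < m + 2" for i using core(1)[OF that] .
      show "inj_on \<sigma> {..<m + 2}" using A(3) by (simp add: inj_on_def)
      show "fig8 (m + 2) (\<sigma> i) (\<sigma> j)" if "i < m + 2" "j < m + 2" "fig8 (m + 2) i j" for i j
        using A(5)[OF hk[OF that(1)] hk[OF that(2)]] fig[OF that(1,2)] fig[OF core(1)[OF that(1)] core(1)[OF that(2)]]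
          core(2)[OF that(2)] that(3) by simp
    qed (rule that)
    have \<sigma>hi: "\<sigma> i \<ge> m + 2" if "i \<ge> m + 2" for i
      using \<sigma>h[of "\<sigma> i"] A(3)[of "\<sigma> i" i] that by (cases "\<sigma> i < m + 2") auto
    have leaf: "\<sigma> i = i" if "m + 2 \<le> i" "i < 2 * m + 3" for i
    proof -
      define j where "j = i - (m + 1)"
      have j: "j < m + 2" "oth i = j" "i < k" using that h by (auto simp: j_def oth_def)
      have "D (\<sigma> i) (\<tau> j) = 1" using A(5)[of i j] hi[OF that(1)] j hk by simp
      then have "j = oth (\<sigma> i)" using hi[OF \<sigma>hi[OF that(1)]] core(2) \<sigma>h j by simp
      then show ?thesis using j \<sigma>hi[OF that(1)] that by (auto simp: oth_def j_def split: if_splits)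
    qed
    show "\<sigma> i = i"
    proof (cases "i < 2 * m + 3")
      case True
      then show ?thesis using \<sigma>h leaf by (cases "i < m + 2") auto
    next
      case False
      have "\<not> \<sigma> i < 2 * m + 3"
        using \<sigma>h[of "\<sigma> i"] leaf[of "\<sigma> i"] A(3)[of "\<sigma> i" i] False by (cases "\<sigma> i < m + 2") auto
      then show ?thesis using A(1)[OF i] i h False by linarith
    qed
  next
    fix j j' assume j: "j < k" "j' < k" and eq: "\<And>i. i < k \<Longrightarrow> D i j = D i j'"
    show "j = j'"
    proof (cases "j < m + 2 \<or> j' < m + 2")
      case True
      then show ?thesis using eq[of j] eq[of j'] Dm[of j j] Dm[of j j'] Dm[of j' j] Dm[of j' j'] j by auto
    next
      case False
      then have "oth j = oth j'"
        using eq[OF oth_lt[OF j(1)]] D'[OF oth_lt[OF j(1)] j(1)] D'[OF oth_lt[OF j(1)] j(2)]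
        by (auto split: if_splits)
      then show ?thesis using False j h by (auto simp: oth_def split: if_splits)
    qed
  qed
  ultimately show thesis using that unfolding half by blast
qed

text \<open>
  The entries 1 form a graph in which row 0 and column 0 have degree 3 and all other lines degree 2:
  three paths from row 0 to column 0, of lengths 3, 5 and at least 9, starting in the columns 1, 2
  and 4.  The entry -1 joins their common ends.
\<close>

lemma ex_rigid_two_sums_aux:
  assumes k: "n \<ge> 7"
  obtains D :: "nat \<Rightarrow> nat \<Rightarrow> int" where "line_sums (n + 1) 2 D" "\<And>i j. D i j \<in> {-1, 0, 1}"
    "neg_mass (n + 1) D = 1" "card (mat_aut (n + 1) D) = 1"
proof -
  define u :: "nat \<Rightarrow> nat" where "u i = (if i = 1 then 0 else if i = 2 then 3 else if i = 3 then 0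
    else if i = n then 0 else Suc i)" for i
  define D :: "nat \<Rightarrow> nat \<Rightarrow> int" where
    "D i j = (if i = 0 then of_bool (j = 1) + of_bool (j = 2) + of_bool (j = 4) - of_bool (j = 0)
      else of_bool (j = i) + of_bool (j = u i))" for i j
  \<comment> \<open>the rows of column \<open>j \<noteq> 0\<close> with entry 1 are \<open>j\<close> and \<open>v j\<close>\<close>
  define v :: "nat \<Rightarrow> nat" where "v j = (if j = 3 then 2 else if j = 1 \<or> j = 2 \<or> j = 4 then 0 else j - 1)" for j
  have D': "D i j = (if j = 0 then of_bool (i = 1) + of_bool (i = 3) + of_bool (i = n) - of_bool (i = 0)
      else of_bool (i = j) + of_bool (i = v j))" if "i < n + 1" "j < n + 1" for i j
  proof (cases "j = 0")
    case True
    consider "i = 0" | "i = 1" | "i = 3" | "i = n" | "i \<noteq> 0" "i \<noteq> 1" "i \<noteq> 3" "i \<noteq> n" by blast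
    then show ?thesis using True k by cases (simp_all add: D_def u_def)
  next
    case False
    show ?thesis
    proof (cases "i = 0")
      case True
      consider "j = 1" | "j = 2" | "j = 4" | "j \<noteq> 0" "j \<noteq> 1" "j \<noteq> 2" "j \<noteq> 4" using False by blast
      then show ?thesis
      proof cases
        case 4
        then have "v j \<noteq> 0" by (simp add: v_def)
        then show ?thesis using True 4 by (simp add: D_def)
      qed (simp_all add: D_def v_def True)
    next
      case i: False
      have "j = u i \<longleftrightarrow> i = v j" using False i that k by (auto simp: u_def v_def)
      then show ?thesis using False i by (simp add: D_def eq_commute[of i j])
    qed
  qed
  have "line_sums (n + 1) 2 D"
    unfolding line_sums_def
  proof (intro conjI allI impI)
    fix i assume i: "i < n + 1"
    have "u i < n + 1" using i k by (simp add: u_def)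
    then show "(\<Sum>j<n + 1. D i j) = 2"
      using i k by (cases "i = 0") (simp_all add: D_def sum.distrib sum_subtractf sum_point del: sum.lessThan_Suc)
  next
    fix j assume j: "j < n + 1"
    have "v j < n + 1" using j k by (auto simp: v_def)
    have "(\<Sum>i<n + 1. D i j) = (\<Sum>i<n + 1. if j = 0 then of_bool (i = 1) + of_bool (i = 3) + of_bool (i = n) - of_bool (i = 0)
      else of_bool (i = j) + of_bool (i = v j))"
      using D' j by (intro sum.cong) auto
    also have "\<dots> = 2"
      using j k \<open>v j < n + 1\<close> by (cases "j = 0") (simp_all add: sum.distrib sum_subtractf sum_point del: sum.lessThan_Suc)
    finally show "(\<Sum>i<n + 1. D i j) = 2" .
  qed
  moreover have "D i j \<in> {-1, 0, 1}" for i j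
  proof -
    have "u i \<noteq> i" if "i \<noteq> 0" using that k by (auto simp: u_def)
    then show ?thesis by (auto simp: D_def)
  qed
  moreover have "neg_mass (n + 1) D = 1"
  proof -
    have "nat (- D i j) = (if i = 0 \<and> j = 0 then 1 else 0)" for i j
      by (auto simp: D_def)
    then have "neg_mass (n + 1) D = (\<Sum>i<n + 1. if i = 0 then 1 else 0)"
      unfolding neg_mass_def using k by (intro sum.cong) auto
    then show ?thesis using k by simp
  qed
  moreover have "card (mat_aut (n + 1) D) = 1"
  proof (rule card_mat_aut_eq_1)
    fix \<sigma> \<tau> i assume st: "(\<sigma>, \<tau>) \<in> mat_aut (n + 1) D" and i: "i < n + 1"
    note A = mat_autD[OF st]
    have Dm: "D i j = -1 \<longleftrightarrow> i = 0 \<and> j = 0" for i j by (auto simp: D_def)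
    have "D (\<sigma> 0) (\<tau> 0) = -1" using A(5)[of 0 0] Dm[of 0 0] k by simp
    then have 00: "\<sigma> 0 = 0" "\<tau> 0 = 0" using Dm by auto
    \<comment> \<open>two rows share a column other than 0: a spider with centre 0 and the legs (1), (2, 3) and (4, 5, ...)\<close>
    define S where "S i i' \<longleftrightarrow> i \<noteq> i' \<and> (\<exists>c<n + 1. c \<noteq> 0 \<and> D i c = 1 \<and> D i' c = 1)" for i i'
    have S_pres: "S (\<sigma> i) (\<sigma> i')" if "S i i'" "i < n + 1" "i' < n + 1" for i i'
    proof -
      obtain c where c: "c < n + 1" "c \<noteq> 0" "D i c = 1" "D i' c = 1" "i \<noteq> i'"
        using \<open>S i i'\<close> by (auto simp: S_def)
      have "\<tau> c \<noteq> 0" using A(4)[of c 0] 00(2) c(2) by simp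
      then show ?thesis
        unfolding S_def using A(2)[OF c(1)] A(3)[of i i'] A(5)[OF that(2) c(1)] A(5)[OF that(3) c(1)] c by auto
    qed
    have D1: "D i c = 1 \<longleftrightarrow> i = c \<or> i = v c" if "c \<noteq> 0" "c < n + 1" "i < n + 1" for i c
    proof -
      have "v c \<noteq> c" using that(1) by (auto simp: v_def)
      then show ?thesis using D'[OF that(3,2)] that(1) by auto
    qed
    have S: "S i i' \<longleftrightarrow> (i = v i' \<and> i' \<noteq> 0) \<or> (i' = v i \<and> i \<noteq> 0)" if "i < n + 1" "i' < n + 1" for i i'
    proof
      assume "S i i'"
      then obtain c where c: "c < n + 1" "c \<noteq> 0" "D i c = 1" "D i' c = 1" "i \<noteq> i'"
        by (auto simp: S_def)
      then have "i = c \<or> i = v c" "i' = c \<or> i' = v c" using D1 that by simp_all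
      then show "(i = v i' \<and> i' \<noteq> 0) \<or> (i' = v i \<and> i \<noteq> 0)" using c(2,5) by blast
    next
      assume "(i = v i' \<and> i' \<noteq> 0) \<or> (i' = v i \<and> i \<noteq> 0)"
      moreover have "S (v c) c \<and> S c (v c)" if "c \<noteq> 0" "c < n + 1" "v c < n + 1" for c
      proof -
        have "v c \<noteq> c" using that(1) by (auto simp: v_def)
        moreover have "D (v c) c = 1" "D c c = 1" using D1 that by simp_all
        ultimately show ?thesis using that by (auto simp: S_def)
      qed
      ultimately show "S i i'" using that by blast
    qed
    have S': "S (\<sigma> i) (\<sigma> i')" if "i = v i'" "i' \<noteq> 0" "i' < n + 1" for i i'
    proof -
      have "v i' < n + 1" using that k by (auto simp: v_def)
      then show ?thesis using that by (intro S_pres) (simp_all add: S)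
    qed
    have vcase: "(v y = 0 \<and> (y = 1 \<or> y = 2 \<or> y = 4)) \<or> (v y = 2 \<and> y = 3) \<or> (4 \<le> v y \<and> y = Suc (v y))"
      if "y \<noteq> 0" for y
    proof -
      have "y = 1 \<or> y = 2 \<or> y = 3 \<or> y = 4 \<or> y \<ge> 5" using that by linarith
      then show ?thesis by (elim disjE) (simp_all add: v_def)
    qed
    have nb: "(x = 0 \<and> (y = 1 \<or> y = 2 \<or> y = 4)) \<or> (y = 0 \<and> (x = 1 \<or> x = 2 \<or> x = 4)) \<or>
        (x = 2 \<and> y = 3) \<or> (x = 3 \<and> y = 2) \<or> (x \<ge> 4 \<and> y = Suc x) \<or> (y \<ge> 4 \<and> x = Suc y)"
      if "S x y" "x < n + 1" "y < n + 1" for x y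
    proof -
      from that have "(x = v y \<and> y \<noteq> 0) \<or> (y = v x \<and> x \<noteq> 0)" using S by simp
      then show ?thesis
      proof (elim disjE conjE)
        assume v: "x = v y" "y \<noteq> 0"
        show ?thesis using vcase[OF v(2)] unfolding v(1)[symmetric] by blast
      next
        assume v: "y = v x" "x \<noteq> 0"
        show ?thesis using vcase[OF v(2)] unfolding v(1)[symmetric] by blast
      qed
    qed
    have lt: "\<sigma> 1 < n + 1" "\<sigma> 2 < n + 1" "\<sigma> 3 < n + 1" "\<sigma> 4 < n + 1" "\<sigma> 5 < n + 1" "\<sigma> 6 < n + 1"
      using A(1) k by auto
    have nb1: "S 0 (\<sigma> 1)" "S 0 (\<sigma> 2)" "S 0 (\<sigma> 4)" "S (\<sigma> 2) (\<sigma> 3)" "S (\<sigma> 4) (\<sigma> 5)" "S (\<sigma> 5) (\<sigma> 6)"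
    proof -
      have v: "0 = v 1" "0 = v 2" "0 = v 4" "2 = v 3" "4 = v 5" "5 = v 6" by (simp_all add: v_def)
      show "S 0 (\<sigma> 1)" "S 0 (\<sigma> 2)" "S 0 (\<sigma> 4)"
        using S'[OF v(1)] S'[OF v(2)] S'[OF v(3)] k by (simp_all add: 00)
      show "S (\<sigma> 2) (\<sigma> 3)" "S (\<sigma> 4) (\<sigma> 5)" "S (\<sigma> 5) (\<sigma> 6)"
        using k by (simp_all add: S'[OF v(4)] S'[OF v(5)] S'[OF v(6)])
    qed
    have ne: "\<sigma> 1 \<noteq> \<sigma> 2" "\<sigma> 1 \<noteq> \<sigma> 4" "\<sigma> 2 \<noteq> \<sigma> 4" "\<sigma> 3 \<noteq> 0" "\<sigma> 5 \<noteq> 0" "\<sigma> 6 \<noteq> \<sigma> 4" "\<sigma> 3 \<noteq> \<sigma> 4" "\<sigma> 5 \<noteq> \<sigma> 2"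
      using A(3)[of 1 2] A(3)[of 1 4] A(3)[of 2 4] A(3)[of 3 0] A(3)[of 5 0] A(3)[of 6 4] A(3)[of 3 4]
        A(3)[of 5 2] 00(1) by simp_all
    have nb0: "y = 1 \<or> y = 2 \<or> y = 4" if "S 0 y" "y < n + 1" for y
      using nb[OF that(1) _ that(2)] by simp
    have nb_1: "y = 0" if "S 1 y" "y < n + 1" for y using nb[OF that(1) _ that(2)] k by auto
    have nb_2: "y = 3" if "S 2 y" "y < n + 1" "y \<noteq> 0" for y using nb[OF that(1) _ that(2)] k that(3) by auto
    have nb_3: "y = 2" if "S 3 y" "y < n + 1" for y using nb[OF that(1) _ that(2)] k by auto
    have nb_long: "y = Suc x \<or> y = 0 \<or> x = Suc y" if "S x y" "x < n + 1" "y < n + 1" "x \<ge> 4" for x y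
      using nb[OF that(1-3)] that(4) by auto
    have not1: "\<sigma> 2 \<noteq> 1" "\<sigma> 4 \<noteq> 1"
      using nb_1[of "\<sigma> 3"] nb_1[of "\<sigma> 5"] nb1(4,5) lt ne(4,5) by metis+
    have "\<sigma> 4 \<noteq> 2"
    proof
      assume 2: "\<sigma> 4 = 2"
      then have "\<sigma> 5 = 3" using nb_2[of "\<sigma> 5"] nb1(5) lt ne by simp
      then have "\<sigma> 6 = 2" using nb_3[of "\<sigma> 6"] nb1(6) lt by simp
      then show False using 2 ne by simp
    qed
    then have 4: "\<sigma> 4 = 4" using nb0[OF nb1(3) lt(4)] not1 by simp
    then have 2: "\<sigma> 2 = 2" using nb0[OF nb1(2) lt(2)] not1 ne(3) by auto
    then have 1: "\<sigma> 1 = 1" using nb0[OF nb1(1) lt(1)] ne(1,2) 4 by auto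
    have 3: "\<sigma> 3 = 3" using nb_2[of "\<sigma> 3"] nb1(4) lt ne(4) 2 by simp
    have long: "4 + m < n + 1 \<longrightarrow> \<sigma> (4 + m) = 4 + m" for m
    proof (induction m rule: less_induct)
      case (less m)
      show ?case
      proof
        assume m: "4 + m < n + 1"
        show "\<sigma> (4 + m) = 4 + m"
        proof (cases m)
          case 0
          then show ?thesis using 4 by simp
        next
          case (Suc d)
          have p: "\<sigma> (4 + d) = 4 + d" using less[of d] m Suc by simp
          have "S (\<sigma> (4 + d)) (\<sigma> (4 + m))" using m Suc by (intro S') (auto simp: v_def)
          then have s: "S (4 + d) (\<sigma> (4 + m))" using p by simp
          have x: "\<sigma> (4 + m) < n + 1" using A(1)[of "4 + m"] m by linarith
          have nz: "\<sigma> (4 + m) \<noteq> 0" using A(3)[of "4 + m" 0] 00 by simp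
          have prev: "\<sigma> (4 + m) \<noteq> 3 + d"
          proof
            assume eq: "\<sigma> (4 + m) = 3 + d"
            have "\<sigma> (3 + d) = 3 + d"
            proof (cases d)
              case 0
              then show ?thesis using 3 by simp
            next
              case (Suc d')
              have d': "d' < m" "3 + d = 4 + d'" using Suc \<open>m = Suc d\<close> by simp_all
              then have "4 + d' < n + 1" using m by linarith
              with less[OF d'(1)] have "\<sigma> (4 + d') = 4 + d'" by blast
              then show ?thesis unfolding d'(2) .
            qed
            then have "\<sigma> (4 + m) = \<sigma> (3 + d)" using eq by (simp only:)
            then have "4 + m = 3 + d" using A(3) by blast
            then show False using Suc by linarith
          qed
          have "4 + d < n + 1" using m Suc by simp
          from nb_long[OF s this x] have "\<sigma> (4 + m) = Suc (4 + d) \<or> \<sigma> (4 + m) = 0 \<or> 4 + d = Suc (\<sigma> (4 + m))"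
            by (simp only: le_add1)
          then show ?thesis
            using nz prev Suc by linarith
        qed
      qed
    qed
    show "\<sigma> i = i"
    proof (cases "i \<ge> 4")
      case True
      then obtain m where m: "i = 4 + m" using le_Suc_ex by blast
      then show ?thesis using long[rule_format, of m] i by blast
    next
      case False
      then have "i = 0 \<or> i = 1 \<or> i = 2 \<or> i = 3" by auto
      then show ?thesis by (elim disjE) (simp_all only: 00 1 2 3)
    qed
  next
    fix j j' assume j: "j < n + 1" "j' < n + 1" and eq: "\<And>i. i < n + 1 \<Longrightarrow> D i j = D i j'"
    have Dm: "D 0 j = -1 \<longleftrightarrow> j = 0" for j by (auto simp: D_def)
    show "j = j'"
    proof (cases "j = 0 \<or> j' = 0")
      case True
      have "D 0 j = D 0 j'" by (rule eq) simp
      then have "j = 0 \<longleftrightarrow> j' = 0" unfolding Dm[symmetric] by (rule arg_cong)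
      then show ?thesis using True by blast
    next
      case False
      have vne: "v c \<noteq> c" if "c \<noteq> 0" for c using that by (auto simp: v_def)
      have D1: "D i c = 1 \<longleftrightarrow> i = c \<or> i = v c" if "c \<noteq> 0" "c < n + 1" "i < n + 1" for i c
        using D'[OF that(3,2)] vne[OF that(1)] that(1) by simp
      have "j = j' \<or> j = v j'" "j' = j \<or> j' = v j"
      proof -
        have nz: "j \<noteq> 0" "j' \<noteq> 0" using False by simp_all
        have "D j j = 1" "D j' j' = 1" using D1[OF nz(1) j(1) j(1)] D1[OF nz(2) j(2) j(2)] by simp_all
        then have D2: "D j j' = 1" "D j' j = 1" using eq[OF j(1)] eq[OF j(2)] by (simp_all only:)
        show "j = j' \<or> j = v j'" using D1[OF nz(2) j(2) j(1)] D2(1) by blast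
        show "j' = j \<or> j' = v j" using D1[OF nz(1) j(1) j(2)] D2(2) by blast
      qed
      moreover have "v c < c" if "c \<noteq> 0" for c using that by (auto simp: v_def)
      ultimately show ?thesis using False by (metis order_less_asym)
    qed
  qed
  ultimately show thesis using that by blast
qed

lemma ex_rigid_two_sums:
  assumes "k \<ge> 8"
  obtains D :: "nat \<Rightarrow> nat \<Rightarrow> int" where "line_sums k 2 D" "\<And>i j. D i j \<in> {-1, 0, 1}"
    "neg_mass k D = 1" "card (mat_aut k D) = 1"
proof -
  define n where "n = k - 1"
  have k: "k = n + 1" and n: "n \<ge> 7" using assms by (simp_all add: n_def)
  show thesis using ex_rigid_two_sums_aux[OF n] that unfolding k by blast
qed

subsection \<open>Regular bipartite graphs without symmetries\<close>

definition arc :: "nat \<Rightarrow> nat \<Rightarrow> nat \<Rightarrow> nat \<Rightarrow> bool" where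
  "arc k r x j \<longleftrightarrow> x \<le> j \<and> j < x + r \<or> j + k < x + r"

text \<open>
  Rows from 4 on are the cyclic intervals \<open>x, \<dots>, x + r - 1\<close>.  In the rows 0, 1 and 3 the entries of
  the columns 0, 1, 2 and of the columns \<open>r\<close>, \<open>r + 1\<close>, \<open>r + 2\<close> are redistributed, without changing line
  sums, so that the dihedral symmetry of the intervals disappears.
\<close>

definition nbr :: "nat \<Rightarrow> nat \<Rightarrow> nat \<Rightarrow> nat \<Rightarrow> bool" where
  "nbr k r x j \<longleftrightarrow>
     (if x = 0 then j = 0 \<or> 2 \<le> j \<and> j \<le> r
      else if x = 1 then 1 \<le> j \<and> j < r \<or> j = r + 2
      else if x = 2 then 2 \<le> j \<and> j \<le> r + 1
      else if x = 3 then j = 1 \<or> 3 \<le> j \<and> j \<le> r + 1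
      else arc k r x j)"

lemma card_arc_row:
  assumes "r \<le> k" "x < k"
  shows "card {j. j < k \<and> arc k r x j} = r"
proof (cases "x + r \<le> k")
  case True
  then have "{j. j < k \<and> arc k r x j} = {x..<x + r}" by (auto simp: arc_def)
  then show ?thesis by simp
next
  case False
  then have "{j. j < k \<and> arc k r x j} = {x..<k} \<union> {..<x + r - k}"
    using assms by (auto simp: arc_def)
  moreover have "card ({x..<k} \<union> {..<x + r - k}) = card {x..<k} + card {..<x + r - k}"
    using assms by (intro card_Un_disjoint) auto
  ultimately show ?thesis using assms False by simp
qed

lemma card_arc_col:
  assumes "r \<le> k" "j < k"
  shows "card {x. x < k \<and> arc k r x j} = r"
proof (cases "r \<le> j + 1")
  case True
  then have "{x. x < k \<and> arc k r x j} = {j + 1 - r..<j + 1}"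
    using assms by (auto simp: arc_def)
  then show ?thesis using True by simp
next
  case False
  then have "{x. x < k \<and> arc k r x j} = {..<j + 1} \<union> {j + k + 1 - r..<k}"
    using assms by (auto simp: arc_def)
  moreover have "card ({..<j + 1} \<union> {j + k + 1 - r..<k}) = card {..<j + 1} + card {j + k + 1 - r..<k}"
    using assms False by (intro card_Un_disjoint) auto
  ultimately show ?thesis using assms False by simp
qed

context
  fixes k r :: nat
  assumes r: "3 \<le> r" and rk: "2 * r \<le> k" and k: "8 \<le> k"
begin

abbreviation "N \<equiv> nbr k r"

lemma N_simps:
  "N 0 j \<longleftrightarrow> j = 0 \<or> 2 \<le> j \<and> j \<le> r"
  "N (Suc 0) j \<longleftrightarrow> 1 \<le> j \<and> j < r \<or> j = r + 2"
  "N 2 j \<longleftrightarrow> 2 \<le> j \<and> j \<le> r + 1"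
  "N 3 j \<longleftrightarrow> j = 1 \<or> 3 \<le> j \<and> j \<le> r + 1"
  "4 \<le> x \<Longrightarrow> N x j \<longleftrightarrow> x \<le> j \<and> j < x + r \<or> j + k < x + r"
  by (auto simp: nbr_def arc_def)

lemma small_cases: "x = 0 \<or> x = Suc 0 \<or> x = 2 \<or> x = 3 \<or> 4 \<le> (x::nat)"
  by auto

lemma card_nbr_row:
  assumes "x < k"
  shows "card {j. j < k \<and> N x j} = r"
proof -
  consider "x = 0" | "x = Suc 0" | "x = 2" | "x = 3" | "4 \<le> x" using small_cases[of x] by blast
  then show ?thesis
  proof cases
    case 1
    have "{j. j < k \<and> N x j} = insert 0 {2..r}" using r rk k 1 by (auto simp: N_simps)
    then show ?thesis using r by simp
  next
    case 2
    have "{j. j < k \<and> N x j} = insert (r + 2) {1..<r}" using r rk k 2 by (auto simp: N_simps)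
    then show ?thesis using r by simp
  next
    case 3
    have "{j. j < k \<and> N x j} = {2..r + 1}" using r rk k 3 by (auto simp: N_simps)
    then show ?thesis using r by simp
  next
    case 4
    have "{j. j < k \<and> N x j} = insert 1 {3..r + 1}" using r rk k 4 by (auto simp: N_simps)
    then show ?thesis using r by simp
  next
    case 5
    then have "{j. j < k \<and> N x j} = {j. j < k \<and> arc k r x j}" by (auto simp: nbr_def)
    then show ?thesis using card_arc_row[OF _ assms] rk by simp
  qed
qed

text \<open>
  The rows 0 to 3 meet each column as often as the intervals that they replace.
\<close>

lemma card_nbr_col:
  assumes j: "j < k"
  shows "card {x. x < k \<and> N x j} = r"
proof -
  have split: "{x. x < k \<and> P x} = {x\<in>{0, Suc 0, 2, 3}. P x} \<union> {x. 4 \<le> x \<and> x < k \<and> P x}" for P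
    using small_cases k by auto
  have card: "card {x. x < k \<and> P x} = card {x\<in>{0, Suc 0, 2, 3}. P x} + card {x. 4 \<le> x \<and> x < k \<and> P x}" for P
    unfolding split[of P] by (rule card_Un_disjoint) auto
  have four: "card {x\<in>{0, Suc 0, 2, 3}. P x} = of_bool (P 0) + of_bool (P (Suc 0)) + of_bool (P 2) + of_bool (P 3)"
    for P :: "nat \<Rightarrow> bool"
  proof -
    have "card {x\<in>{0, Suc 0, 2, 3}. P x} = (\<Sum>x\<in>{0, Suc 0, 2, 3}. of_bool (P x))"
      by (simp add: sum_of_bool_eq Int_def conj_commute)
    also have "\<dots> = of_bool (P 0) + of_bool (P (Suc 0)) + of_bool (P 2) + of_bool (P 3)" by simp
    finally show ?thesis .
  qed
  have "of_bool (N 0 j) + of_bool (N (Suc 0) j) + of_bool (N 2 j) + of_bool (N 3 j)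
     = (of_bool (arc k r 0 j) + of_bool (arc k r (Suc 0) j) + of_bool (arc k r 2 j) + of_bool (arc k r 3 j) :: nat)"
  proof -
    consider "j = 0" | "j = 1" | "j = 2" | "3 \<le> j" "j < r" | "j = r" | "j = r + 1" | "j = r + 2" | "r + 2 < j"
      by linarith
    then show ?thesis using r rk k j by cases (simp_all add: N_simps arc_def)
  qed
  then have "card {x\<in>{0, Suc 0, 2, 3}. N x j} = card {x\<in>{0, Suc 0, 2, 3}. arc k r x j}"
    unfolding four .
  moreover have "{x. 4 \<le> x \<and> x < k \<and> N x j} = {x. 4 \<le> x \<and> x < k \<and> arc k r x j}"
    by (auto simp: nbr_def)
  ultimately show ?thesis
    using card[of "\<lambda>x. N x j"] card[of "\<lambda>x. arc k r x j"] card_arc_col[OF _ j] rk by simp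
qed

text \<open>
  The invariant that recovers the rows: the number of neighbours of \<open>x\<close> that are not neighbours
  of \<open>y\<close>.
\<close>

definition diff :: "nat \<Rightarrow> nat \<Rightarrow> nat" where
  "diff x y = card {j. j < k \<and> N x j \<and> \<not> N y j}"

lemma diff_sym: assumes "x < k" "y < k" shows "diff x y = diff y x"
proof -
  have *: "diff x y + card {j. j < k \<and> N x j \<and> N y j} = card {j. j < k \<and> N x j}" for x y
    unfolding diff_def by (subst card_Un_disjoint[symmetric]) (auto intro!: arg_cong[where f = card])
  have "{j. j < k \<and> N x j \<and> N y j} = {j. j < k \<and> N y j \<and> N x j}" by auto
  then show ?thesis using *[of x y] *[of y x] card_nbr_row assms by simp
qed

lemma diff_le: "finite A \<Longrightarrow> (\<And>j. j < k \<Longrightarrow> N x j \<Longrightarrow> \<not> N y j \<Longrightarrow> j \<in> A) \<Longrightarrow> diff x y \<le> card A"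
  unfolding diff_def by (rule card_mono) auto

lemma diff_ge: "(\<And>j. j \<in> A \<Longrightarrow> j < k \<and> N x j \<and> \<not> N y j) \<Longrightarrow> card A \<le> diff x y"
  unfolding diff_def by (rule card_mono) auto

lemma diff_ge_2: "a \<noteq> b \<Longrightarrow> a < k \<and> N x a \<and> \<not> N y a \<Longrightarrow> b < k \<and> N x b \<and> \<not> N y b \<Longrightarrow> diff x y > 1"
  using diff_ge[of "{a, b}" x y] by fastforce

lemma far_core:
  assumes "x < y" "y < 4" and not: "\<not> (x = 0 \<and> y = 2)" "\<not> (x = 2 \<and> y = 3)"
  shows "diff x y > 1"
proof -
  have "y = 1 \<or> y = 2 \<or> y = 3" using assms(1,2) by auto
  then consider "x = 0" "y = Suc 0" | "x = 0" "y = 3" | "x = Suc 0" "y = 2" | "x = Suc 0" "y = 3"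
    using assms(1) not by (cases x; cases "x - 1"; cases "x - 2") auto
  then show ?thesis
  proof cases
    case 1
    then show ?thesis using r rk k by (intro diff_ge_2[of 0 r]) (simp_all add: N_simps(1,2))
  next
    case 2
    then show ?thesis using r rk k by (intro diff_ge_2[of 0 2]) (simp_all add: N_simps(1,4))
  next
    case 3
    then show ?thesis using r rk k by (intro diff_ge_2[of 1 "r + 2"]) (simp_all add: N_simps(2,3))
  next
    case 4
    then show ?thesis using r rk k by (intro diff_ge_2[of 2 "r + 2"]) (simp_all add: N_simps(2,4))
  qed
qed

text \<open>
  The two witnesses are the first two elements of the interval of \<open>x\<close>, unless the interval of \<open>y\<close>
  wraps around and covers them; then they are its last two elements.
\<close>

lemma far_long:
  assumes x: "4 \<le> x" and xy: "Suc x < y" "y < k"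
  shows "diff x y > 1"
proof (cases "y + r \<le> x + k")
  case True
  then show ?thesis
    using r rk x xy N_simps(5)[of x] N_simps(5)[of y] by (intro diff_ge_2[of x "Suc x"]) simp_all
next
  case False
  define a where "a = x + r - 2"
  have "a + 2 = x + r" using r by (simp add: a_def)
  then show ?thesis
    using False r rk x xy N_simps(5)[of x] N_simps(5)[of y] by (intro diff_ge_2[of a "Suc a"]) simp_all
qed

text \<open>
  If the interval of \<open>y\<close> does not wrap around, it misses all columns below 4.  Otherwise it starts
  beyond \<open>k - r \<ge> r\<close>, so it misses \<open>r - 1\<close> and \<open>r\<close>.
\<close>

lemma far_mixed:
  assumes x: "x < 4" and y: "4 \<le> y" "y < k"
  shows "diff x y > 1"
proof -
  note Ny = N_simps(5)[OF y(1)]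
  define s where "s = r - 1"
  have s: "Suc s = r" using r by (simp add: s_def)
  consider "x = 0" | "x = Suc 0" | "x = 2" | "x = 3" using x by linarith
  then show ?thesis
  proof cases
    case 1
    show ?thesis
    proof (cases "y + r \<le> k")
      case True
      then show ?thesis unfolding 1 using r rk y by (intro diff_ge_2[of 0 2]) (simp_all add: N_simps(1) Ny)
    next
      case False
      then show ?thesis unfolding 1 using r rk y s by (intro diff_ge_2[of r s]) (simp_all add: N_simps(1) Ny)
    qed
  next
    case 2
    show ?thesis
    proof (cases "y + r \<le> k")
      case True
      then show ?thesis unfolding 2 using r rk y by (intro diff_ge_2[of 1 2]) (simp_all add: N_simps(2) Ny)
    next
      case wrap: False
      show ?thesis
      proof (cases "y > r + 2")
        case True
        then show ?thesis unfolding 2 using wrap r rk k y s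
          by (intro diff_ge_2[of s "r + 2"]) (simp_all add: N_simps(2) Ny)
      next
        case False
        then have "r \<ge> 4" using wrap r rk k by linarith
        then show ?thesis unfolding 2 using False wrap rk y s
          by (intro diff_ge_2[of s 2]) (simp_all add: N_simps(2) Ny)
      qed
    qed
  next
    case 3
    show ?thesis
    proof (cases "y + r \<le> k")
      case True
      then show ?thesis unfolding 3 using r rk y by (intro diff_ge_2[of 2 3]) (simp_all add: N_simps(3) Ny)
    next
      case False
      then show ?thesis unfolding 3 using r rk y s by (intro diff_ge_2[of r s]) (simp_all add: N_simps(3) Ny)
    qed
  next
    case 4
    show ?thesis
    proof (cases "y + r \<le> k")
      case True
      then show ?thesis unfolding 4 using r rk y by (intro diff_ge_2[of 1 3]) (simp_all add: N_simps(4) Ny)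
    next
      case wrap: False
      show ?thesis
      proof (cases "y > r + 1")
        case True
        then show ?thesis unfolding 4 using wrap r rk k y
          by (intro diff_ge_2[of r "r + 1"]) (simp_all add: N_simps(4) Ny)
      next
        case False
        then show ?thesis unfolding 4 using wrap r rk k y
          by (intro diff_ge_2[of r 1]) (simp_all add: N_simps(4) Ny)
      qed
    qed
  qed
qed

lemma far_pairs:
  assumes xy: "x < y" "y < k" and not: "\<not> (x = 0 \<and> y = 2)" "\<not> (x = 2 \<and> y = 3)" "\<not> (4 \<le> x \<and> y = Suc x)"
  shows "diff x y > 1"
proof -
  show ?thesis
  proof (cases "y < 4")
    case True
    show ?thesis by (rule far_core[OF xy(1) True not(1,2)])
  next
    case y: False
    show ?thesis
    proof (cases "x < 4")
      case True
      then show ?thesis using y xy(2) by (intro far_mixed) simp_all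
    next
      case False
      then show ?thesis using xy not(3) by (intro far_long) simp_all
    qed
  qed
qed

lemma near_pairs:
  "diff 0 2 \<le> 1" "diff 2 3 \<le> 1" "4 \<le> x \<Longrightarrow> Suc x < k \<Longrightarrow> diff x (Suc x) \<le> 1"
proof -
  have "diff 0 2 \<le> card {0::nat}" by (rule diff_le) (auto simp: N_simps(1,3))
  then show "diff 0 2 \<le> 1" by simp
  have "diff 2 3 \<le> card {2::nat}" by (rule diff_le) (auto simp: N_simps(3,4))
  then show "diff 2 3 \<le> 1" by simp
  show "diff x (Suc x) \<le> 1" if "4 \<le> x" "Suc x < k"
  proof -
    have "diff x (Suc x) \<le> card {x}" using that by (intro diff_le) (auto simp: N_simps(5))
    then show ?thesis by simp
  qed
qed

definition near :: "nat \<Rightarrow> nat \<Rightarrow> bool" where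
  "near x y \<longleftrightarrow> x \<noteq> y \<and> diff x y \<le> 1"

text \<open>
  The rows that differ in one element form the path \<open>0, 2, 3\<close>, the isolated row 1, and the path
  \<open>4, \<dots>, k - 1\<close>.
\<close>

lemma near_iff:
  assumes "x < k" "y < k"
  shows "near x y \<longleftrightarrow> x = 0 \<and> y = 2 \<or> x = 2 \<and> y = 0 \<or> x = 2 \<and> y = 3 \<or> x = 3 \<and> y = 2 \<or>
    4 \<le> x \<and> y = Suc x \<or> 4 \<le> y \<and> x = Suc y"
proof -
  have lt: "near x y \<longleftrightarrow> x = 0 \<and> y = 2 \<or> x = 2 \<and> y = 3 \<or> 4 \<le> x \<and> y = Suc x" if "x < y" "y < k" for x y
    using far_pairs[OF that] near_pairs that unfolding near_def by (metis less_irrefl not_le)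
  have sym: "near x y \<longleftrightarrow> near y x" using diff_sym[OF assms] by (auto simp: near_def)
  have irr: "\<not> near x x" by (simp add: near_def)
  consider "x < y" | "y < x" | "x = y" by linarith
  then show ?thesis
  proof cases
    case 1
    then show ?thesis using lt[OF 1 assms(2)] by auto
  next
    case 2
    then show ?thesis using lt[OF 2 assms(1)] sym by auto
  next
    case 3
    then show ?thesis using irr by auto
  qed
qed

text \<open>
  These values tell the two ends of each path apart.
\<close>

lemma landmark_diffs: "diff 2 4 \<le> 2" "diff 2 (k - 1) > 2" "diff 0 4 > 2" "diff 3 4 \<le> 2"
proof -
  have "diff 2 4 \<le> card {2, 3::nat}" by (rule diff_le) (auto simp: N_simps(3) N_simps(5)[of 4])
  then show "diff 2 4 \<le> 2" by simp
  have "diff 3 4 \<le> card {1, 3::nat}" by (rule diff_le) (auto simp: N_simps(4) N_simps(5)[of 4])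
  then show "diff 3 4 \<le> 2" by simp
  have "card {0, 2, 3::nat} \<le> diff 0 4"
    using r rk k by (intro diff_ge) (auto simp: N_simps(1) N_simps(5)[of 4])
  then show "diff 0 4 > 2" by simp
  define s where "s = r - 1"
  have s: "Suc s = r" using r by (simp add: s_def)
  have "4 \<le> k - 1" using k by simp
  note N_last = N_simps(5)[OF this]
  have "j < k \<and> N 2 j \<and> \<not> N (k - 1) j" if "j = s \<or> j = r \<or> j = Suc r" for j
    unfolding N_last N_simps(3) using that s r rk k by linarith
  then have "card {s, r, Suc r} \<le> diff 2 (k - 1)" by (intro diff_ge) simp
  moreover have "card {s, r, Suc r} = 3" using s by auto
  ultimately show "diff 2 (k - 1) > 2" by simp
qed

text \<open>
  If \<open>j' \<ge> 4\<close>, then one of the intervals starting at \<open>j'\<close>, at \<open>j\<close>, or as early as possible before \<open>j'\<close>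
  contains only one of the two columns.
\<close>

lemma nbr_columns_distinct:
  assumes j: "j < j'" "j' < k" and eq: "\<And>x. x < k \<Longrightarrow> N x j \<longleftrightarrow> N x j'"
  shows False
proof (cases "4 \<le> j'")
  case False
  then have "N 0 j \<noteq> N 0 j' \<or> N 2 j \<noteq> N 2 j' \<or> N 3 j \<noteq> N 3 j'" using j r by (auto simp: N_simps)
  then show False using eq[of 0] eq[of 2] eq[of 3] k by auto
next
  case j': True
  have wrap: "j + k < j' + r" using eq[OF j(2)] r j N_simps(5)[OF j'] by auto
  show False
  proof (cases "4 \<le> j")
    case True
    then show False using eq[of j] r rk j wrap N_simps(5)[OF True] by auto
  next
    case False
    \<comment> \<open>the earliest interval that contains \<open>j'\<close>\<close>
    define x where "x = max 4 (j' + 1 - r)"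
    have x: "4 \<le> x" "x < k" "x \<le> j'" "j' < x + r" using r j j' by (auto simp: x_def)
    then have "j + k < x + r" using eq[OF x(2)] N_simps(5)[OF x(1)] False by auto
    then show False using r rk k j by (auto simp: x_def max_def split: if_splits)
  qed
qed

text \<open>
  Row 1 is the only one with no near row.  Row 2 is the only one with two near rows that are ends of
  their path, because the other path has at least four rows.  Distance from row 2 distinguishes the
  ends of the long path and distance from row 4 those of the short one, so no path is reversed.
\<close>

lemma near_preserving_fixes:
  assumes f: "\<And>x. x < k \<Longrightarrow> f x < k" and inj: "\<And>x y. f x = f y \<longleftrightarrow> x = y"
    and surj: "\<And>y. y < k \<Longrightarrow> \<exists>x<k. f x = y"
    and d: "\<And>x y. x < k \<Longrightarrow> y < k \<Longrightarrow> diff (f x) (f y) = diff x y"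
    and x: "x < k"
  shows "f x = x"
proof -
  have near: "near (f x) (f y) \<longleftrightarrow> near x y" if "x < k" "y < k" for x y
    using d[OF that] inj by (auto simp: near_def)
  have img: "\<exists>w<k. near x w \<and> f w = z" if xz: "x < k" "z < k" "near (f x) z" for x z
  proof -
    obtain w where "w < k" "f w = z" using surj[OF xz(2)] by blast
    then show ?thesis using near[OF xz(1)] xz(3) by blast
  qed
  have lt: "f 0 < k" "f 1 < k" "f 2 < k" "f 3 < k" "f 4 < k" using f k by auto
  have f1: "f 1 = 1"
  proof (rule ccontr)
    assume ne: "f 1 \<noteq> 1"
    have "\<exists>z<k. near (f 1) z"
    proof -
      consider "f 1 = 0" | "f 1 = 2" | "f 1 = 3" | "f 1 = 4" | "5 \<le> f 1" using ne by linarith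
      then show ?thesis
      proof cases
        case 1 then show ?thesis using near_iff[of 0 2] k by (intro exI[of _ 2]) simp
      next
        case 2 then show ?thesis using near_iff[of 2 0] k by (intro exI[of _ 0]) simp
      next
        case 3 then show ?thesis using near_iff[of 3 2] k by (intro exI[of _ 2]) simp
      next
        case 4 then show ?thesis using near_iff[of 4 5] k by (intro exI[of _ 5]) simp
      next
        case 5 then show ?thesis using near_iff[of "f 1" "f 1 - 1"] lt(2) by (intro exI[of _ "f 1 - 1"]) auto
      qed
    qed
    then obtain z where "z < k" "near (f 1) z" by blast
    then obtain w where "w < k" "near 1 w" using img[of 1 z] k by auto
    then show False using near_iff[of 1 w] k by auto
  qed
  have n0: "near (f 2) (f 0)" "near (f 2) (f 3)" using near[of 2 0] near[of 2 3] near_iff[of 2 0] near_iff[of 2 3] k by auto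
  have only2: "z = f 2" if z: "z < k" "near (f 0) z \<or> near (f 3) z" for z
  proof -
    obtain w where "w < k" "near 0 w \<or> near 3 w" "f w = z" using img[of 0 z] img[of 3 z] z k by auto
    then show ?thesis using near_iff[of 0 w] near_iff[of 3 w] k by auto
  qed
  have ne: "f 0 \<noteq> f 3" "f 2 \<noteq> f 1" using inj by auto
  have f2: "f 2 = 2"
  proof (rule ccontr)
    assume not2: "f 2 \<noteq> 2"
    have "4 \<le> f 2"
    proof (rule ccontr)
      assume "\<not> 4 \<le> f 2"
      then have "f 2 = 0 \<or> f 2 = 3" using not2 ne(2) f1 by linarith
      then have "f 0 = 2" "f 3 = 2"
        using n0 near_iff[OF lt(3) lt(1)] near_iff[OF lt(3) lt(4)] by auto
      then show False using ne(1) by simp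
    qed
    then have "(f 0 = f 2 + 1 \<and> f 3 + 1 = f 2 \<or> f 3 = f 2 + 1 \<and> f 0 + 1 = f 2)" and ge: "4 \<le> f 0" "4 \<le> f 3"
      using n0 near_iff[OF lt(3) lt(1)] near_iff[OF lt(3) lt(4)] ne(1) by auto
    then obtain a where a: "a = f 0 \<or> a = f 3" "a + 1 = f 2" "4 \<le> a" and b: "f 2 + 1 = f 0 \<or> f 2 + 1 = f 3"
      by (metis add.commute)
    have "a = 4"
    proof (rule ccontr)
      assume "a \<noteq> 4"
      then have "near a (a - 1)" "a - 1 < k" using near_iff[of a "a - 1"] a lt by auto
      then have "a - 1 = f 2" using only2 a(1) by blast
      then show False using a(2) by simp
    qed
    then have "f 2 = 5" using a(2) by simp
    then have "near 6 7" "near (f 0) 7 \<or> near (f 3) 7" using near_iff[of 6 7] b k by auto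
    then have "7 = f 2" using only2[of 7] k by simp
    then show False using \<open>f 2 = 5\<close> by simp
  qed
  have f03: "f 0 = 0 \<or> f 0 = 3" "f 3 = 0 \<or> f 3 = 3"
    using n0 near_iff[of 2 "f 0"] near_iff[of 2 "f 3"] lt f2 k by auto
  have ge4: "4 \<le> f x" if "4 \<le> x" for x
  proof -
    have "f x \<noteq> f 0" "f x \<noteq> f 1" "f x \<noteq> f 2" "f x \<noteq> f 3" "f 0 \<noteq> f 3" using inj that by auto
    then show ?thesis using f03 f1 f2 by linarith
  qed
  have f4: "f 4 = 4"
  proof (rule ccontr)
    assume ne4: "f 4 \<noteq> 4"
    then have g: "5 \<le> f 4" using ge4[of 4] by simp
    have last: "f 4 = k - 1"
    proof (rule ccontr)
      assume "f 4 \<noteq> k - 1"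
      then have s: "Suc (f 4) < k" "f 4 - 1 < k" using lt(5) by auto
      have "near (f 4) (Suc (f 4))" "near (f 4) (f 4 - 1)"
        using near_iff[OF lt(5) s(1)] near_iff[OF lt(5) s(2)] g by auto
      then obtain w w' where "w < k" "near 4 w" "f w = Suc (f 4)" "w' < k" "near 4 w'" "f w' = f 4 - 1"
        using img[of 4 "Suc (f 4)"] img[of 4 "f 4 - 1"] s k by auto
      moreover from this have "w = 5" "w' = 5" using near_iff[of 4 w] near_iff[of 4 w'] k by auto
      ultimately show False by simp
    qed
    have "diff 2 (k - 1) = diff 2 4" using d[of 2 4] f2 last k by simp
    then show False using landmark_diffs by simp
  qed
  have long: "4 + n < k \<longrightarrow> f (4 + n) = 4 + n" for n
  proof (induction n rule: less_induct)
    case (less n)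
    show ?case
    proof
      assume n: "4 + n < k"
      show "f (4 + n) = 4 + n"
      proof (cases n)
        case 0
        then show ?thesis using f4 by simp
      next
        case (Suc m)
        then have m: "m < n" "4 + m < k" "4 + n = Suc (4 + m)" using n by auto
        have fm: "f (4 + m) = 4 + m" using less m by blast
        have "near (4 + m) (4 + n)" using near_iff[OF m(2) n] m(3) by simp
        then have nr: "near (4 + m) (f (4 + n))" using near[OF m(2) n] fm by simp
        have "f (4 + n) \<noteq> 3 + m"
        proof (cases m)
          case 0
          then show ?thesis using ge4[of "4 + n"] by simp
        next
          case (Suc p)
          then have p: "p < n" "4 + p < k" "3 + m = 4 + p" using m by auto
          have "f (4 + p) = 4 + p" using less p by blast
          then have "f (4 + n) = 3 + m \<longleftrightarrow> f (4 + n) = f (4 + p)" using p(3) by simp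
          then show ?thesis using inj p(1) by simp
        qed
        moreover have "f (4 + n) = Suc (4 + m) \<or> 4 + m = Suc (f (4 + n))"
          using near_iff[OF m(2) f[OF n]] nr ge4[of "4 + n"] by auto
        ultimately show ?thesis using m(3) by linarith
      qed
    qed
  qed
  have f0: "f 0 = 0"
  proof (rule ccontr)
    assume "f 0 \<noteq> 0"
    then have "diff 3 4 = diff 0 4" using d[of 0 4] f03 f4 k by simp
    then show False using landmark_diffs by simp
  qed
  then have f3: "f 3 = 3" using f03 ne(1) by auto
  consider "x = 0" | "x = 1" | "x = 2" | "x = 3" | "4 \<le> x" by linarith
  then show ?thesis
  proof cases
    case 5
    then obtain n where "x = 4 + n" using le_Suc_ex by blast
    then show ?thesis using long x by blast
  qed (simp_all only: f0 f1 f2 f3)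
qed

lemma rigid_nbr: "card (mat_aut k (\<lambda>i j. of_bool (N i j) :: int)) = 1"
proof (rule card_mat_aut_eq_1)
  fix \<sigma> \<tau> x assume st: "(\<sigma>, \<tau>) \<in> mat_aut k (\<lambda>i j. of_bool (N i j) :: int)" and x: "x < k"
  note A = mat_autD[OF st]
  have N: "N (\<sigma> i) (\<tau> j) \<longleftrightarrow> N i j" if "i < k" "j < k" for i j using A(5)[OF that] by (simp add: of_bool_eq_iff)
  have p: "\<sigma> permutes {..<k}" "\<tau> permutes {..<k}" using st by (auto simp: mat_aut_def)
  show "\<sigma> x = x"
  proof (rule near_preserving_fixes[OF A(1) A(3) _ _ x])
    show "\<exists>x<k. \<sigma> x = y" if "y < k" for y
      using permutes_image[OF p(1)] that by (metis imageE lessThan_iff)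
    show "diff (\<sigma> x) (\<sigma> y) = diff x y" if xy: "x < k" "y < k" for x y
    proof -
      have "{j. j < k \<and> N (\<sigma> x) j \<and> \<not> N (\<sigma> y) j} = \<tau> ` {j. j < k \<and> N x j \<and> \<not> N y j}"
      proof (intro equalityI subsetI)
        fix j assume j: "j \<in> {j. j < k \<and> N (\<sigma> x) j \<and> \<not> N (\<sigma> y) j}"
        then obtain c where c: "c < k" "\<tau> c = j" using A(6) by blast
        then show "j \<in> \<tau> ` {j. j < k \<and> N x j \<and> \<not> N y j}" using j N[OF xy(1) c(1)] N[OF xy(2) c(1)] by auto
      qed (use A(2) N xy in auto)
      then show ?thesis unfolding diff_def using A(4) by (simp add: card_image inj_on_def)
    qed
  qed
next
  fix j j' assume j: "j < k" "j' < k" and eq: "\<And>i. i < k \<Longrightarrow> (of_bool (N i j) :: int) = of_bool (N i j')"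
  then have "\<And>x. x < k \<Longrightarrow> N x j \<longleftrightarrow> N x j'" by (simp add: of_bool_eq_iff)
  then show "j = j'" using nbr_columns_distinct[of j j'] nbr_columns_distinct[of j' j] j by (metis linorder_neqE_nat)
qed

lemma ex_rigid_sparse:
  "\<exists>D :: nat \<Rightarrow> nat \<Rightarrow> int. line_sums k (int r) D \<and> (\<forall>i j. D i j \<in> {0, 1}) \<and> card (mat_aut k D) = 1"
proof (intro exI conjI)
  let ?D = "\<lambda>i j. of_bool (N i j) :: int"
  show "line_sums k (int r) ?D"
    using card_nbr_row card_nbr_col by (simp add: line_sums_def sum_of_bool_eq Int_def)
  show "\<forall>i j. ?D i j \<in> {0, 1}" by simp
  show "card (mat_aut k ?D) = 1" by (rule rigid_nbr)
qed

end

text \<open>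
  For \<open>2 * c > k\<close> the complementary matrix is used; it has the same symmetries.
\<close>

lemma ex_rigid_regular:
  assumes k: "8 \<le> k" and c: "3 \<le> c" "c + 3 \<le> k"
  obtains D :: "nat \<Rightarrow> nat \<Rightarrow> int" where "line_sums k (int c) D" "\<And>i j. D i j \<in> {-1, 0, 1}"
    "neg_mass k D = 0" "card (mat_aut k D) = 1"
proof -
  have "\<exists>D :: nat \<Rightarrow> nat \<Rightarrow> int. line_sums k (int c) D \<and> (\<forall>i j. D i j \<in> {0, 1}) \<and> card (mat_aut k D) = 1"
  proof (cases "2 * c \<le> k")
    case True
    then show ?thesis using ex_rigid_sparse[OF c(1) _ k] by blast
  next
    case False
    obtain D :: "nat \<Rightarrow> nat \<Rightarrow> int" where D: "line_sums k (int (k - c)) D" "\<forall>i j. D i j \<in> {0, 1}"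
      "card (mat_aut k D) = 1"
    proof -
      have "3 \<le> k - c" "2 * (k - c) \<le> k" using c False by simp_all
      from ex_rigid_sparse[OF this k] show thesis using that by blast
    qed
    let ?D = "\<lambda>i j. 1 - D i j"
    have "line_sums k (int c) ?D" using D(1) c by (simp add: line_sums_def sum_subtractf of_nat_diff)
    moreover have "mat_aut k ?D = mat_aut k D" by (rule mat_aut_cong) simp
    moreover have "?D i j \<in> {0, 1}" for i j using D(2)[rule_format, of i j] by auto
    ultimately show ?thesis using D(3) by metis
  qed
  then obtain D :: "nat \<Rightarrow> nat \<Rightarrow> int" where D: "line_sums k (int c) D" "\<forall>i j. D i j \<in> {0, 1}"
    "card (mat_aut k D) = 1" by blast
  have D01: "D i j = 0 \<or> D i j = 1" for i j using D(2)[rule_format, of i j] by simp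
  have "nat (- D i j) = 0" for i j using D01[of i j] by auto
  then have "neg_mass k D = 0" by (simp add: neg_mass_def)
  moreover have "D i j \<in> {-1, 0, 1}" for i j using D01[of i j] by auto
  ultimately show thesis using that D(1,3) by blast
qed

section \<open>The smallest automorphism group\<close>

text \<open>
  The number of entries -1 in an optimal matrix with line sums \<open>c\<close>.  Each of them cancels an entry 1
  beyond the \<open>k * c\<close> that the line sums require.
\<close>

definition cancellations :: "nat \<Rightarrow> nat \<Rightarrow> nat" where
  "cancellations k c = (if c = 0 then k else if c = 1 then (k + 1) div 2 else if c = 2 then 1 else 0)"

lemma card_mat_aut_ge_cancellations:
  assumes "k \<ge> 2" "line_sums k (int c) D"
  shows "2 ^ (cancellations k c - neg_mass k D) \<le> card (mat_aut k D)"
  using assms card_mat_aut_zero_sums[of k D] card_mat_aut_unit_sums[of k D] card_mat_aut_two_sums[of k D]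
    card_mat_aut_pos[of k D]
  by (auto simp: cancellations_def)

lemma ex_rigid:
  assumes "8 \<le> k" "c + 3 \<le> k"
  obtains D :: "nat \<Rightarrow> nat \<Rightarrow> int" where "line_sums k (int c) D" "\<And>i j. D i j \<in> {-1, 0, 1}"
    "neg_mass k D = cancellations k c" "card (mat_aut k D) = 1"
proof -
  consider "c = 0" | "c = 1" | "c = 2" | "3 \<le> c" by linarith
  then show thesis
  proof cases
    case 1
    have "5 \<le> k" using assms by simp
    from ex_rigid_zero_sums[OF this] show thesis using that 1 by (simp add: cancellations_def) blast
  next
    case 2
    have "7 \<le> k" using assms by simp
    from ex_rigid_unit_sums[OF this] show thesis using that 2 by (simp add: cancellations_def) blast
  next
    case 3
    from ex_rigid_two_sums[OF assms(1)] show thesis using that 3 by (simp add: cancellations_def) blast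
  next
    case 4
    from ex_rigid_regular[OF assms(1) 4 assms(2)] show thesis using that 4 by (simp add: cancellations_def) blast
  qed
qed

lemma cancellations_le:
  assumes "8 \<le> k" "c + 3 \<le> k"
  shows "k * c + 2 * cancellations k c \<le> k ^ 2"
proof -
  have sq: "8 * k \<le> k ^ 2" using assms(1) by (simp add: power2_eq_square)
  consider "c = 0" | "c = 1" | "c = 2" | "3 \<le> c" by linarith
  then show ?thesis
  proof cases
    case 4
    then show ?thesis using assms by (simp add: cancellations_def power2_eq_square)
  qed (use sq assms in \<open>simp_all add: cancellations_def\<close>)
qed

text \<open>
  Size, line sums and negative mass determine how often each of the three values occurs.
\<close>

lemma prod_by_values:
  fixes D :: "nat \<Rightarrow> nat \<Rightarrow> int" and f :: "int \<Rightarrow> nat"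
  assumes D: "line_sums k (int c) D" "\<And>i j. D i j \<in> {-1, 0, 1}"
  shows "(\<Prod>i<k. \<Prod>j<k. f (D i j)) =
    f 1 ^ (k * c + neg_mass k D) * f 0 ^ (k ^ 2 - k * c - 2 * neg_mass k D) * f (-1) ^ neg_mass k D"
proof -
  let ?S = "{..<k} \<times> {..<k}"
  define d where "d = (\<lambda>x. D (fst x) (snd x))"
  define n where "n v = card {x\<in>?S. d x = v}" for v
  have dv: "d x = -1 \<or> d x = 0 \<or> d x = 1" for x using D(2)[of "fst x" "snd x"] by (simp add: d_def)
  have dS: "d ` ?S \<subseteq> {-1, 0, 1}" using dv by auto
  have "(\<Prod>i<k. \<Prod>j<k. f (D i j)) = (\<Prod>x\<in>?S. f (d x))"
    by (simp add: prod.cartesian_product d_def case_prod_beta)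
  also have "\<dots> = (\<Prod>v\<in>{-1, 0, 1}. \<Prod>x\<in>{x\<in>?S. d x = v}. f (d x))"
    by (rule prod.group[symmetric]) (use dS in auto)
  also have "\<dots> = (\<Prod>v\<in>{-1, 0, 1}. f v ^ n v)"
    unfolding n_def by (intro prod.cong refl) simp
  finally have prod: "(\<Prod>i<k. \<Prod>j<k. f (D i j)) = f (-1) ^ n (-1) * (f 0 ^ n 0 * f 1 ^ n 1)"
    by simp
  have "k ^ 2 = (\<Sum>x\<in>?S. 1)" by (simp add: power2_eq_square)
  also have "\<dots> = (\<Sum>v\<in>{-1, 0, 1}. \<Sum>x\<in>{x\<in>?S. d x = v}. 1)"
    by (rule sum.group[symmetric]) (use dS in auto)
  finally have total: "k ^ 2 = n (-1) + (n 0 + n 1)" by (simp add: n_def)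
  have "neg_mass k D = (\<Sum>x\<in>?S. nat (- d x))"
    by (simp add: neg_mass_def sum.cartesian_product d_def case_prod_beta)
  also have "\<dots> = (\<Sum>v\<in>{-1, 0, 1}. \<Sum>x\<in>{x\<in>?S. d x = v}. nat (- d x))"
    by (rule sum.group[symmetric]) (use dS in auto)
  also have "\<dots> = (\<Sum>v\<in>{-1, 0, 1}. n v * nat (- v))"
    unfolding n_def by (intro sum.cong refl) simp
  finally have neg: "neg_mass k D = n (-1)" by simp
  have "int (k * c) = (\<Sum>i<k. \<Sum>j<k. D i j)"
    using D(1) by (simp add: line_sums_def)
  also have "\<dots> = (\<Sum>x\<in>?S. d x)"
    by (simp add: sum.cartesian_product d_def case_prod_beta)
  also have "\<dots> = (\<Sum>v\<in>{-1, 0, 1}. \<Sum>x\<in>{x\<in>?S. d x = v}. d x)"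
    by (rule sum.group[symmetric]) (use dS in auto)
  also have "\<dots> = (\<Sum>v\<in>{-1, 0, 1}. int (n v) * v)"
    unfolding n_def by (intro sum.cong refl) simp
  finally have "int (k * c) = int (n 1) - int (n (-1))" by simp
  then have "n 1 = k * c + neg_mass k D" using neg by linarith
  moreover from this have "n 0 = k ^ 2 - k * c - 2 * neg_mass k D" using total neg by linarith
  ultimately show ?thesis using prod neg by (simp add: mult_ac)
qed

lemma fact_power_identity:
  assumes "Q \<ge> 1"
  shows "fact (Q + 1) ^ a * fact Q ^ m * fact (Q - 1) ^ b * Q ^ b = fact Q ^ (a + m + b) * (Q + 1 :: nat) ^ a"
proof -
  define F :: nat where "F = fact Q"
  have 1: "fact (Q + 1) = (Q + 1) * F" by (simp add: F_def)
  have "F = fact (Q - 1) * Q"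
    using assms fact_reduce[of Q, where 'a = nat] by (simp add: F_def mult.commute)
  then have 2: "fact (Q - 1) ^ b * Q ^ b = F ^ b" by (simp add: power_mult_distrib)
  have "fact (Q + 1) ^ a * fact Q ^ m * fact (Q - 1) ^ b * Q ^ b = ((Q + 1) * F) ^ a * F ^ m * F ^ b"
    unfolding 1 by (simp only: F_def[symmetric] mult.assoc 2)
  also have "\<dots> = F ^ (a + m + b) * (Q + 1) ^ a"
    by (simp only: power_mult_distrib power_add mult_ac)
  finally show ?thesis by (simp only: F_def)
qed

lemma chi_eqI:
  assumes "t \<in> aut_orders k l" "\<And>n. n \<in> aut_orders k l \<Longrightarrow> t \<le> n"
  shows "chi k l = t"
  unfolding chi_def using assms by (intro Min_eqI finite_aut_orders) auto

text \<open>
  The sign \<open>\<epsilon>\<close> treats excess and defect together: \<open>D\<close> has line sums \<open>c \<ge> 0\<close> in both cases, and only the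
  roles of the weights \<open>Q + 1\<close> and \<open>1 / Q\<close> are exchanged.  For \<open>Q = 0\<close> the value is 1 and the lower
  bound is trivial.
\<close>

lemma chi_deviation:
  fixes k l c Q :: nat and \<epsilon> :: int
  defines "h \<equiv> cancellations k c"
  assumes k: "8 \<le> k" and c: "c + 3 \<le> k" and l: "l \<ge> 1" and \<epsilon>: "\<epsilon> = 1 \<or> \<epsilon> = -1"
    and eq: "int l = int Q * int k + \<epsilon> * int c" and Q: "Q \<ge> 1 \<or> \<epsilon> = 1 \<and> 3 \<le> c"
  shows "chi k l = fact (nat (int Q + \<epsilon>)) ^ (k * c + h) * fact Q ^ (k ^ 2 - k * c - 2 * h)
    * fact (nat (int Q - \<epsilon>)) ^ h" (is "chi k l = ?t")
proof (rule chi_eqI)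
  obtain D :: "nat \<Rightarrow> nat \<Rightarrow> int" where D: "line_sums k (int c) D" "\<And>i j. D i j \<in> {-1, 0, 1}"
    "neg_mass k D = h" "card (mat_aut k D) = 1"
    using ex_rigid[OF k c] unfolding h_def by blast
  define M where "M i j = nat (int Q + \<epsilon> * D i j)" for i j
  have M: "int (M i j) = int Q + \<epsilon> * D i j" if "i < k" "j < k" for i j
  proof -
    have D3: "D i j = -1 \<or> D i j = 0 \<or> D i j = 1" using D(2)[of i j] by simp
    have "int Q + \<epsilon> * D i j \<ge> 0"
    proof (cases "Q \<ge> 1")
      case True
      then show ?thesis using D3 \<epsilon> by auto
    next
      case False
      then have "\<epsilon> = 1" "h = 0" using Q by (auto simp: h_def cancellations_def)
      then have "D i j \<ge> 0" using D(3) that by (auto simp: neg_mass_def)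
      then show ?thesis using \<open>\<epsilon> = 1\<close> by simp
    qed
    then show ?thesis by (simp add: M_def)
  qed
  have "int (\<Sum>j<k. M i j) = int l" "int (\<Sum>j<k. M j i) = int l" if "i < k" for i
    using D(1) that eq M unfolding of_nat_sum
    by (simp_all add: line_sums_def sum.distrib flip: sum_distrib_left)
  then have lM: "line_sums k l M" by (simp add: line_sums_def del: of_nat_sum)
  have "M i j = M i' j' \<longleftrightarrow> D i j = D i' j'" if "i < k" "j < k" "i' < k" "j' < k" for i j i' j'
    using M[OF that(1,2)] M[OF that(3,4)] \<epsilon> by auto
  then have "mat_aut k M = mat_aut k D" by (rule mat_aut_cong)
  then have "card (mat_aut k M) = 1" using D(4) by simp
  moreover have "(\<Prod>i<k. \<Prod>j<k. fact (M i j)) = ?t"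
    using prod_by_values[OF D(1,2), of "\<lambda>d. fact (nat (int Q + \<epsilon> * d))"] D(3) by (simp add: M_def)
  ultimately show "?t \<in> aut_orders k l" using aut_ordersI[OF lM l] by simp
next
  fix n assume "n \<in> aut_orders k l"
  then obtain M where M: "line_sums k l M" and n: "n = card (mat_aut k M) * (\<Prod>i<k. \<Prod>j<k. fact (M i j))"
    using aut_ordersE[OF _ l] by metis
  let ?X = "\<Prod>i<k. \<Prod>j<k. fact (M i j) :: nat"
  have X: "?X \<ge> 1" by (simp add: Suc_le_eq prod_pos)
  show "?t \<le> n"
  proof (cases "Q \<ge> 1")
    case False
    then have "\<epsilon> = 1" "h = 0" "Q = 0" using Q by (auto simp: h_def cancellations_def)
    then have "?t = 1" by simp
    also have "1 \<le> n" unfolding n using card_mat_aut_pos[of k M] X by (simp add: Suc_le_eq)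
    finally show ?thesis .
  next
    case Q1: True
    define D where "D i j = \<epsilon> * (int (M i j) - int Q)" for i j
    define up dn where "up = (\<Sum>i<k. \<Sum>j<k. M i j - Q)" and "dn = (\<Sum>i<k. \<Sum>j<k. Q - M i j)"
    have sums: "(\<Sum>j<k. int (M i j)) = int l" "(\<Sum>j<k. int (M j i)) = int l" if "i < k" for i
      using M that unfolding line_sums_def by (simp_all flip: of_nat_sum)
    have \<epsilon>2: "\<epsilon> * \<epsilon> = 1" using \<epsilon> by auto
    have "\<epsilon> * (int l - int k * int Q) = int c" using eq \<epsilon>2 by (simp add: mult.commute flip: mult.assoc)
    then have D: "line_sums k (int c) D"
      using sums by (simp add: line_sums_def D_def sum_subtractf flip: sum_distrib_left)
    have "int up - int dn = (\<Sum>i<k. \<Sum>j<k. int (M i j) - int Q)"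
      unfolding up_def dn_def of_nat_sum sum_subtractf[symmetric] by (intro sum.cong refl) auto
    also have "\<dots> = int k * (int l - int k * int Q)" using sums by (simp add: sum_subtractf)
    also have "\<dots> = \<epsilon> * int (k * c)" using eq by (simp add: mult_ac)
    finally have bal: "int up - int dn = \<epsilon> * int (k * c)" .
    have A: "2 ^ (h - neg_mass k D) \<le> card (mat_aut k M)"
    proof -
      have "mat_aut k M = mat_aut k D" by (rule mat_aut_cong) (use \<epsilon> in \<open>auto simp: D_def\<close>)
      then show ?thesis using card_mat_aut_ge_cancellations[OF _ D] k by (simp add: h_def)
    qed
    have W: "fact Q ^ (k ^ 2) * (Q + 1) ^ up \<le> ?X * Q ^ dn"
      unfolding up_def dn_def by (rule prod_fact_weight)
    have le: "k * c + 2 * h \<le> k ^ 2" unfolding h_def by (rule cancellations_le[OF k c])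
    show ?thesis
    proof (cases "\<epsilon> = 1")
      case True
      have nd: "neg_mass k D = dn"
        unfolding neg_mass_def dn_def D_def True by (intro sum.cong refl) (simp add: nat_minus_as_int)
      have "int up = int (k * c + dn)" using bal True by simp
      then have "up = k * c + dn" by (simp only: of_nat_eq_iff)
      then have W': "fact Q ^ (k ^ 2) * (Q + 1) ^ (k * c + dn) \<le> ?X * Q ^ (0 + dn)" using W by simp
      have "nat (int Q + \<epsilon>) = Q + 1" "nat (int Q - \<epsilon>) = Q - 1" using True Q1 by simp_all
      then have t: "?t * Q ^ (0 + h) = fact Q ^ (k ^ 2) * (Q + 1) ^ (k * c + h)"
        using fact_power_identity[OF Q1, of "k * c + h" "k ^ 2 - k * c - 2 * h" h] le by simp
      show ?thesis unfolding n by (rule weight_tradeoff[OF Q1 W' t A[unfolded nd]])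
    next
      case False
      then have e: "\<epsilon> = -1" using \<epsilon> by simp
      have nd: "neg_mass k D = up"
        unfolding neg_mass_def up_def D_def e by (intro sum.cong refl) simp
      have "int dn = int (k * c + up)" using bal e by simp
      then have "dn = k * c + up" by (simp only: of_nat_eq_iff)
      then have W': "fact Q ^ (k ^ 2) * (Q + 1) ^ (0 + up) \<le> ?X * Q ^ (k * c + up)" using W by simp
      have "nat (int Q + \<epsilon>) = Q - 1" "nat (int Q - \<epsilon>) = Q + 1" using e Q1 by simp_all
      then have t: "?t * Q ^ (k * c + h) = fact Q ^ (k ^ 2) * (Q + 1) ^ (0 + h)"
        using fact_power_identity[OF Q1, of h "k ^ 2 - k * c - 2 * h" "k * c + h"] le by (simp add: mult_ac)
      show ?thesis unfolding n by (rule weight_tradeoff[OF Q1 W' t A[unfolded nd]])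
    qed
  qed
qed

theorem theorem1p1:
  fixes k l :: nat and q r :: int
  assumes "k \<ge> 8" and "l \<ge> 2"
    and "int l = q * int k + r"
    and "-2 \<le> r" and "r \<le> int k - 3"
  shows "mu k l = fact k * fact l ^ k \<and>
    (l = 2 \<longrightarrow> chi k l = 2 * k) \<and>
    (l \<noteq> 2 \<longrightarrow>
      (r = 0 \<longrightarrow>
        chi k l = fact (nat (q + 1)) ^ k * fact (nat q) ^ (k^2 - 2 * k) * fact (nat (q - 1)) ^ k) \<and>
      (3 \<le> r \<and> r \<le> int k - 3 \<longrightarrow>
        chi k l = fact (nat (q + 1)) ^ (nat r * k) * fact (nat q) ^ (k^2 - nat r * k)) \<and>
      (r = 1 \<or> r = -1 \<longrightarrow>
        chi k l = fact (nat (q + r)) ^ (k + nat \<lceil>real k / 2\<rceil>)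
          * fact (nat q) ^ (k^2 - k - 2 * nat \<lceil>real k / 2\<rceil>)
          * fact (nat (q - r)) ^ nat \<lceil>real k / 2\<rceil>) \<and>
      (\<forall>\<epsilon>\<in>{1, -1}. r = 2 * \<epsilon> \<longrightarrow>
        chi k l = fact (nat (q + \<epsilon>)) ^ (2 * k + 1)
          * fact (nat q) ^ (k^2 - 2 * k - 2)
          * fact (nat (q - \<epsilon>))))"
proof -
  have q: "q \<ge> 0"
  proof (rule ccontr)
    assume "\<not> q \<ge> 0"
    then have "q * int k \<le> (-1) * int k" by (intro mult_right_mono) auto
    then show False using assms by linarith
  qed
  define Q where "Q = nat q"
  have qQ: "q = int Q" using q by (simp add: Q_def)
  have q1: "Q \<ge> 1" if "l \<noteq> 2" "r < 3"
  proof (rule ccontr)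
    assume "\<not> Q \<ge> 1"
    then have "int l = r" using assms(3) qQ by simp
    then show False using assms(2) that by linarith
  qed
  have l1: "1 \<le> l" using assms(2) by simp
  have ceil: "nat \<lceil>real k / 2\<rceil> = (k + 1) div 2" by linarith
  note dev = chi_deviation[OF assms(1) _ l1]
  show ?thesis
  proof (intro conjI impI ballI)
    show "mu k l = fact k * fact l ^ k" by (rule mu_eq[OF l1])
  next
    assume "l = 2"
    then show "chi k l = 2 * k" using chi_2 assms(1) by simp
  next
    assume l2: "l \<noteq> 2" and r: "r = 0"
    have "chi k l = fact (nat (int Q + 1)) ^ (k * 0 + cancellations k 0) * fact Q ^ (k ^ 2 - k * 0 - 2 * cancellations k 0)
      * fact (nat (int Q - 1)) ^ cancellations k 0"
      by (rule dev) (use assms r q1 l2 qQ in auto)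
    then show "chi k l = fact (nat (q + 1)) ^ k * fact (nat q) ^ (k^2 - 2 * k) * fact (nat (q - 1)) ^ k"
      by (simp add: cancellations_def qQ)
  next
    assume l2: "l \<noteq> 2" and r: "3 \<le> r \<and> r \<le> int k - 3"
    define c where "c = nat r"
    have rc: "r = int c" "3 \<le> c" "c + 3 \<le> k" using r by (auto simp: c_def)
    have "chi k l = fact (nat (int Q + 1)) ^ (k * c + cancellations k c) * fact Q ^ (k ^ 2 - k * c - 2 * cancellations k c)
      * fact (nat (int Q - 1)) ^ cancellations k c"
      by (rule dev) (use assms rc qQ in auto)
    then show "chi k l = fact (nat (q + 1)) ^ (nat r * k) * fact (nat q) ^ (k^2 - nat r * k)"
      using rc by (simp add: cancellations_def qQ mult.commute)
  next
    assume l2: "l \<noteq> 2" and r: "r = 1 \<or> r = -1"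
    have "chi k l = fact (nat (int Q + r)) ^ (k * 1 + cancellations k 1) * fact Q ^ (k ^ 2 - k * 1 - 2 * cancellations k 1)
      * fact (nat (int Q - r)) ^ cancellations k 1"
      by (rule dev) (use assms r q1 l2 qQ in auto)
    then show "chi k l = fact (nat (q + r)) ^ (k + nat \<lceil>real k / 2\<rceil>)
          * fact (nat q) ^ (k^2 - k - 2 * nat \<lceil>real k / 2\<rceil>)
          * fact (nat (q - r)) ^ nat \<lceil>real k / 2\<rceil>"
      unfolding ceil by (simp add: cancellations_def qQ)
  next
    fix \<epsilon> :: int assume l2: "l \<noteq> 2" and \<epsilon>: "\<epsilon> \<in> {1, -1}" and r: "r = 2 * \<epsilon>"
    have "chi k l = fact (nat (int Q + \<epsilon>)) ^ (k * 2 + cancellations k 2) * fact Q ^ (k ^ 2 - k * 2 - 2 * cancellations k 2)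
      * fact (nat (int Q - \<epsilon>)) ^ cancellations k 2"
      by (rule dev) (use assms r q1 l2 qQ \<epsilon> in auto)
    then show "chi k l = fact (nat (q + \<epsilon>)) ^ (2 * k + 1) * fact (nat q) ^ (k^2 - 2 * k - 2) * fact (nat (q - \<epsilon>))"
      by (simp add: cancellations_def qQ mult.commute)
  qed
qed

end
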